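(* Let $\mathbf{Stone}$ be the category of Stone spaces (zero-dimensional compact Hausdorff spaces) and continuous maps. Up to equivalence, $\mathbf{Stone}$ is the unique non-trivial well-powered positive and coherent category which is well-pointed, strongly filtral and complete. That is: $\mathbf{Stone}$ is a well-powered, non-trivial, positive coherent category which is well-pointed, strongly filtral and complete; and any category with all of these properties is equivalent to $\mathbf{Stone}$.
   Context: Subobjects. A subobject of $X$ is an equivalence class of monomorphisms into $X$, where $m_1\sim m_2$ iff each factors through the other; $\mathrm{Sub}(X)$ is the poset of subobjects of $X$, with $m_1\le m_2$ iff $m_1$ factors through $m_2$. A category is well-powered if every $\mathrm{Sub}(X)$ is a set. For $f\colon X\to Y$ in a category with pullbacks, $f^*\colon \mathrm{Sub}(Y)\to\mathrm{Sub}(X)$ is pullback along $f$. The image of $f\colon X\to Y$ is the smallest subobject of $Y$ through which $f$ factors. Regular, coherent, positive. A regular category is a category with finite limits in which every morphism has an image and image factorisations are stable under pullback. A coherent category is a regular category in which every $\mathrm{Sub}(X)$ has finite joins (including a bottom element) and every $f^*$ preserves them. In a coherent category each $\mathrm{Sub}(X)$ is a bounded distributive lattice and there is a strict initial object $\mathbf{0}$ (the least element of $\mathrm{Sub}(\mathbf{1})$, $\mathbf{1}$ the terminal object). The category is non-trivial if $\mathbf{0}\not\cong\mathbf{1}$. A coherent category is positive if it has finite coproducts and they are disjoint, i.e. for all $X_1,X_2$ the pullback of one coproduct injection into $X_1+X_2$ along the other is the initial object. Well-pointed. A category with terminal object $\mathbf{1}$ is well-pointed if the functor $\mathrm{pt}=\mathrm{Hom}(\mathbf{1},-)$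 to $\mathbf{Set}$ is faithful. Filtral. For a bounded distributive lattice $L$, let $\mathcal{C}(L)$ be the Boolean algebra of complemented elements of $L$, and for a bounded distributive lattice $M$ let $\mathcal{F}(M)$ be the set of all non-empty filters of $M$ (the improper filter included), ordered by reverse inclusion. $L$ is filtral if the map $L\to\mathcal{F}(\mathcal{C}(L))$, $x\mapsto \{y\in \mathcal{C}(L)\mid x\le y\}$, is an isomorphism of posets. An object $X$ of a coherent category is filtral if the lattice $\mathrm{Sub}(X)$ is filtral. A coherent category is strongly filtral if every object of it is filtral. Complete means having all small limits. *)

theory Defs
  imports "HOL-Analysis.Analysis" "HOL-Algebra.Lattice"
begin

unbundle cardinal_syntax

section \<open>Size\<close>

text \<open>
  HOL has no proper classes, so ``set versus class'' is read relative to a Grothendieck universe,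
  given by a type \<open>'u\<close> whose cardinality is strongly inaccessible: a set (over any type) is
  \<^emph>\<open>small\<close> if it has fewer elements than \<open>'u\<close>.  Every small set is then in bijection with a
  small subset of \<open>'u\<close>.
\<close>

definition inaccessible :: "'u itself \<Rightarrow> bool" where
  "inaccessible _ \<longleftrightarrow>
     |UNIV :: nat set| <o |UNIV :: 'u set| \<and>
     regularCard |UNIV :: 'u set| \<and>
     (\<forall>A :: 'u set. |A| <o |UNIV :: 'u set| \<longrightarrow> |Pow A| <o |UNIV :: 'u set| )"

definition small :: "'u itself \<Rightarrow> 'x set \<Rightarrow> bool" where
  "small _ A \<longleftrightarrow> |A| <o |UNIV :: 'u set|"


section \<open>Categories, functors, equivalences\<close>

text \<open>\<open>Comp C g f\<close> is the composite ``\<open>g\<close> after \<open>f\<close>''.\<close>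

record ('o, 'a) cat =
  Obj :: "'o set"
  Arr :: "'a set"
  Dom :: "'a \<Rightarrow> 'o"
  Cod :: "'a \<Rightarrow> 'o"
  Ident :: "'o \<Rightarrow> 'a"
  Comp :: "'a \<Rightarrow> 'a \<Rightarrow> 'a"

definition Hom :: "('o, 'a) cat \<Rightarrow> 'o \<Rightarrow> 'o \<Rightarrow> 'a set" where
  "Hom C X Y = {f \<in> Arr C. Dom C f = X \<and> Cod C f = Y}"

locale category =
  fixes C :: "('o, 'a) cat"
  assumes dom_in_obj: "f \<in> Arr C \<Longrightarrow> Dom C f \<in> Obj C"
    and cod_in_obj: "f \<in> Arr C \<Longrightarrow> Cod C f \<in> Obj C"
    and ident_in_hom: "X \<in> Obj C \<Longrightarrow> Ident C X \<in> Hom C X X"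
    and comp_in_hom: "f \<in> Hom C X Y \<Longrightarrow> g \<in> Hom C Y Z \<Longrightarrow> Comp C g f \<in> Hom C X Z"
    and comp_ident_right: "f \<in> Hom C X Y \<Longrightarrow> Comp C f (Ident C X) = f"
    and comp_ident_left: "f \<in> Hom C X Y \<Longrightarrow> Comp C (Ident C Y) f = f"
    and comp_assoc: "f \<in> Hom C W X \<Longrightarrow> g \<in> Hom C X Y \<Longrightarrow> h \<in> Hom C Y Z \<Longrightarrow>
      Comp C h (Comp C g f) = Comp C (Comp C h g) f"

definition is_iso :: "('o, 'a) cat \<Rightarrow> 'a \<Rightarrow> bool" where
  "is_iso C f \<longleftrightarrow> f \<in> Arr C \<and>
     (\<exists>g \<in> Hom C (Cod C f) (Dom C f).
        Comp C g f = Ident C (Dom C f) \<and> Comp C f g = Ident C (Cod C f))"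

definition isomorphic_objects :: "('o, 'a) cat \<Rightarrow> 'o \<Rightarrow> 'o \<Rightarrow> bool" where
  "isomorphic_objects C X Y \<longleftrightarrow> (\<exists>f \<in> Hom C X Y. is_iso C f)"

record ('o, 'a, 'p, 'b) fctr =
  omap :: "'o \<Rightarrow> 'p"
  amap :: "'a \<Rightarrow> 'b"

definition is_functor ::
  "('o, 'a) cat \<Rightarrow> ('p, 'b) cat \<Rightarrow> ('o, 'a, 'p, 'b) fctr \<Rightarrow> bool" where
  "is_functor C D F \<longleftrightarrow>
     (\<forall>X \<in> Obj C. omap F X \<in> Obj D) \<and>
     (\<forall>f \<in> Arr C. amap F f \<in> Hom D (omap F (Dom C f)) (omap F (Cod C f))) \<and>
     (\<forall>X \<in> Obj C. amap F (Ident C X) = Ident D (omap F X)) \<and>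
     (\<forall>f \<in> Arr C. \<forall>g \<in> Arr C. Dom C g = Cod C f \<longrightarrow>
        amap F (Comp C g f) = Comp D (amap F g) (amap F f))"

definition faithful_functor ::
  "('o, 'a) cat \<Rightarrow> ('p, 'b) cat \<Rightarrow> ('o, 'a, 'p, 'b) fctr \<Rightarrow> bool" where
  "faithful_functor C D F \<longleftrightarrow> is_functor C D F \<and>
     (\<forall>X \<in> Obj C. \<forall>Y \<in> Obj C. inj_on (amap F) (Hom C X Y))"

definition id_functor :: "('o, 'a, 'o, 'a) fctr" where
  "id_functor = \<lparr>omap = (\<lambda>X. X), amap = (\<lambda>f. f)\<rparr>"

definition comp_functor ::
  "('p, 'b, 'q, 'c) fctr \<Rightarrow> ('o, 'a, 'p, 'b) fctr \<Rightarrow> ('o, 'a, 'q, 'c) fctr" where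
  "comp_functor G F = \<lparr>omap = omap G \<circ> omap F, amap = amap G \<circ> amap F\<rparr>"

definition naturally_isomorphic ::
  "('o, 'a) cat \<Rightarrow> ('p, 'b) cat \<Rightarrow> ('o, 'a, 'p, 'b) fctr \<Rightarrow> ('o, 'a, 'p, 'b) fctr \<Rightarrow> bool" where
  "naturally_isomorphic C D F G \<longleftrightarrow>
     (\<exists>\<eta>. (\<forall>X \<in> Obj C. \<eta> X \<in> Hom D (omap F X) (omap G X) \<and> is_iso D (\<eta> X)) \<and>
          (\<forall>f \<in> Arr C. Comp D (\<eta> (Cod C f)) (amap F f) = Comp D (amap G f) (\<eta> (Dom C f))))"

definition equivalent_categories :: "('o, 'a) cat \<Rightarrow> ('p, 'b) cat \<Rightarrow> bool" where
  "equivalent_categories C D \<longleftrightarrow>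
     (\<exists>F G. is_functor C D F \<and> is_functor D C G \<and>
        naturally_isomorphic C C (comp_functor G F) id_functor \<and>
        naturally_isomorphic D D (comp_functor F G) id_functor)"


section \<open>Limits and coproducts\<close>

definition is_cone ::
  "('j, 'b) cat \<Rightarrow> ('o, 'a) cat \<Rightarrow> ('j, 'b, 'o, 'a) fctr \<Rightarrow> 'o \<Rightarrow> ('j \<Rightarrow> 'a) \<Rightarrow> bool" where
  "is_cone J C D L \<mu> \<longleftrightarrow> L \<in> Obj C \<and>
     (\<forall>j \<in> Obj J. \<mu> j \<in> Hom C L (omap D j)) \<and>
     (\<forall>u \<in> Arr J. Comp C (amap D u) (\<mu> (Dom J u)) = \<mu> (Cod J u))"

definition is_limit ::
  "('j, 'b) cat \<Rightarrow> ('o, 'a) cat \<Rightarrow> ('j, 'b, 'o, 'a) fctr \<Rightarrow> 'o \<Rightarrow> ('j \<Rightarrow> 'a) \<Rightarrow> bool" where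
  "is_limit J C D L \<mu> \<longleftrightarrow> is_cone J C D L \<mu> \<and>
     (\<forall>K \<nu>. is_cone J C D K \<nu> \<longrightarrow>
        (\<exists>!h. h \<in> Hom C K L \<and> (\<forall>j \<in> Obj J. Comp C (\<mu> j) h = \<nu> j)))"

definition has_limits_of_shape :: "('j, 'b) cat \<Rightarrow> ('o, 'a) cat \<Rightarrow> bool" where
  "has_limits_of_shape J C \<longleftrightarrow> (\<forall>D. is_functor J C D \<longrightarrow> (\<exists>L \<mu>. is_limit J C D L \<mu>))"

text \<open>
  Up to isomorphism, every finite (small) category has its objects and arrows in \<open>nat\<close> (in \<open>'u\<close>),
  so these two types of shapes lose no generality.
\<close>

definition has_finite_limits :: "('o, 'a) cat \<Rightarrow> bool" where
  "has_finite_limits C \<longleftrightarrow>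
     (\<forall>J :: (nat, nat) cat. category J \<and> finite (Obj J) \<and> finite (Arr J) \<longrightarrow>
        has_limits_of_shape J C)"

definition complete_category :: "'u itself \<Rightarrow> ('o, 'a) cat \<Rightarrow> bool" where
  "complete_category U C \<longleftrightarrow>
     (\<forall>J :: ('u, 'u) cat. category J \<and> small U (Obj J) \<and> small U (Arr J) \<longrightarrow>
        has_limits_of_shape J C)"

definition is_terminal :: "('o, 'a) cat \<Rightarrow> 'o \<Rightarrow> bool" where
  "is_terminal C T \<longleftrightarrow> T \<in> Obj C \<and> (\<forall>X \<in> Obj C. \<exists>!f. f \<in> Hom C X T)"

definition is_initial :: "('o, 'a) cat \<Rightarrow> 'o \<Rightarrow> bool" where
  "is_initial C Z \<longleftrightarrow> Z \<in> Obj C \<and> (\<forall>X \<in> Obj C. \<exists>!f. f \<in> Hom C Z X)"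

text \<open>\<open>is_pullback C f g p q\<close>: the square \<open>f \<circ> p = g \<circ> q\<close> is a pullback; \<open>q\<close> is the pullback of
  \<open>f\<close> along \<open>g\<close>.\<close>

definition is_pullback :: "('o, 'a) cat \<Rightarrow> 'a \<Rightarrow> 'a \<Rightarrow> 'a \<Rightarrow> 'a \<Rightarrow> bool" where
  "is_pullback C f g p q \<longleftrightarrow>
     f \<in> Arr C \<and> g \<in> Arr C \<and> Cod C f = Cod C g \<and>
     p \<in> Arr C \<and> q \<in> Arr C \<and> Dom C p = Dom C q \<and>
     Cod C p = Dom C f \<and> Cod C q = Dom C g \<and> Comp C f p = Comp C g q \<and>
     (\<forall>W. \<forall>a \<in> Hom C W (Dom C f). \<forall>b \<in> Hom C W (Dom C g). Comp C f a = Comp C g b \<longrightarrow>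
        (\<exists>!h. h \<in> Hom C W (Dom C p) \<and> Comp C p h = a \<and> Comp C q h = b))"

definition is_coproduct ::
  "('o, 'a) cat \<Rightarrow> 'i set \<Rightarrow> ('i \<Rightarrow> 'o) \<Rightarrow> 'o \<Rightarrow> ('i \<Rightarrow> 'a) \<Rightarrow> bool" where
  "is_coproduct C I X S \<iota> \<longleftrightarrow> S \<in> Obj C \<and> (\<forall>i \<in> I. X i \<in> Obj C \<and> \<iota> i \<in> Hom C (X i) S) \<and>
     (\<forall>Y \<in> Obj C. \<forall>\<phi>. (\<forall>i \<in> I. \<phi> i \<in> Hom C (X i) Y) \<longrightarrow>
        (\<exists>!h. h \<in> Hom C S Y \<and> (\<forall>i \<in> I. Comp C h (\<iota> i) = \<phi> i)))"

definition has_finite_coproducts :: "('o, 'a) cat \<Rightarrow> bool" where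
  "has_finite_coproducts C \<longleftrightarrow>
     (\<forall>(n :: nat) X. (\<forall>i < n. X i \<in> Obj C) \<longrightarrow> (\<exists>S \<iota>. is_coproduct C {..<n} X S \<iota>))"


section \<open>Subobjects\<close>

definition is_mono :: "('o, 'a) cat \<Rightarrow> 'a \<Rightarrow> bool" where
  "is_mono C m \<longleftrightarrow> m \<in> Arr C \<and>
     (\<forall>W. \<forall>f \<in> Hom C W (Dom C m). \<forall>g \<in> Hom C W (Dom C m).
        Comp C m f = Comp C m g \<longrightarrow> f = g)"

definition factors_through :: "('o, 'a) cat \<Rightarrow> 'a \<Rightarrow> 'a \<Rightarrow> bool" where
  "factors_through C f m \<longleftrightarrow> (\<exists>h \<in> Hom C (Dom C f) (Dom C m). Comp C m h = f)"

definition monos_into :: "('o, 'a) cat \<Rightarrow> 'o \<Rightarrow> 'a set" where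
  "monos_into C X = {m. is_mono C m \<and> Cod C m = X}"

definition subobject_rel :: "('o, 'a) cat \<Rightarrow> 'o \<Rightarrow> ('a \<times> 'a) set" where
  "subobject_rel C X = {(m, n). m \<in> monos_into C X \<and> n \<in> monos_into C X \<and>
     factors_through C m n \<and> factors_through C n m}"

definition Sub :: "('o, 'a) cat \<Rightarrow> 'o \<Rightarrow> 'a set gorder" where
  "Sub C X = \<lparr>carrier = monos_into C X // subobject_rel C X, eq = (=),
     le = (\<lambda>S T. \<exists>m \<in> S. \<exists>n \<in> T. factors_through C m n)\<rparr>"

definition well_powered :: "'u itself \<Rightarrow> ('o, 'a) cat \<Rightarrow> bool" where
  "well_powered U C \<longleftrightarrow> (\<forall>X \<in> Obj C. small U (carrier (Sub C X)))"

text \<open>The map \<open>f\<^sup>*\<close>: the equivalence class of the pullbacks along \<open>f\<close> of the monomorphisms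
  representing \<open>S\<close>.\<close>

definition pullback_sub :: "('o, 'a) cat \<Rightarrow> 'a \<Rightarrow> 'a set \<Rightarrow> 'a set" where
  "pullback_sub C f S = {n. \<exists>m \<in> S. \<exists>p. is_pullback C m f p n}"

definition is_image :: "('o, 'a) cat \<Rightarrow> 'a \<Rightarrow> 'a set \<Rightarrow> bool" where
  "is_image C f S \<longleftrightarrow>
     least (Sub C (Cod C f)) S
       {T \<in> carrier (Sub C (Cod C f)). \<exists>m \<in> T. factors_through C f m}"


section \<open>Regular, coherent, positive categories\<close>

text \<open>Stability of image factorisations: if \<open>q\<close> is the pullback of \<open>f\<close> along \<open>g\<close>, then the
  image of \<open>q\<close> is the pullback along \<open>g\<close> of the image of \<open>f\<close>.\<close>

definition regular_category :: "('o, 'a) cat \<Rightarrow> bool" where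
  "regular_category C \<longleftrightarrow> category C \<and> has_finite_limits C \<and>
     (\<forall>f \<in> Arr C. \<exists>S. is_image C f S) \<and>
     (\<forall>f g p q S. is_pullback C f g p q \<and> is_image C f S \<longrightarrow> is_image C q (pullback_sub C g S))"

text \<open>The case \<open>A = {}\<close> below gives bottom elements and their preservation.\<close>

definition coherent_category :: "('o, 'a) cat \<Rightarrow> bool" where
  "coherent_category C \<longleftrightarrow> regular_category C \<and>
     (\<forall>X \<in> Obj C. \<forall>A \<subseteq> carrier (Sub C X). finite A \<longrightarrow> (\<exists>S. is_lub (Sub C X) S A)) \<and>
     (\<forall>f \<in> Arr C. \<forall>A \<subseteq> carrier (Sub C (Cod C f)). \<forall>S.
        finite A \<and> is_lub (Sub C (Cod C f)) S A \<longrightarrow>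
        is_lub (Sub C (Dom C f)) (pullback_sub C f S) (pullback_sub C f ` A))"

definition positive_category :: "('o, 'a) cat \<Rightarrow> bool" where
  "positive_category C \<longleftrightarrow> coherent_category C \<and> has_finite_coproducts C \<and>
     (\<forall>X S \<iota> p q. is_coproduct C {0, 1 :: nat} X S \<iota> \<and> is_pullback C (\<iota> 0) (\<iota> 1) p q \<longrightarrow>
        is_initial C (Dom C p))"

definition non_trivial :: "('o, 'a) cat \<Rightarrow> bool" where
  "non_trivial C \<longleftrightarrow>
     (\<exists>Z T. is_initial C Z \<and> is_terminal C T \<and> \<not> isomorphic_objects C Z T)"


section \<open>Well-pointed categories\<close>

text \<open>The category of small subsets of the type \<open>'x\<close>; an arrow is a function together with its
  domain and codomain, the function being \<open>undefined\<close> off its domain.\<close>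

definition set_cat :: "'u itself \<Rightarrow> ('x set, 'x set \<times> ('x \<Rightarrow> 'x) \<times> 'x set) cat" where
  "set_cat U = \<lparr>
     Obj = {A. small U A},
     Arr = {(A, f, B). small U A \<and> small U B \<and> f \<in> A \<rightarrow>\<^sub>E B},
     Dom = (\<lambda>(A, f, B). A),
     Cod = (\<lambda>(A, f, B). B),
     Ident = (\<lambda>A. (A, restrict (\<lambda>x. x) A, A)),
     Comp = (\<lambda>(B, g, D) (A, f, B'). (A, compose A g f, D))\<rparr>"

definition pt :: "('o, 'a) cat \<Rightarrow> 'o \<Rightarrow> ('o, 'a, 'a set, 'a set \<times> ('a \<Rightarrow> 'a) \<times> 'a set) fctr" where
  "pt C T = \<lparr>
     omap = (\<lambda>X. Hom C T X),
     amap = (\<lambda>f. (Hom C T (Dom C f),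
                  restrict (\<lambda>x. Comp C f x) (Hom C T (Dom C f)),
                  Hom C T (Cod C f)))\<rparr>"

text \<open>That \<open>pt C T\<close> is a functor into \<open>set_cat U\<close> includes that each \<open>Hom C T X\<close> is small.\<close>

definition well_pointed :: "'u itself \<Rightarrow> ('o, 'a) cat \<Rightarrow> bool" where
  "well_pointed U C \<longleftrightarrow> (\<exists>T. is_terminal C T) \<and>
     (\<forall>T. is_terminal C T \<longrightarrow> faithful_functor C (set_cat U) (pt C T))"


section \<open>Filtral lattices and categories\<close>

definition complemented_part :: "'x gorder \<Rightarrow> 'x gorder" where
  "complemented_part L = \<lparr>
     carrier = {x \<in> carrier L. \<exists>y \<in> carrier L.
       x \<sqinter>\<^bsub>L\<^esub> y = \<bottom>\<^bsub>L\<^esub> \<and> x \<squnion>\<^bsub>L\<^esub> y = \<top>\<^bsub>L\<^esub>},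
     eq = (=), le = le L\<rparr>"

definition filters_of :: "'x gorder \<Rightarrow> 'x set gorder" where
  "filters_of M = \<lparr>
     carrier = {F. F \<subseteq> carrier M \<and> F \<noteq> {} \<and>
       (\<forall>x \<in> F. \<forall>y \<in> carrier M. x \<sqsubseteq>\<^bsub>M\<^esub> y \<longrightarrow> y \<in> F) \<and>
       (\<forall>x \<in> F. \<forall>y \<in> F. x \<sqinter>\<^bsub>M\<^esub> y \<in> F)},
     eq = (=), le = (\<lambda>F G. G \<subseteq> F)\<rparr>"

text \<open>Only meaningful for bounded distributive lattices \<open>L\<close>, such as \<open>Sub C X\<close> for coherent \<open>C\<close>.\<close>

definition filtral_lattice :: "'x gorder \<Rightarrow> bool" where
  "filtral_lattice L \<longleftrightarrow>
     (let \<phi> = (\<lambda>x. {y \<in> carrier (complemented_part L). x \<sqsubseteq>\<^bsub>L\<^esub> y});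
          F = filters_of (complemented_part L)
      in order_emb L F \<phi> \<and> bij_betw \<phi> (carrier L) (carrier F))"

definition strongly_filtral :: "('o, 'a) cat \<Rightarrow> bool" where
  "strongly_filtral C \<longleftrightarrow> (\<forall>X \<in> Obj C. filtral_lattice (Sub C X))"


section \<open>Stone spaces\<close>

definition Stone_space :: "'x topology \<Rightarrow> bool" where
  "Stone_space X \<longleftrightarrow> compact_space X \<and> Hausdorff_space X \<and>
     neighbourhood_base_of (\<lambda>V. closedin X V \<and> openin X V) X"

text \<open>Every small Stone space is homeomorphic to one whose points are elements of \<open>'u\<close>, so
  restricting the underlying sets to subsets of \<open>'u\<close> loses no generality.\<close>

definition Stone :: "('u topology, 'u topology \<times> ('u \<Rightarrow> 'u) \<times> 'u topology) cat" where
  "Stone = \<lparr>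
     Obj = {X. Stone_space X \<and> small TYPE('u) (topspace X)},
     Arr = {(X, f, Y). Stone_space X \<and> small TYPE('u) (topspace X) \<and>
                       Stone_space Y \<and> small TYPE('u) (topspace Y) \<and>
                       continuous_map X Y f \<and> f \<in> extensional (topspace X)},
     Dom = (\<lambda>(X, f, Y). X),
     Cod = (\<lambda>(X, f, Y). Y),
     Ident = (\<lambda>X. (X, restrict (\<lambda>x. x) (topspace X), X)),
     Comp = (\<lambda>(Y, g, Z) (X, f, Y'). (X, compose (topspace X) g f, Z))\<rparr>"

end

theory Submission
  imports Defs
begin

text \<open>
  In \<open>Stone\<close> the subobjects of \<open>X\<close> are the closed subsets of \<open>X\<close>, with pullback as preimage, and a
  closed subset of a Stone space is the same thing as a filter of clopen subsets.

  Conversely, let \<open>C\<close> have the listed properties, with terminal object \<open>1\<close>.  An object \<open>X\<close> without points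
  is initial: the two injections of \<open>X\<close> into \<open>X + X\<close> agree by well-pointedness, but are disjoint.
  Hence the points of \<open>X\<close> are the atoms of \<open>Sub X\<close>, and by filtrality a subobject is determined by
  its points, so that \<open>Sub X\<close> is the lattice of closed sets of a Stone topology on \<open>Hom(1, X)\<close>.  This
  defines a faithful functor to \<open>Stone\<close>.  It is full because the graph of a continuous map is a
  closed set of points of \<open>X \<times> Y\<close>, that is, a subobject, whose projection to \<open>X\<close> is bijective on points and
  therefore invertible.  It is essentially surjective because every Stone space is a closed
  subspace of a power of a two-point space, and such a power is the spectrum of a power of \<open>1 + 1\<close>.
\<close>

section \<open>Small sets\<close>

text \<open>The obstacle is that \<open>spec\<close> is not known in advance to preserve products.
  Compactness replaces preservation: the projections of a product \<open>P\<close> separate its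
  points, so they embed the compact space \<open>spec P\<close> into the product of the spectra, and
  a map into \<open>spec P\<close> is continuous once its components are. The two halves of
  filtrality do different work. That the map from \<open>Sub X\<close> to filters is an embedding
  makes a subobject the meet of the complemented ones above it, which is why points determine it;
  that the map is surjective supplies the arbitrary intersections and the compactness of the
  topology. Coherence supplies the finite unions: a join can be pulled back along a point to
  \<open>Sub T\<close>, \<open>T\<close> being the terminal object, where a subobject either
  contains the only point of \<open>T\<close>, and is then everything, or has no points, and lies
  below all others. On the Stone side, closedness of ranges turns every question about subobjects
  into one about closed sets, and points of a pullback are found by maps from the one-point
  space.\<close>

lemma small_inj:
  assumes "small U B" "inj_on f A" "f ` A \<subseteq> B"
  shows "small U A"
  using assms card_of_ordLeq[of A B] ordLeq_ordLess_trans unfolding small_def by blast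

lemma small_subset: "small U B \<Longrightarrow> A \<subseteq> B \<Longrightarrow> small U A"
  by (rule small_inj[where f = id]) auto

lemma small_image: "small U A \<Longrightarrow> small U (f ` A)"
  unfolding small_def using card_of_image ordLeq_ordLess_trans by blast

lemma small_code:
  fixes A :: "'x set"
  assumes "small TYPE('u) A"
  obtains c :: "'x \<Rightarrow> 'u" where "inj_on c A"
proof -
  have "|A| \<le>o |UNIV :: 'u set|"
    using assms ordLess_imp_ordLeq unfolding small_def by blast
  then show thesis
    using that card_of_ordLeq[of A "UNIV :: 'u set"] by blast
qed

lemma inaccessible_infinite:
  assumes "inaccessible TYPE('u)"
  shows "infinite (UNIV :: 'u set)"
  using assms infinite_iff_card_of_nat ordLess_imp_ordLeq unfolding inaccessible_def by blast

lemma inaccessible_two_elements: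
  assumes "inaccessible TYPE('u)"
  obtains a b :: 'u where "a \<noteq> b"
proof -
  have "(UNIV :: 'u set) \<noteq> {undefined}"
    using inaccessible_infinite[OF assms] by (metis finite.emptyI finite_insert)
  then show thesis using that by blast
qed

lemma small_finite:
  assumes "inaccessible TYPE('u)" "finite A"
  shows "small TYPE('u) A"
  using inaccessible_infinite[OF assms(1)] assms(2)
    finite_ordLess_infinite[of "|A|" "|UNIV :: 'u set|", OF card_of_Well_order card_of_Well_order]
  unfolding small_def by (simp add: Field_card_of)

text \<open>Inaccessibility speaks only of subsets of \<open>'u\<close>, so \<open>A\<close> is
  first copied into \<open>'u\<close> by an injection.\<close>

lemma small_Pow:
  fixes A :: "'x set"
  assumes "inaccessible TYPE('u)" "small TYPE('u) A"
  shows "small TYPE('u) (Pow A)"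
proof -
  obtain c :: "'x \<Rightarrow> 'u" where c: "inj_on c A"
    using small_code assms(2) by blast
  have "small TYPE('u) (c ` A)"
    using assms(2) by (rule small_image)
  then have "small TYPE('u) (Pow (c ` A))"
    using assms(1) unfolding inaccessible_def small_def by blast
  then show ?thesis
    by (rule small_inj[where f = "(`) c"]) (use c inj_on_image_Pow in auto)
qed

text \<open>Regularity of the universe enters here: an infinite regular cardinal is stable under
  unions of fewer sets of smaller size.\<close>

lemma small_UN:
  fixes I :: "'i set" and A :: "'i \<Rightarrow> 'x set"
  assumes "inaccessible TYPE('u)" "small TYPE('u) I" "\<And>i. i \<in> I \<Longrightarrow> small TYPE('u) (A i)"
  shows "small TYPE('u) (\<Union>i\<in>I. A i)"
proof -
  have "stable |UNIV :: 'u set|"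
    using assms(1) inaccessible_infinite[OF assms(1)] regularCard_stable[OF card_of_Card_order]
    unfolding inaccessible_def by (metis Field_card_of)
  then show ?thesis
    using assms(2,3) stable_UNION unfolding small_def by blast
qed

lemma small_Sigma:
  fixes I :: "'i set" and A :: "'i \<Rightarrow> 'x set"
  assumes "inaccessible TYPE('u)" "small TYPE('u) I" "\<And>i. i \<in> I \<Longrightarrow> small TYPE('u) (A i)"
  shows "small TYPE('u) (Sigma I A)"
proof -
  have "Sigma I A = (\<Union>i\<in>I. Pair i ` A i)" by auto
  then show ?thesis
    using small_UN[OF assms(1,2), of "\<lambda>i. Pair i ` A i"] assms(3) small_image by metis
qed

text \<open>An extensional function is determined by its graph, a subset of
  \<open>Sigma I A\<close>, so the product is no larger than a power set.\<close>

lemma small_PiE: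
  fixes I :: "'i set" and A :: "'i \<Rightarrow> 'x set"
  assumes "inaccessible TYPE('u)" "small TYPE('u) I" "\<And>i. i \<in> I \<Longrightarrow> small TYPE('u) (A i)"
  shows "small TYPE('u) (PiE I A)"
proof (rule small_inj)
  show "small TYPE('u) (Pow (Sigma I A))"
    using assms by (intro small_Pow small_Sigma)
  let ?g = "\<lambda>f. (\<lambda>i. (i, f i)) ` I"
  show "inj_on ?g (PiE I A)"
  proof (rule inj_onI)
    fix f g assume "f \<in> PiE I A" "g \<in> PiE I A" and eq: "?g f = ?g g"
    moreover have "f i = g i" if "i \<in> I" for i
      using eq that by blast
    ultimately show "f = g" by (blast intro: PiE_ext)
  qed
  show "?g ` PiE I A \<subseteq> Pow (Sigma I A)" by auto
qed


section \<open>Stone spaces\<close>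

definition clopen_in :: "'x topology \<Rightarrow> 'x set \<Rightarrow> bool" where
  "clopen_in X V \<longleftrightarrow> closedin X V \<and> openin X V"

lemma clopen_in_complement: "clopen_in X V \<Longrightarrow> clopen_in X (topspace X - V)"
  unfolding clopen_in_def by blast

lemma clopen_in_Inter:
  "finite \<F> \<Longrightarrow> \<F> \<noteq> {} \<Longrightarrow> (\<And>V. V \<in> \<F> \<Longrightarrow> clopen_in X V) \<Longrightarrow> clopen_in X (\<Inter>\<F>)"
  unfolding clopen_in_def by (meson closedin_Inter openin_Inter)

lemma clopen_in_preimage:
  "continuous_map X Y f \<Longrightarrow> clopen_in Y V \<Longrightarrow> clopen_in X {x \<in> topspace X. f x \<in> V}"
  unfolding clopen_in_def
  by (simp add: closedin_continuous_map_preimage openin_continuous_map_preimage)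

lemma Stone_space_compact: "Stone_space X \<Longrightarrow> compact_space X"
  and Stone_space_Hausdorff: "Stone_space X \<Longrightarrow> Hausdorff_space X"
  unfolding Stone_space_def by auto

lemma Stone_space_clopen_nbhd:
  assumes "Stone_space X" "openin X W" "x \<in> W"
  obtains V where "clopen_in X V" "x \<in> V" "V \<subseteq> W"
proof -
  have "neighbourhood_base_of (clopen_in X) X"
    using assms(1) unfolding Stone_space_def clopen_in_def by simp
  then show thesis
    using assms(2,3) that unfolding neighbourhood_base_of by (meson subsetD)
qed

lemma Stone_space_clopen_separation:
  assumes "Stone_space X" "closedin X K" "x \<in> topspace X" "x \<notin> K"
  obtains V where "clopen_in X V" "K \<subseteq> V" "x \<notin> V"
proof -
  have op: "openin X (topspace X - K)" and x: "x \<in> topspace X - K"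
    using assms by auto
  obtain V where "clopen_in X V" "x \<in> V" "V \<subseteq> topspace X - K"
    by (rule Stone_space_clopen_nbhd[OF assms(1) op x])
  then show thesis
    using that[of "topspace X - V"] clopen_in_complement closedin_subset[OF assms(2)] by blast
qed

text \<open>Compactness upgrades separation of points to a clopen base: the complement of a
  neighbourhood of \<open>x\<close> is compact and covered by the complements of clopen sets around
  \<open>x\<close>, and finitely many of these suffice.\<close>

lemma Stone_spaceI:
  assumes comp: "compact_space X"
    and sep: "\<And>x y. x \<in> topspace X \<Longrightarrow> y \<in> topspace X \<Longrightarrow> x \<noteq> y \<Longrightarrow>
      \<exists>V. clopen_in X V \<and> x \<in> V \<and> y \<notin> V"
  shows "Stone_space X"
proof -
  have "Hausdorff_space X"
    unfolding Hausdorff_space_def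
  proof (intro allI impI, elim conjE)
    fix x y assume "x \<in> topspace X" "y \<in> topspace X" "x \<noteq> y"
    then obtain V where "clopen_in X V" "x \<in> V" "y \<notin> V"
      using sep by blast
    then show "\<exists>U V. openin X U \<and> openin X V \<and> x \<in> U \<and> y \<in> V \<and> disjnt U V"
      using \<open>y \<in> topspace X\<close> unfolding clopen_in_def disjnt_def
      by (intro exI[of _ V] exI[of _ "topspace X - V"]) auto
  qed
  moreover have "\<exists>U V. openin X U \<and> clopen_in X V \<and> x \<in> U \<and> U \<subseteq> V \<and> V \<subseteq> W"
    if W: "openin X W" "x \<in> W" for W x
  proof -
    have xX: "x \<in> topspace X" using W openin_subset by blast
    let ?\<U> = "{topspace X - V |V. clopen_in X V \<and> x \<in> V}"
    have "compactin X (topspace X - W)"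
      using comp W(1) closedin_compact_space by blast
    moreover have "\<forall>U\<in>?\<U>. openin X U"
      unfolding clopen_in_def by auto
    moreover have "topspace X - W \<subseteq> \<Union>?\<U>"
    proof
      fix y assume y: "y \<in> topspace X - W"
      then have "y \<in> topspace X" "x \<noteq> y" using W by auto
      then obtain V where "clopen_in X V" "x \<in> V" "y \<notin> V" using sep xX by blast
      then show "y \<in> \<Union>?\<U>" using y by blast
    qed
    ultimately obtain \<G> where \<G>: "finite \<G>" "\<G> \<subseteq> ?\<U>" "topspace X - W \<subseteq> \<Union>\<G>"
      unfolding compactin_def by meson
    \<comment> \<open>Inserting \<open>topspace X\<close> keeps the intersection inside the space
      when the subcover \<open>\<G>\<close> is empty.\<close>
    let ?V = "\<Inter>(insert (topspace X) ((-) (topspace X) ` \<G>))"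
    have "clopen_in X ?V"
    proof (rule clopen_in_Inter)
      fix V assume "V \<in> insert (topspace X) ((-) (topspace X) ` \<G>)"
      then consider "V = topspace X" | G where "G \<in> \<G>" "V = topspace X - G" by auto
      then show "clopen_in X V"
      proof cases
        case 1 then show ?thesis unfolding clopen_in_def by simp
      next
        case 2
        then obtain V' where "clopen_in X V'" "G = topspace X - V'" using \<G>(2) by blast
        then show ?thesis using 2 clopen_in_complement by metis
      qed
    qed (use \<G>(1) in auto)
    moreover have "x \<in> ?V" using xX \<G>(2) by auto
    moreover have "?V \<subseteq> W" using \<G>(3) by auto
    moreover have "openin X ?V" using \<open>clopen_in X ?V\<close> clopen_in_def by blast
    ultimately show ?thesis by blast
  qed
  ultimately show ?thesis
    using comp unfolding Stone_space_def neighbourhood_base_of clopen_in_def by blast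
qed

text \<open>Closed subspaces, products and homeomorphic copies are all recognised as Stone by this
  criterion. The targets \<open>Y\<close> may vary with the two points but share one type, which is
  fixed at each use.\<close>

lemma Stone_space_separating_maps:
  assumes "compact_space X"
    and "\<And>x y. x \<in> topspace X \<Longrightarrow> y \<in> topspace X \<Longrightarrow> x \<noteq> y \<Longrightarrow>
      \<exists>(Y :: 'y topology) f. Stone_space Y \<and> continuous_map X Y f \<and> f x \<noteq> f y"
  shows "Stone_space X"
proof (rule Stone_spaceI[OF assms(1)])
  fix x y assume x: "x \<in> topspace X" and y: "y \<in> topspace X" and xy: "x \<noteq> y"
  obtain Y :: "'y topology" and f where
    Y: "Stone_space Y" and f: "continuous_map X Y f" "f x \<noteq> f y"
    using assms(2)[OF x y xy] by (elim exE conjE)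
  have fx: "f x \<in> topspace Y" "f y \<in> topspace Y"
    using continuous_map_funspace[OF f(1)] x y by auto
  have cl: "closedin Y {f x}"
    using closedin_Hausdorff_singleton[OF Stone_space_Hausdorff[OF Y] fx(1)] .
  have "f y \<notin> {f x}" using f(2) by simp
  obtain V where V: "clopen_in Y V" "{f x} \<subseteq> V" "f y \<notin> V"
    by (rule Stone_space_clopen_separation[OF Y cl fx(2) \<open>f y \<notin> {f x}\<close>])
  have "clopen_in X {z \<in> topspace X. f z \<in> V}"
    by (rule clopen_in_preimage[OF f(1) V(1)])
  then show "\<exists>V. clopen_in X V \<and> x \<in> V \<and> y \<notin> V"
    using V x by (intro exI[of _ "{z \<in> topspace X. f z \<in> V}"]) auto
qed

lemma Stone_space_subtopology:
  fixes X :: "'a topology"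
  assumes "Stone_space X" "closedin X K"
  shows "Stone_space (subtopology X K)"
proof (rule Stone_space_separating_maps[where 'y = 'a])
  show "compact_space (subtopology X K)"
    using assms Stone_space_compact closedin_compact_space compact_space_subtopology by blast
  show "\<exists>(Y :: 'a topology) f. Stone_space Y \<and> continuous_map (subtopology X K) Y f \<and> f x \<noteq> f y" if "x \<noteq> y" for x y
    using assms(1) that continuous_map_from_subtopology[OF continuous_map_id, of X K]
    by (intro exI[of _ X] exI[of _ id]) auto
qed

lemma Stone_space_product:
  fixes Y :: "'i \<Rightarrow> 'b topology"
  assumes "\<And>i. i \<in> I \<Longrightarrow> Stone_space (Y i)"
  shows "Stone_space (product_topology Y I)"
proof (rule Stone_space_separating_maps[where 'y = 'b])
  show "compact_space (product_topology Y I)"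
    using assms Stone_space_compact compact_space_product_topology by blast
  fix x y assume "x \<in> topspace (product_topology Y I)" "y \<in> topspace (product_topology Y I)" "x \<noteq> y"
  then obtain i where i: "i \<in> I" "x i \<noteq> y i"
    by (metis PiE_ext topspace_product_topology)
  show "\<exists>(Z :: 'b topology) f. Stone_space Z \<and> continuous_map (product_topology Y I) Z f \<and> f x \<noteq> f y"
  proof (intro exI conjI)
    show "Stone_space (Y i)" using assms i by blast
    show "continuous_map (product_topology Y I) (Y i) (\<lambda>x. x i)"
      using i(1) by (rule continuous_map_product_projection)
    show "x i \<noteq> y i" by (rule i(2))
  qed
qed

lemma Stone_space_discrete: "finite S \<Longrightarrow> Stone_space (discrete_topology S)"
  by (rule Stone_spaceI)
    (auto simp: compact_space_discrete_topology clopen_in_def closedin_discrete_topology)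

lemma homeomorphic_Stone_space:
  fixes X :: "'a topology" and Y :: "'b topology"
  assumes "Stone_space X" "homeomorphic_map X Y h"
  shows "Stone_space Y"
proof -
  obtain g where g: "continuous_map Y X g" "\<forall>y\<in>topspace Y. h (g y) = y"
    using assms(2) unfolding homeomorphic_map_maps homeomorphic_maps_def by blast
  show ?thesis
  proof (rule Stone_space_separating_maps[where 'y = 'a])
    show "compact_space Y"
      using assms Stone_space_compact homeomorphic_compact_space homeomorphic_map_imp_homeomorphic_space
      by blast
    fix x y assume "x \<in> topspace Y" "y \<in> topspace Y" "x \<noteq> y"
    then have "g x \<noteq> g y" using g(2) by metis
    then show "\<exists>(Z :: 'a topology) f. Stone_space Z \<and> continuous_map Y Z f \<and> f x \<noteq> f y"
      by (intro exI[of _ X] exI[of _ g]) (simp add: assms(1) g(1))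
  qed
qed

text \<open>The maps \<open>f i\<close> embed the compact space \<open>X\<close> into the product of the \<open>Y i\<close>.\<close>

lemma continuous_map_into_compact:
  assumes X: "compact_space X"
    and Y: "\<And>i. i \<in> I \<Longrightarrow> Hausdorff_space (Y i)"
    and f: "\<And>i. i \<in> I \<Longrightarrow> continuous_map X (Y i) (f i)"
    and sep: "\<And>x y. x \<in> topspace X \<Longrightarrow> y \<in> topspace X \<Longrightarrow> (\<And>i. i \<in> I \<Longrightarrow> f i x = f i y) \<Longrightarrow> x = y"
    and h: "h \<in> topspace Z \<rightarrow> topspace X"
    and fh: "\<And>i. i \<in> I \<Longrightarrow> continuous_map Z (Y i) (\<lambda>z. f i (h z))"
  shows "continuous_map Z X h"
proof -
  let ?P = "product_topology Y I"
  let ?e = "\<lambda>x. restrict (\<lambda>i. f i x) I"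
  have e: "continuous_map X ?P ?e"
    unfolding continuous_map_componentwise using f by auto
  have inj: "inj_on ?e (topspace X)"
  proof (rule inj_onI)
    fix x y assume x: "x \<in> topspace X" and y: "y \<in> topspace X" and eq: "?e x = ?e y"
    have "f i x = f i y" if "i \<in> I" for i
      using fun_cong[OF eq, of i] that by simp
    then show "x = y" by (rule sep[OF x y])
  qed
  have "Hausdorff_space ?P"
    using Y by (simp add: Hausdorff_space_product_topology)
  \<comment> \<open>A continuous map from a compact to a Hausdorff space is closed. Being also
    injective, \<open>?e\<close> makes each closed set of \<open>X\<close> the preimage of a closed
    set of \<open>?P\<close>, which reduces continuity of \<open>h\<close> to that of
    \<open>?e\<close> after \<open>h\<close>.\<close>
  then have emb: "closed_map X ?P ?e"
    using X e continuous_imp_closed_map by blast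
  have eh: "continuous_map Z ?P (\<lambda>z. ?e (h z))"
    unfolding continuous_map_componentwise using fh by auto
  show ?thesis
    unfolding continuous_map_closedin
  proof (intro conjI allI impI)
    show "h \<in> topspace Z \<rightarrow> topspace X" by (rule h)
    fix K assume K: "closedin X K"
    then have "closedin ?P (?e ` K)" using emb by (simp add: closed_map_def)
    then have "closedin Z {z \<in> topspace Z. ?e (h z) \<in> ?e ` K}"
      by (rule closedin_continuous_map_preimage[OF eh])
    moreover have "?e (h z) \<in> ?e ` K \<longleftrightarrow> h z \<in> K" if "z \<in> topspace Z" for z
      using inj_on_image_mem_iff[OF inj] h that closedin_subset[OF K] by blast
    ultimately show "closedin Z {z \<in> topspace Z. h z \<in> K}"
      by (smt (verit, best) Collect_cong)
  qed
qed

text \<open>One injective map in place of a family. It makes inverses and factorisations continuous: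
  only their composite with \<open>f\<close> has to be checked.\<close>

lemma continuous_map_inj_reflect:
  assumes "compact_space X" "Hausdorff_space Y" "continuous_map X Y f" "inj_on f (topspace X)"
    and "h \<in> topspace Z \<rightarrow> topspace X" "continuous_map Z Y (\<lambda>z. f (h z))"
  shows "continuous_map Z X h"
  using assms
  by (intro continuous_map_into_compact[of X "{()}" "\<lambda>_. Y" "\<lambda>_. f"]) (auto dest: inj_onD)

text \<open>Products and sums live on larger types than \<open>'u\<close>. Smallness of the point
  set lets the topology be carried back along an injection into \<open>'u\<close>.\<close>

lemma Stone_space_code:
  fixes W :: "'x topology"
  assumes "Stone_space W" "small TYPE('u) (topspace W)"
  obtains X :: "'u topology" and h where
    "Stone_space X" "small TYPE('u) (topspace X)" "homeomorphic_map W X h"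
proof -
  obtain c :: "'x \<Rightarrow> 'u" where c: "inj_on c (topspace W)"
    using small_code assms(2) by blast
  let ?g = "inv_into (topspace W) c"
  let ?X = "pullback_topology (c ` topspace W) ?g W"
  have tX: "topspace ?X = c ` topspace W"
    using c by (auto simp: topspace_pullback_topology)
  have gc: "?g (c x) = x" if "x \<in> topspace W" for x
    using that c by simp
  have "homeomorphic_maps W ?X c ?g"
    unfolding homeomorphic_maps_def
  proof (intro conjI)
    show "continuous_map W ?X c"
      by (rule continuous_map_pullback'[where f = ?g])
        (use gc in \<open>auto intro: continuous_map_eq[OF continuous_map_id]\<close>)
    show "continuous_map ?X W ?g"
      using continuous_map_pullback[OF continuous_map_id] by (metis id_comp)
  qed (use tX gc c in auto)
  then have "homeomorphic_map W ?X c"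
    using homeomorphic_map_maps by blast
  then show thesis
    using that assms homeomorphic_Stone_space small_image tX by metis
qed

section \<open>Lattices of sets\<close>

definition set_filter :: "'p set set \<Rightarrow> 'p set set \<Rightarrow> bool" where
  "set_filter \<B> \<G> \<longleftrightarrow> \<G> \<subseteq> \<B> \<and> \<G> \<noteq> {} \<and>
     (\<forall>A\<in>\<G>. \<forall>B\<in>\<B>. A \<subseteq> B \<longrightarrow> B \<in> \<G>) \<and> (\<forall>A\<in>\<G>. \<forall>B\<in>\<G>. A \<inter> B \<in> \<G>)"

text \<open>A subobject is a class of arrows, so \<open>Sub C X\<close> is not literally a family of
  subsets of a space. The coding \<open>e\<close> presents it as one, which turns lattice
  operations, complements and filters into set operations. It serves for closed sets of a Stone
  space and for sets of points of an abstract object.\<close>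

locale lattice_of_sets =
  fixes L :: "'x gorder" and e :: "'p set \<Rightarrow> 'x" and \<K> :: "'p set set" and P :: "'p set"
  assumes eq_L: "eq L = (=)"
    and carrier_L: "carrier L = e ` \<K>"
    and le_L: "A \<in> \<K> \<Longrightarrow> B \<in> \<K> \<Longrightarrow> le L (e A) (e B) \<longleftrightarrow> A \<subseteq> B"
    and Int_in: "A \<in> \<K> \<Longrightarrow> B \<in> \<K> \<Longrightarrow> A \<inter> B \<in> \<K>"
    and Un_in: "A \<in> \<K> \<Longrightarrow> B \<in> \<K> \<Longrightarrow> A \<union> B \<in> \<K>"
    and empty_in: "{} \<in> \<K>"
    and space_in: "P \<in> \<K>"
    and sub_space: "A \<in> \<K> \<Longrightarrow> A \<subseteq> P"
begin

lemma e_eq_iff: "A \<in> \<K> \<Longrightarrow> B \<in> \<K> \<Longrightarrow> e A = e B \<longleftrightarrow> A = B"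
  using le_L by (metis subset_antisym subset_refl)

lemma inj_e: "inj_on e \<K>"
  using e_eq_iff by (auto intro: inj_onI)

lemma weak_partial_order_L: "weak_partial_order L"
  by unfold_locales (auto simp: eq_L carrier_L le_L e_eq_iff)

lemma Lower_L:
  "\<A> \<subseteq> \<K> \<Longrightarrow> Lower L (e ` \<A>) = e ` {B \<in> \<K>. \<forall>A\<in>\<A>. B \<subseteq> A}"
proof -
  assume \<A>: "\<A> \<subseteq> \<K>"
  then have "e ` \<A> \<inter> e ` \<K> = e ` \<A>" by blast
  then have "Lower L (e ` \<A>) = {l \<in> e ` \<K>. \<forall>x\<in>e ` \<A>. l \<sqsubseteq>\<^bsub>L\<^esub> x}"
    unfolding Lower_def carrier_L by auto
  also have "\<dots> = e ` {B \<in> \<K>. \<forall>A\<in>\<A>. e B \<sqsubseteq>\<^bsub>L\<^esub> e A}" by auto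
  also have "\<dots> = e ` {B \<in> \<K>. \<forall>A\<in>\<A>. B \<subseteq> A}"
    using \<A> le_L by (intro arg_cong[where f = "(`) e"] Collect_cong) (simp cong: conj_cong add: subset_eq[of \<A>])
  finally show ?thesis .
qed

lemma Upper_L:
  "\<A> \<subseteq> \<K> \<Longrightarrow> Upper L (e ` \<A>) = e ` {B \<in> \<K>. \<forall>A\<in>\<A>. A \<subseteq> B}"
proof -
  assume \<A>: "\<A> \<subseteq> \<K>"
  then have "e ` \<A> \<inter> e ` \<K> = e ` \<A>" by blast
  then have "Upper L (e ` \<A>) = {u \<in> e ` \<K>. \<forall>x\<in>e ` \<A>. x \<sqsubseteq>\<^bsub>L\<^esub> u}"
    unfolding Upper_def carrier_L by auto
  also have "\<dots> = e ` {B \<in> \<K>. \<forall>A\<in>\<A>. e A \<sqsubseteq>\<^bsub>L\<^esub> e B}" by auto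
  also have "\<dots> = e ` {B \<in> \<K>. \<forall>A\<in>\<A>. A \<subseteq> B}"
    using \<A> le_L by (intro arg_cong[where f = "(`) e"] Collect_cong) (simp cong: conj_cong add: subset_eq[of \<A>])
  finally show ?thesis .
qed

lemma least_L:
  "\<A> \<subseteq> \<K> \<Longrightarrow> least L x (e ` \<A>) \<longleftrightarrow> (\<exists>A\<in>\<A>. x = e A \<and> (\<forall>B\<in>\<A>. A \<subseteq> B))"
  unfolding least_def carrier_L using le_L by (auto simp: subset_iff)

lemma greatest_L:
  "\<A> \<subseteq> \<K> \<Longrightarrow> greatest L x (e ` \<A>) \<longleftrightarrow> (\<exists>A\<in>\<A>. x = e A \<and> (\<forall>B\<in>\<A>. B \<subseteq> A))"
  unfolding greatest_def carrier_L using le_L by (auto simp: subset_iff)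

lemma meet_L:
  assumes "A \<in> \<K>" "B \<in> \<K>"
  shows "e A \<sqinter>\<^bsub>L\<^esub> e B = e (A \<inter> B)"
proof -
  \<comment> \<open>The meet is a value of \<open>SOME\<close>; showing that exactly one
    \<open>x\<close> qualifies determines it. Join, bottom and top are treated alike.\<close>
  have "greatest L x (Lower L {e A, e B}) \<longleftrightarrow> x = e (A \<inter> B)" for x
  proof -
    have L: "Lower L {e A, e B} = e ` {D \<in> \<K>. D \<subseteq> A \<and> D \<subseteq> B}"
      using Lower_L[of "{A, B}"] assms by simp
    show ?thesis
      unfolding L using assms Int_in[OF assms] by (subst greatest_L) (auto intro!: arg_cong[where f = e])
  qed
  then show ?thesis
    unfolding meet_def inf_def by simp
qed

lemma join_L:
  assumes "A \<in> \<K>" "B \<in> \<K>"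
  shows "e A \<squnion>\<^bsub>L\<^esub> e B = e (A \<union> B)"
proof -
  have "least L x (Upper L {e A, e B}) \<longleftrightarrow> x = e (A \<union> B)" for x
  proof -
    have L: "Upper L {e A, e B} = e ` {D \<in> \<K>. A \<subseteq> D \<and> B \<subseteq> D}"
      using Upper_L[of "{A, B}"] assms by simp
    show ?thesis
      unfolding L using assms Un_in[OF assms] by (subst least_L) (auto intro!: arg_cong[where f = e])
  qed
  then show ?thesis
    unfolding join_def sup_def by simp
qed

lemma bottom_L: "\<bottom>\<^bsub>L\<^esub> = e {}"
proof -
  have "least L x (carrier L) \<longleftrightarrow> x = e {}" for x
    unfolding carrier_L using empty_in by (subst least_L) auto
  then show ?thesis unfolding bottom_def by simp
qed

lemma top_L: "\<top>\<^bsub>L\<^esub> = e P"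
proof -
  have "greatest L x (carrier L) \<longleftrightarrow> x = e P" for x
    unfolding carrier_L using space_in sub_space
    by (subst greatest_L) (auto intro!: arg_cong[where f = e])
  then show ?thesis unfolding top_def by simp
qed

section \<open>Complements, filters and filtrality in a lattice of sets\<close>

definition clopens :: "'p set set" where
  "clopens = {A \<in> \<K>. P - A \<in> \<K>}"

lemma clopens_sub: "clopens \<subseteq> \<K>"
  unfolding clopens_def by auto

lemma carrier_complemented_part: "carrier (complemented_part L) = e ` clopens"
proof -
  have "(\<exists>B\<in>\<K>. e A \<sqinter>\<^bsub>L\<^esub> e B = \<bottom>\<^bsub>L\<^esub> \<and> e A \<squnion>\<^bsub>L\<^esub> e B = \<top>\<^bsub>L\<^esub>) \<longleftrightarrow> P - A \<in> \<K>" if A: "A \<in> \<K>" for A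
  proof -
    \<comment> \<open>With meets and joins computed on sets, the only possible complement of
      \<open>A\<close> is \<open>P - A\<close>.\<close>
    have "e A \<sqinter>\<^bsub>L\<^esub> e B = \<bottom>\<^bsub>L\<^esub> \<and> e A \<squnion>\<^bsub>L\<^esub> e B = \<top>\<^bsub>L\<^esub> \<longleftrightarrow> B = P - A" if B: "B \<in> \<K>" for B
      using A B sub_space[OF A] sub_space[OF B] Int_in[OF A B] Un_in[OF A B]
      by (auto simp: meet_L join_L bottom_L top_L e_eq_iff empty_in space_in)
    then show ?thesis by auto
  qed
  then show ?thesis
    unfolding complemented_part_def clopens_def carrier_L by auto
qed

text \<open>Filters use the meet taken inside the complemented part. As the same \<open>e\<close>
  codes that part, this meet is again intersection.\<close>

lemma lattice_of_sets_clopens: "lattice_of_sets (complemented_part L) e clopens P"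
proof
  show "eq (complemented_part L) = (=)" by (simp add: complemented_part_def)
  show "carrier (complemented_part L) = e ` clopens" by (rule carrier_complemented_part)
qed (auto simp: clopens_def complemented_part_def le_L sub_space empty_in space_in Int_in Un_in
    Diff_Int Diff_Un)

text \<open>Injectivity of \<open>e\<close> transports filters together with their members, so they
  can be handled as families of sets.\<close>

lemma carrier_filters:
  "carrier (filters_of (complemented_part L)) = (`) e ` {\<G>. set_filter clopens \<G>}"
proof -
  interpret B: lattice_of_sets "complemented_part L" e clopens P
    by (rule lattice_of_sets_clopens)
  have "{F. F \<subseteq> e ` clopens \<and> Q F} = (`) e ` {\<G>. \<G> \<subseteq> clopens \<and> Q (e ` \<G>)}" for Q
    by (auto simp: subset_image_iff)
  moreover have "(e ` \<G> \<noteq> {} \<and>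
      (\<forall>x \<in> e ` \<G>. \<forall>y \<in> e ` clopens. x \<sqsubseteq>\<^bsub>complemented_part L\<^esub> y \<longrightarrow> y \<in> e ` \<G>) \<and>
      (\<forall>x \<in> e ` \<G>. \<forall>y \<in> e ` \<G>. x \<sqinter>\<^bsub>complemented_part L\<^esub> y \<in> e ` \<G>)) \<longleftrightarrow>
      (\<G> \<noteq> {} \<and> (\<forall>A\<in>\<G>. \<forall>B\<in>clopens. A \<subseteq> B \<longrightarrow> B \<in> \<G>) \<and> (\<forall>A\<in>\<G>. \<forall>B\<in>\<G>. A \<inter> B \<in> \<G>))"
    if \<G>: "\<G> \<subseteq> clopens" for \<G>
  proof -
    have mem: "e B \<in> e ` \<G> \<longleftrightarrow> B \<in> \<G>" if "B \<in> clopens" for B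
      using inj_on_image_mem_iff[OF B.inj_e that \<G>] .
    have "(\<forall>x \<in> e ` \<G>. \<forall>y \<in> e ` clopens. x \<sqsubseteq>\<^bsub>complemented_part L\<^esub> y \<longrightarrow> y \<in> e ` \<G>) \<longleftrightarrow>
        (\<forall>A\<in>\<G>. \<forall>B\<in>clopens. A \<subseteq> B \<longrightarrow> B \<in> \<G>)"
      using \<G> mem B.le_L by (simp add: ball_simps subset_eq[of \<G>])
    moreover have "(\<forall>x \<in> e ` \<G>. \<forall>y \<in> e ` \<G>. x \<sqinter>\<^bsub>complemented_part L\<^esub> y \<in> e ` \<G>) \<longleftrightarrow>
        (\<forall>A\<in>\<G>. \<forall>B\<in>\<G>. A \<inter> B \<in> \<G>)"
      using \<G> mem B.meet_L B.Int_in by (simp add: ball_simps subset_eq[of \<G>])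
    ultimately show ?thesis by simp
  qed
  ultimately show ?thesis
    unfolding filters_of_def set_filter_def carrier_complemented_part
    by (simp cong: conj_cong)
qed

lemma set_filter_clopens_above: "A \<in> \<K> \<Longrightarrow> set_filter clopens {B \<in> clopens. A \<subseteq> B}"
  using lattice_of_sets.Int_in[OF lattice_of_sets_clopens] lattice_of_sets.space_in[OF lattice_of_sets_clopens]
    sub_space unfolding set_filter_def by blast

lemma weak_partial_order_filters: "weak_partial_order (filters_of M)"
  by unfold_locales (auto simp: filters_of_def)

text \<open>An order embedding is injective, so bijectivity adds only surjectivity to it. Read on
  sets, the first conjunct says that each member of \<open>\<K>\<close> is cut out by the clopens
  above it; the second recovers each filter of clopens from a member of \<open>\<K>\<close>.\<close>

lemma filtral_lattice_iff:
  "filtral_lattice L \<longleftrightarrow>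
     (\<forall>A\<in>\<K>. \<forall>A'\<in>\<K>. (\<forall>B\<in>clopens. A' \<subseteq> B \<longrightarrow> A \<subseteq> B) \<longrightarrow> A \<subseteq> A') \<and>
     (\<forall>\<G>. set_filter clopens \<G> \<longrightarrow> (\<exists>A\<in>\<K>. \<G> = {B \<in> clopens. A \<subseteq> B}))"
  (is "_ \<longleftrightarrow> ?emb \<and> ?surj")
proof -
  let ?\<phi> = "\<lambda>x. {y \<in> carrier (complemented_part L). x \<sqsubseteq>\<^bsub>L\<^esub> y}"
  let ?above = "\<lambda>A. {B \<in> clopens. A \<subseteq> B}"
  let ?F = "filters_of (complemented_part L)"
  have \<phi>: "?\<phi> (e A) = e ` ?above A" if "A \<in> \<K>" for A
    using that clopens_sub le_L unfolding carrier_complemented_part by auto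
  have subobject: "e ` \<G> \<subseteq> e ` \<G>' \<longleftrightarrow> \<G> \<subseteq> \<G>'" if "\<G> \<subseteq> clopens" "\<G>' \<subseteq> clopens" for \<G> \<G>'
    using inj_on_image_subset_iff[OF inj_e] that clopens_sub by (meson subset_trans)
  have le_\<phi>: "?\<phi> (e A) \<sqsubseteq>\<^bsub>?F\<^esub> ?\<phi> (e A') \<longleftrightarrow> ?above A' \<subseteq> ?above A" if "A \<in> \<K>" "A' \<in> \<K>" for A A'
    using that by (simp add: \<phi> filters_of_def subobject)
  have emb: "order_emb L ?F ?\<phi> \<longleftrightarrow> ?emb"
  proof -
    have "order_emb L ?F ?\<phi> \<longleftrightarrow> (\<forall>A\<in>\<K>. \<forall>A'\<in>\<K>. ?above A' \<subseteq> ?above A \<longleftrightarrow> A \<subseteq> A')"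
      unfolding order_emb_def carrier_L
      using weak_partial_order_L weak_partial_order_filters[of "complemented_part L"] le_\<phi> le_L by simp
    \<comment> \<open>Passing to a smaller set enlarges the family of clopens above it, so
      monotonicity is free and only reflection of the order remains.\<close>
    moreover have "(?above A' \<subseteq> ?above A \<longleftrightarrow> A \<subseteq> A') \<longleftrightarrow>
        ((\<forall>B\<in>clopens. A' \<subseteq> B \<longrightarrow> A \<subseteq> B) \<longrightarrow> A \<subseteq> A')" for A A'
      by blast
    ultimately show ?thesis by (simp only:)
  qed
  have bij: "bij_betw ?\<phi> (carrier L) (carrier ?F) \<longleftrightarrow> ?surj" if ?emb
  proof -
    have "inj_on ?\<phi> (carrier L)"
      unfolding carrier_L
    proof (rule inj_onI)
      fix x y assume "x \<in> e ` \<K>" "y \<in> e ` \<K>" and eq: "?\<phi> x = ?\<phi> y"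
      then obtain A A' where A: "A \<in> \<K>" "A' \<in> \<K>" and x: "x = e A" "y = e A'" by blast
      have im: "e ` ?above A = e ` ?above A'"
        using eq unfolding x \<phi>[OF A(1)] \<phi>[OF A(2)] .
      note above = subobject[OF Collect_subset Collect_subset, THEN iffD1]
      have "A \<subseteq> A'"
        using that A above[OF equalityD2[OF im]] by blast
      moreover have "A' \<subseteq> A"
        using that A above[OF equalityD1[OF im]] by blast
      ultimately show "x = y" unfolding x by (simp add: subset_antisym)
    qed
    moreover have "?\<phi> ` carrier L = (`) e ` ?above ` \<K>"
      unfolding carrier_L image_image using \<phi> by (intro image_cong) auto
    moreover have "(`) e ` ?above ` \<K> = carrier ?F \<longleftrightarrow> ?surj"
    proof -
      have "inj_on ((`) e) (Pow clopens)"
        by (rule inj_on_image_Pow[OF inj_on_subset[OF inj_e clopens_sub]])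
      moreover have "?above ` \<K> \<subseteq> Pow clopens" "{\<G>. set_filter clopens \<G>} \<subseteq> Pow clopens"
        unfolding set_filter_def by auto
      ultimately have "(`) e ` ?above ` \<K> = (`) e ` {\<G>. set_filter clopens \<G>} \<longleftrightarrow>
          ?above ` \<K> = {\<G>. set_filter clopens \<G>}"
        by (rule inj_on_image_eq_iff)
      also have "\<dots> \<longleftrightarrow> ?surj"
        using set_filter_clopens_above by blast
      finally show ?thesis unfolding carrier_filters .
    qed
    ultimately show ?thesis unfolding bij_betw_def by simp
  qed
  show ?thesis
    unfolding filtral_lattice_def Let_def using emb bij by blast
qed

end

text \<open>The family \<open>\<K>\<close> is meant to be the closed sets of a topology, but only
  binary unions and intersections are assumed. Filtrality has to provide the arbitrary
  intersections.\<close>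

locale filtral_lattice_of_sets = lattice_of_sets +
  assumes filtral: "filtral_lattice L"
    and singleton_in: "p \<in> P \<Longrightarrow> {p} \<in> \<K>"
begin

text \<open>Filtrality compares members of \<open>\<K>\<close> only; applied to \<open>{p}\<close>
  it becomes a statement about points.\<close>

lemma eq_Inter_clopens:
  assumes "A \<in> \<K>" "p \<in> P" "\<And>B. B \<in> clopens \<Longrightarrow> A \<subseteq> B \<Longrightarrow> p \<in> B"
  shows "p \<in> A"
proof -
  have "{p} \<subseteq> A"
    by (rule filtral[unfolded filtral_lattice_iff, THEN conjunct1, rule_format, OF singleton_in[OF assms(2)] assms(1)])
      (simp add: assms(3))
  then show ?thesis by simp
qed

text \<open>One filter settles both claims. The clopens containing a finite intersection of members
  of \<open>\<A>\<close> form a filter, which surjectivity realises as the clopens above some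
  \<open>K\<close>, and \<open>K\<close> turns out to be the full intersection. If that is empty,
  the empty set belongs to the filter and so contains a finite intersection.\<close>

lemma Inter_in_and_compact:
  assumes \<A>: "\<A> \<subseteq> \<K>"
  shows "P \<inter> \<Inter>\<A> \<in> \<K>"
    and "P \<inter> \<Inter>\<A> = {} \<Longrightarrow> \<exists>\<F>. finite \<F> \<and> \<F> \<subseteq> \<A> \<and> P \<inter> \<Inter>\<F> = {}"
proof -
  interpret B: lattice_of_sets "complemented_part L" e clopens P
    by (rule lattice_of_sets_clopens)
  \<comment> \<open>The factor \<open>P\<close> gives the empty subfamily the intersection
    \<open>P\<close> rather than the whole type.\<close>
  define \<G> where "\<G> = {B \<in> clopens. \<exists>\<F>. finite \<F> \<and> \<F> \<subseteq> \<A> \<and> P \<inter> \<Inter>\<F> \<subseteq> B}"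
  have GI: "B \<in> \<G>" if "B \<in> clopens" "finite \<F>" "\<F> \<subseteq> \<A>" "P \<inter> \<Inter>\<F> \<subseteq> B" for B \<F>
    using that unfolding \<G>_def by (intro CollectI conjI exI[of _ \<F>])
  have GE: "\<exists>\<F>. finite \<F> \<and> \<F> \<subseteq> \<A> \<and> P \<inter> \<Inter>\<F> \<subseteq> B" if "B \<in> \<G>" for B
    using that unfolding \<G>_def by (elim CollectE conjE)
  have G_clopen: "\<G> \<subseteq> clopens"
    unfolding \<G>_def by (rule Collect_subset)
  have "set_filter clopens \<G>"
    unfolding set_filter_def
  proof (intro conjI ballI impI)
    have "P \<in> \<G>" by (rule GI[of P "{}"]) (auto simp: B.space_in)
    then show "\<G> \<noteq> {}" by auto
    show "\<G> \<subseteq> clopens" by (rule G_clopen)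
  next
    fix A B assume A: "A \<in> \<G>" and B: "B \<in> \<G>"
    from GE[OF A] obtain \<F> where \<F>: "finite \<F>" "\<F> \<subseteq> \<A>" "P \<inter> \<Inter>\<F> \<subseteq> A"
      by (elim conjE exE)
    from GE[OF B] obtain \<F>' where \<F>': "finite \<F>'" "\<F>' \<subseteq> \<A>" "P \<inter> \<Inter>\<F>' \<subseteq> B"
      by (elim conjE exE)
    show "A \<inter> B \<in> \<G>"
    proof (rule GI[of _ "\<F> \<union> \<F>'"])
      show "A \<inter> B \<in> clopens" using A B G_clopen B.Int_in by (simp add: subset_eq)
    qed (use \<F> \<F>' in auto)
  next
    fix A B assume A: "A \<in> \<G>" and B: "B \<in> clopens" "A \<subseteq> B"
    from GE[OF A] obtain \<F> where \<F>: "finite \<F>" "\<F> \<subseteq> \<A>" "P \<inter> \<Inter>\<F> \<subseteq> A"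
      by (elim conjE exE)
    show "B \<in> \<G>" by (rule GI[OF B(1) \<F>(1,2) subset_trans[OF \<F>(3) B(2)]])
  qed
  then have "\<exists>K\<in>\<K>. \<G> = {B \<in> clopens. K \<subseteq> B}"
    by (rule filtral[unfolded filtral_lattice_iff, THEN conjunct2, rule_format])
  then obtain K where K: "K \<in> \<K>" "\<G> = {B \<in> clopens. K \<subseteq> B}" by (elim bexE)
  have K_sub: "K \<subseteq> B" if "B \<in> \<G>" for B
    using that unfolding K(2) by (elim CollectE conjE)
  have K_mem: "B \<in> \<G>" if "B \<in> clopens" "K \<subseteq> B" for B
    using that unfolding K(2) by (intro CollectI conjI)
  have "K \<subseteq> P" using K sub_space by blast
  have eq: "P \<inter> \<Inter>\<A> = K"
  proof
    show "K \<subseteq> P \<inter> \<Inter>\<A>"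
    proof
      fix p assume p: "p \<in> K"
      then have "p \<in> P" using \<open>K \<subseteq> P\<close> by blast
      \<comment> \<open>Each \<open>A\<close> is itself cut out by clopens, and these lie in the
        filter by way of the subfamily \<open>{A}\<close>.\<close>
      moreover have "p \<in> A" if A: "A \<in> \<A>" for A
      proof (rule eq_Inter_clopens)
        fix B assume B: "B \<in> clopens" "A \<subseteq> B"
        then have "B \<in> \<G>" using A by (intro GI[of B "{A}"]) auto
        then show "p \<in> B" using K_sub p by (simp add: subset_eq)
      qed (use A \<A> \<open>p \<in> P\<close> in auto)
      ultimately show "p \<in> P \<inter> \<Inter>\<A>" by blast
    qed
    show "P \<inter> \<Inter>\<A> \<subseteq> K"
    proof
      fix p assume p: "p \<in> P \<inter> \<Inter>\<A>"
      show "p \<in> K"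
      proof (rule eq_Inter_clopens[OF K(1)])
        fix B assume "B \<in> clopens" "K \<subseteq> B"
        then have "B \<in> \<G>" by (rule K_mem)
        from GE[OF this] obtain \<F> where "\<F> \<subseteq> \<A>" "P \<inter> \<Inter>\<F> \<subseteq> B" by (elim exE conjE)
        then show "p \<in> B" using p by auto
      qed (use p in simp)
    qed
  qed
  show "P \<inter> \<Inter>\<A> \<in> \<K>" using eq K(1) by simp
  assume "P \<inter> \<Inter>\<A> = {}"
  then have "K = {}" using eq by simp
  then have "{} \<in> \<G>" by (intro K_mem B.empty_in) simp
  then show "\<exists>\<F>. finite \<F> \<and> \<F> \<subseteq> \<A> \<and> P \<inter> \<Inter>\<F> = {}" using GE[of "{}"] by simp
qed

definition set_space :: "'b topology" where
  "set_space = topology (\<lambda>U. U \<subseteq> P \<and> P - U \<in> \<K>)"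

lemma openin_space: "openin set_space U \<longleftrightarrow> U \<subseteq> P \<and> P - U \<in> \<K>"
proof -
  have "istopology (\<lambda>U. U \<subseteq> P \<and> P - U \<in> \<K>)"
    unfolding istopology_def
  proof (intro conjI allI impI)
    fix S T assume "S \<subseteq> P \<and> P - S \<in> \<K>" "T \<subseteq> P \<and> P - T \<in> \<K>"
    then show "S \<inter> T \<subseteq> P" "P - S \<inter> T \<in> \<K>" using Un_in by (auto simp: Diff_Int)
  next
    fix \<U> assume \<U>: "\<forall>U\<in>\<U>. U \<subseteq> P \<and> P - U \<in> \<K>"
    then show "\<Union>\<U> \<subseteq> P" by blast
    have eq: "P - \<Union>\<U> = P \<inter> \<Inter>((\<lambda>U. P - U) ` \<U>)" by auto
    have "(\<lambda>U. P - U) ` \<U> \<subseteq> \<K>" using \<U> by (simp add: image_subset_iff)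
    then show "P - \<Union>\<U> \<in> \<K>" unfolding eq by (rule Inter_in_and_compact(1))
  qed
  then show ?thesis unfolding set_space_def by (simp add: topology_inverse')
qed

lemma topspace_space: "topspace set_space = P"
proof
  show "topspace set_space \<subseteq> P" unfolding topspace_def openin_space by auto
  have "openin set_space P" unfolding openin_space using empty_in by simp
  then show "P \<subseteq> topspace set_space" by (rule openin_subset)
qed

lemma closedin_space: "closedin set_space A \<longleftrightarrow> A \<in> \<K>"
  unfolding closedin_def topspace_space openin_space
  using sub_space[of A] double_diff[of A P P] by auto

lemma Stone_space_space: "Stone_space set_space"
proof (rule Stone_spaceI)
  show "compact_space set_space"
    unfolding compact_space_fip closedin_space
  proof (intro allI impI, elim conjE)
    fix \<U> assume \<U>: "\<forall>C\<in>\<U>. C \<in> \<K>" and fip: "\<forall>\<F>. finite \<F> \<and> \<F> \<subseteq> \<U> \<longrightarrow> \<Inter>\<F> \<noteq> {}"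
    show "\<Inter>\<U> \<noteq> {}"
    proof
      assume "\<Inter>\<U> = {}"
      moreover from this have "\<U> \<noteq> {}" by auto
      moreover obtain \<F> where \<F>: "finite \<F>" "\<F> \<subseteq> \<U>" "P \<inter> \<Inter>\<F> = {}"
        using Inter_in_and_compact(2)[of \<U>] \<U> \<open>\<Inter>\<U> = {}\<close> by (auto simp: subset_eq)
      ultimately obtain C where C: "C \<in> \<U>" by auto
      have "C \<subseteq> P" using C \<U> sub_space by simp
      \<comment> \<open>The finite intersection property is stated without \<open>P\<close>; adding
        one member \<open>C\<close> of \<open>\<U>\<close>, which lies in \<open>P\<close>, absorbs
        it.\<close>
      then have "\<Inter>(insert C \<F>) = {}" using \<F>(3) by auto
      moreover have "\<Inter>(insert C \<F>) \<noteq> {}"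
        using \<F> C by (intro fip[rule_format]) simp
      ultimately show False by (rule notE[rotated])
    qed
  qed
  fix p q assume "p \<in> topspace set_space" "q \<in> topspace set_space" "p \<noteq> q"
  \<comment> \<open>The clopen is found around \<open>q\<close>, since \<open>{q}\<close> is cut out
    by clopens and \<open>p\<close> is not in it. Its complement is the set required around
    \<open>p\<close>.\<close>
  then obtain B where "B \<in> clopens" "{q} \<subseteq> B" "p \<notin> B"
    using eq_Inter_clopens[of "{q}" p] singleton_in by (auto simp: topspace_space)
  moreover from this have "P - (P - B) = B"
    using sub_space clopens_sub by auto
  ultimately show "\<exists>V. clopen_in set_space V \<and> p \<in> V \<and> q \<notin> V"
    using \<open>p \<in> topspace set_space\<close> unfolding clopens_def clopen_in_def closedin_space openin_space topspace_space
    by (intro exI[of _ "P - B"]) auto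
qed

end

section \<open>Subobjects and pullbacks\<close>

definition subobject :: "('o, 'a) cat \<Rightarrow> 'o \<Rightarrow> 'a \<Rightarrow> 'a set" where
  "subobject C X m = subobject_rel C X `` {m}"

lemma HomD:
  assumes "f \<in> Hom C X Y"
  shows "f \<in> Arr C" "Dom C f = X" "Cod C f = Y"
  using assms unfolding Hom_def by auto

lemma Arr_Hom: "f \<in> Arr C \<Longrightarrow> f \<in> Hom C (Dom C f) (Cod C f)"
  unfolding Hom_def by simp

lemma factors_through_iff:
  "f \<in> Hom C W X \<Longrightarrow> m \<in> Hom C A X \<Longrightarrow>
    factors_through C f m \<longleftrightarrow> (\<exists>h\<in>Hom C W A. Comp C m h = f)"
  unfolding factors_through_def by (simp add: HomD)

lemma monos_into_Hom: "m \<in> monos_into C X \<Longrightarrow> m \<in> Hom C (Dom C m) X"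
  unfolding monos_into_def is_mono_def Hom_def by simp

lemma monos_intoD:
  "m \<in> monos_into C X \<Longrightarrow> f \<in> Hom C W (Dom C m) \<Longrightarrow> g \<in> Hom C W (Dom C m) \<Longrightarrow>
    Comp C m f = Comp C m g \<Longrightarrow> f = g"
  unfolding monos_into_def is_mono_def by blast

lemma monos_intoI:
  assumes "m \<in> Hom C A X"
    and "\<And>W f g. f \<in> Hom C W A \<Longrightarrow> g \<in> Hom C W A \<Longrightarrow> Comp C m f = Comp C m g \<Longrightarrow> f = g"
  shows "m \<in> monos_into C X"
  using assms unfolding monos_into_def is_mono_def by (simp add: HomD)

lemma eq_Sub: "eq (Sub C X) = (=)"
  unfolding Sub_def by simp

lemma carrier_Sub: "carrier (Sub C X) = subobject C X ` monos_into C X"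
  unfolding Sub_def subobject_def quotient_def by auto

lemma is_pullback_Hom:
  assumes "is_pullback C f g p q"
  shows "f \<in> Hom C (Dom C f) (Cod C f)" "g \<in> Hom C (Dom C g) (Cod C f)"
    "p \<in> Hom C (Dom C p) (Dom C f)" "q \<in> Hom C (Dom C p) (Dom C g)"
    "Comp C f p = Comp C g q"
  using assms unfolding is_pullback_def Hom_def by auto

lemma is_pullback_universal:
  assumes "is_pullback C f g p q" "a \<in> Hom C W (Dom C f)" "b \<in> Hom C W (Dom C g)"
    "Comp C f a = Comp C g b"
  obtains h where "h \<in> Hom C W (Dom C p)" "Comp C p h = a" "Comp C q h = b"
  using assms unfolding is_pullback_def by blast

lemma is_pullback_unique:
  assumes "is_pullback C f g p q" "h \<in> Hom C W (Dom C p)" "h' \<in> Hom C W (Dom C p)"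
    "Comp C p h = Comp C p h'" "Comp C q h = Comp C q h'"
    and "Comp C p h \<in> Hom C W (Dom C f)" "Comp C q h \<in> Hom C W (Dom C g)"
    "Comp C f (Comp C p h) = Comp C g (Comp C q h)"
  shows "h = h'"
proof -
  have "\<exists>!k. k \<in> Hom C W (Dom C p) \<and> Comp C p k = Comp C p h \<and> Comp C q k = Comp C q h"
    using assms(1,6,7,8) unfolding is_pullback_def by blast
  then show ?thesis using assms(2-5) by metis
qed

lemma is_pullbackI:
  assumes "f \<in> Hom C A Y" "g \<in> Hom C X Y" "p \<in> Hom C P A" "q \<in> Hom C P X"
    and "Comp C f p = Comp C g q"
    and "\<And>W a b. a \<in> Hom C W A \<Longrightarrow> b \<in> Hom C W X \<Longrightarrow> Comp C f a = Comp C g b \<Longrightarrow>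
      \<exists>!h. h \<in> Hom C W P \<and> Comp C p h = a \<and> Comp C q h = b"
  shows "is_pullback C f g p q"
  using assms unfolding is_pullback_def Hom_def by simp

context category
begin

lemma Hom_obj: "f \<in> Hom C X Y \<Longrightarrow> X \<in> Obj C" "f \<in> Hom C X Y \<Longrightarrow> Y \<in> Obj C"
  using dom_in_obj cod_in_obj unfolding Hom_def by auto

lemma factors_through_refl: "m \<in> Hom C A X \<Longrightarrow> factors_through C m m"
  using factors_through_iff ident_in_hom Hom_obj comp_ident_right by metis

lemma factors_through_trans:
  assumes "f \<in> Hom C W X" "m \<in> Hom C A X" "n \<in> Hom C B X"
    and "factors_through C f m" "factors_through C m n"
  shows "factors_through C f n"
proof -
  obtain h where h: "h \<in> Hom C W A" "Comp C m h = f"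
    using assms(4) factors_through_iff[OF assms(1,2)] by blast
  obtain k where k: "k \<in> Hom C A B" "Comp C n k = m"
    using assms(5) factors_through_iff[OF assms(2,3)] by blast
  have "Comp C n (Comp C k h) = f"
    using comp_assoc[OF h(1) k(1) assms(3)] h k by simp
  then show ?thesis
    using factors_through_iff[OF assms(1,3)] comp_in_hom[OF h(1) k(1)] by blast
qed

lemma monos_factors_trans:
  assumes "m \<in> monos_into C X" "n \<in> monos_into C X" "k \<in> monos_into C X"
    and "factors_through C m n" "factors_through C n k"
  shows "factors_through C m k"
  by (rule factors_through_trans[OF monos_into_Hom[OF assms(1)] monos_into_Hom[OF assms(2)]
        monos_into_Hom[OF assms(3)] assms(4,5)])

lemma equiv_subobject_rel: "equiv (monos_into C X) (subobject_rel C X)"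
proof (rule equivI)
  show "subobject_rel C X \<subseteq> monos_into C X \<times> monos_into C X"
    unfolding subobject_rel_def by auto
  show "refl_on (monos_into C X) (subobject_rel C X)"
    unfolding refl_on_def subobject_rel_def
    by (auto intro: factors_through_refl[OF monos_into_Hom])
  show "sym (subobject_rel C X)"
    unfolding sym_def subobject_rel_def by auto
  show "trans (subobject_rel C X)"
  proof (rule transI)
    fix m n k assume "(m, n) \<in> subobject_rel C X" "(n, k) \<in> subobject_rel C X"
    then show "(m, k) \<in> subobject_rel C X"
      using monos_factors_trans[of m X n k] monos_factors_trans[of k X n m]
      unfolding subobject_rel_def by simp
  qed
qed

lemma mem_sub_iff:
  "m \<in> monos_into C X \<Longrightarrow> n \<in> subobject C X m \<longleftrightarrow>
    n \<in> monos_into C X \<and> factors_through C m n \<and> factors_through C n m"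
  unfolding subobject_def subobject_rel_def by auto

lemma sub_self: "m \<in> monos_into C X \<Longrightarrow> m \<in> subobject C X m"
  by (simp add: mem_sub_iff factors_through_refl[OF monos_into_Hom])

lemma sub_eq_iff:
  assumes "m \<in> monos_into C X" "n \<in> monos_into C X"
  shows "subobject C X m = subobject C X n \<longleftrightarrow> factors_through C m n \<and> factors_through C n m"
  using eq_equiv_class_iff[OF equiv_subobject_rel assms] assms
  unfolding subobject_def subobject_rel_def by simp

text \<open>The order asks only for some pair of representatives that factor; composing with the
  comparisons inside each class reaches any pair.\<close>

lemma le_Sub:
  assumes m: "m \<in> monos_into C X" and n: "n \<in> monos_into C X"
  shows "le (Sub C X) (subobject C X m) (subobject C X n) \<longleftrightarrow> factors_through C m n"
proof
  assume "le (Sub C X) (subobject C X m) (subobject C X n)"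
  then obtain m' n' where m': "m' \<in> subobject C X m" and n': "n' \<in> subobject C X n" and "factors_through C m' n'"
    unfolding Sub_def by (simp add: Bex_def) blast
  have m'm: "m' \<in> monos_into C X" "factors_through C m m'"
    and n'm: "n' \<in> monos_into C X" "factors_through C n' n"
    using m' n' mem_sub_iff[OF m] mem_sub_iff[OF n] by simp_all
  show "factors_through C m n"
    by (rule monos_factors_trans[OF m m'm(1) n m'm(2) monos_factors_trans[OF m'm(1) n'm(1) n
            \<open>factors_through C m' n'\<close> n'm(2)]])
next
  assume "factors_through C m n"
  then show "le (Sub C X) (subobject C X m) (subobject C X n)"
    unfolding Sub_def using sub_self[OF m] sub_self[OF n] by auto
qed

section \<open>Pullbacks of subobjects described by the arrows that factor through them\<close>

lemma pullback_mono:
  assumes pb: "is_pullback C m f p n" and m: "is_mono C m"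
  shows "n \<in> monos_into C (Dom C f)"
proof (rule monos_intoI[OF is_pullback_Hom(4)[OF pb]])
  note H = is_pullback_Hom[OF pb]
  fix W h k assume h: "h \<in> Hom C W (Dom C p)" and k: "k \<in> Hom C W (Dom C p)"
    and eq: "Comp C n h = Comp C n k"
  have "Comp C m (Comp C p h) = Comp C f (Comp C n h)" if "h \<in> Hom C W (Dom C p)" for h
    using comp_assoc[OF that H(3) H(1)] comp_assoc[OF that H(4) H(2)] H(5) by simp
  then have "Comp C m (Comp C p h) = Comp C m (Comp C p k)"
    "Comp C m (Comp C p h) = Comp C f (Comp C n h)"
    using h k eq by simp_all
  moreover from this have "Comp C p h = Comp C p k"
    using m comp_in_hom[OF h H(3)] comp_in_hom[OF k H(3)] unfolding is_mono_def by blast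
  ultimately show "h = k"
    using is_pullback_unique[OF pb h k] eq comp_in_hom[OF h H(3)] comp_in_hom[OF h H(4)] by simp
qed

lemma factors_through_pullback:
  assumes pb: "is_pullback C m f p n" and g: "g \<in> Hom C W (Dom C f)"
  shows "factors_through C g n \<longleftrightarrow> factors_through C (Comp C f g) m"
proof -
  note H = is_pullback_Hom[OF pb]
  show ?thesis
    unfolding factors_through_iff[OF g H(4)]
      factors_through_iff[OF comp_in_hom[OF g H(2)] H(1)]
  proof
    assume "\<exists>h\<in>Hom C W (Dom C p). Comp C n h = g"
    then obtain h where h: "h \<in> Hom C W (Dom C p)" "Comp C n h = g" by blast
    have "Comp C m (Comp C p h) = Comp C f g"
      using comp_assoc[OF h(1) H(3,1)] comp_assoc[OF h(1) H(4,2)] H(5) h(2) by simp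
    then show "\<exists>h\<in>Hom C W (Dom C m). Comp C m h = Comp C f g"
      using comp_in_hom[OF h(1) H(3)] by blast
  next
    assume "\<exists>h\<in>Hom C W (Dom C m). Comp C m h = Comp C f g"
    then obtain k where k: "k \<in> Hom C W (Dom C m)" "Comp C m k = Comp C f g" by blast
    obtain h where "h \<in> Hom C W (Dom C p)" "Comp C n h = g"
      by (rule is_pullback_universal[OF pb k(1) g k(2)])
    then show "\<exists>h\<in>Hom C W (Dom C p). Comp C n h = g" by blast
  qed
qed

text \<open>Lifts through a monomorphism are unique, so the universal property of the square reduces
  to which arrows factor, and the remaining side \<open>p\<close> can be forgotten.\<close>

lemma pullback_of_mono_iff:
  assumes m: "m \<in> monos_into C Y" and f: "f \<in> Hom C X Y" and n: "n \<in> monos_into C X"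
  shows "(\<exists>p. is_pullback C m f p n) \<longleftrightarrow>
    (\<forall>W. \<forall>g\<in>Hom C W X. factors_through C g n \<longleftrightarrow> factors_through C (Comp C f g) m)"
    (is "?l \<longleftrightarrow> ?r")
proof
  assume ?l
  then obtain p where pb: "is_pullback C m f p n" by blast
  show ?r
    using factors_through_pullback[OF pb] unfolding HomD(2)[OF f] by blast
next
  assume r: ?r
  note mH = monos_into_Hom[OF m] and nH = monos_into_Hom[OF n]
  have fnH: "Comp C f n \<in> Hom C (Dom C n) Y" by (rule comp_in_hom[OF nH f])
  \<comment> \<open>The condition applied to \<open>n\<close> itself yields the missing side of the
    square.\<close>
  have "factors_through C (Comp C f n) m"
    using r nH factors_through_refl[OF nH] by blast
  then obtain p where p: "p \<in> Hom C (Dom C n) (Dom C m)" "Comp C m p = Comp C f n"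
    unfolding factors_through_iff[OF fnH mH] by blast
  have "is_pullback C m f p n"
  proof (rule is_pullbackI[OF mH f p(1) nH p(2)])
    fix W a b assume a: "a \<in> Hom C W (Dom C m)" and b: "b \<in> Hom C W X"
      and ab: "Comp C m a = Comp C f b"
    have fbH: "Comp C f b \<in> Hom C W Y" by (rule comp_in_hom[OF b f])
    have "factors_through C (Comp C f b) m"
      unfolding factors_through_iff[OF fbH mH] using a ab by blast
    then have "factors_through C b n" using r b by blast
    then obtain h where h: "h \<in> Hom C W (Dom C n)" "Comp C n h = b"
      unfolding factors_through_iff[OF b nH] by blast
    have "Comp C m (Comp C p h) = Comp C m a"
      using comp_assoc[OF h(1) p(1) mH] comp_assoc[OF h(1) nH f] p(2) h(2) ab by simp
    then have ph: "Comp C p h = a"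
      by (rule monos_intoD[OF m comp_in_hom[OF h(1) p(1)] a])
    show "\<exists>!h. h \<in> Hom C W (Dom C n) \<and> Comp C p h = a \<and> Comp C n h = b"
    proof (rule ex1I[of _ h])
      fix k assume k: "k \<in> Hom C W (Dom C n) \<and> Comp C p k = a \<and> Comp C n k = b"
      show "k = h"
        by (rule monos_intoD[OF n, of _ W]) (use k h in auto)
    qed (use h ph in simp)
  qed
  then show ?l by blast
qed

lemma factors_through_sub_cong:
  assumes "m \<in> monos_into C X" "m' \<in> subobject C X m" "g \<in> Hom C W X"
  shows "factors_through C g m' \<longleftrightarrow> factors_through C g m"
proof -
  have m': "m' \<in> monos_into C X" "factors_through C m m'" "factors_through C m' m"
    using mem_sub_iff[OF assms(1)] assms(2) by auto
  note H = monos_into_Hom[OF assms(1)] monos_into_Hom[OF m'(1)]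
  show ?thesis
    using factors_through_trans[OF assms(3) H _ m'(2)] factors_through_trans[OF assms(3) H(2,1) _ m'(3)]
    by blast
qed

lemma sub_eqI:
  assumes m: "m \<in> monos_into C X" and n: "n \<in> monos_into C X"
    and "\<And>W g. g \<in> Hom C W X \<Longrightarrow> factors_through C g m \<longleftrightarrow> factors_through C g n"
  shows "subobject C X m = subobject C X n"
  using assms(3)[OF monos_into_Hom[OF m]] assms(3)[OF monos_into_Hom[OF n]]
    factors_through_refl[OF monos_into_Hom[OF m]] factors_through_refl[OF monos_into_Hom[OF n]]
  unfolding sub_eq_iff[OF m n] by simp

text \<open>\<open>pullback_sub\<close> collects all pullbacks of all representatives. Equality with
  the class of \<open>n\<close> therefore takes two arguments: any such pullback is equivalent to
  \<open>n\<close>, and any arrow equivalent to \<open>n\<close> is itself such a pullback.\<close>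

lemma pullback_sub_eq:
  assumes m: "m \<in> monos_into C Y" and f: "f \<in> Hom C X Y" and n: "n \<in> monos_into C X"
    and fact: "\<And>W g. g \<in> Hom C W X \<Longrightarrow>
      factors_through C g n \<longleftrightarrow> factors_through C (Comp C f g) m"
  shows "pullback_sub C f (subobject C Y m) = subobject C X n"
proof (intro equalityI subsetI)
  fix n' assume "n' \<in> pullback_sub C f (subobject C Y m)"
  then obtain m' p where m': "m' \<in> subobject C Y m" and pb: "is_pullback C m' f p n'"
    unfolding pullback_sub_def by blast
  have m'm: "m' \<in> monos_into C Y" using m' mem_sub_iff[OF m] by blast
  then have n': "n' \<in> monos_into C X"
    using pullback_mono[OF pb] HomD(2)[OF f] unfolding monos_into_def by simp
  have "factors_through C g n' \<longleftrightarrow> factors_through C g n" if g: "g \<in> Hom C W X" for W g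
    using pullback_of_mono_iff[OF m'm f n'] pb g fact[OF g]
      factors_through_sub_cong[OF m m' comp_in_hom[OF g f]] by blast
  then have "subobject C X n' = subobject C X n" by (rule sub_eqI[OF n' n])
  then show "n' \<in> subobject C X n" using sub_self[OF n'] by simp
next
  fix n' assume n': "n' \<in> subobject C X n"
  then have n'm: "n' \<in> monos_into C X" using mem_sub_iff[OF n] by blast
  have "\<exists>p. is_pullback C m f p n'"
    unfolding pullback_of_mono_iff[OF m f n'm]
    using factors_through_sub_cong[OF n n'] fact by blast
  then show "n' \<in> pullback_sub C f (subobject C Y m)"
    unfolding pullback_sub_def using sub_self[OF m] by blast
qed

lemma is_image_iff:
  assumes f: "f \<in> Hom C X Y"
  shows "is_image C f S \<longleftrightarrow> (\<exists>m\<in>monos_into C Y. S = subobject C Y m \<and> factors_through C f m \<and>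
    (\<forall>n\<in>monos_into C Y. factors_through C f n \<longrightarrow> factors_through C m n))"
proof -
  have eq: "{T \<in> carrier (Sub C Y). \<exists>m\<in>T. factors_through C f m} =
      subobject C Y ` {m \<in> monos_into C Y. factors_through C f m}"
    unfolding carrier_Sub
  proof (intro equalityI subsetI)
    fix T assume "T \<in> {T \<in> subobject C Y ` monos_into C Y. \<exists>m\<in>T. factors_through C f m}"
    then obtain m m' where "m \<in> monos_into C Y" "T = subobject C Y m" "m' \<in> subobject C Y m" "factors_through C f m'"
      by blast
    then show "T \<in> subobject C Y ` {m \<in> monos_into C Y. factors_through C f m}"
      using factors_through_sub_cong[OF _ _ f, of m m'] by blast
  next
    fix T assume "T \<in> subobject C Y ` {m \<in> monos_into C Y. factors_through C f m}"
    then obtain m where "m \<in> monos_into C Y" "T = subobject C Y m" "factors_through C f m" by blast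
    then show "T \<in> {T \<in> subobject C Y ` monos_into C Y. \<exists>m\<in>T. factors_through C f m}"
      using sub_self[of m Y] by blast
  qed
  have "least (Sub C Y) S (subobject C Y ` {m \<in> monos_into C Y. factors_through C f m}) \<longleftrightarrow>
    (\<exists>m\<in>monos_into C Y. S = subobject C Y m \<and> factors_through C f m \<and>
      (\<forall>n\<in>monos_into C Y. factors_through C f n \<longrightarrow> factors_through C m n))"
    unfolding least_def carrier_Sub using le_Sub by auto
  then show ?thesis
    unfolding is_image_def HomD(3)[OF f] eq .
qed

end


section \<open>Equivalences of categories\<close>

text \<open>The inverse functor sends \<open>Z\<close> to a chosen \<open>G0 Z\<close> with an
  isomorphism \<epsilon> from \<open>omap F (G0 Z)\<close> to \<open>Z\<close>, and an arrow to the
  unique lift of its conjugate by \<epsilon>. Equations in \<open>C\<close> are checked after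
  applying \<open>F\<close>.\<close>

lemma equivalent_categoriesI:
  fixes C :: "('o, 'a) cat" and D :: "('p, 'b) cat" and F :: "('o, 'a, 'p, 'b) fctr"
  assumes "category C" "category D" and F: "is_functor C D F"
    and ff: "\<And>X Y. X \<in> Obj C \<Longrightarrow> Y \<in> Obj C \<Longrightarrow>
      bij_betw (amap F) (Hom C X Y) (Hom D (omap F X) (omap F Y))"
    and es: "\<And>Z. Z \<in> Obj D \<Longrightarrow> \<exists>X\<in>Obj C. isomorphic_objects D (omap F X) Z"
  shows "equivalent_categories C D"
proof -
  interpret C: category C by fact
  interpret D: category D by fact
  have Fo: "X \<in> Obj C \<Longrightarrow> omap F X \<in> Obj D"
    and Fa: "f \<in> Hom C X Y \<Longrightarrow> amap F f \<in> Hom D (omap F X) (omap F Y)"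
    and Fi: "X \<in> Obj C \<Longrightarrow> amap F (Ident C X) = Ident D (omap F X)" for X Y f
    using F unfolding is_functor_def Hom_def by auto
  have Fc: "amap F (Comp C g f) = Comp D (amap F g) (amap F f)"
    if "f \<in> Hom C X Y" "g \<in> Hom C Y Z" for f g X Y Z
    using F that unfolding is_functor_def Hom_def by auto
  define lift where "lift X Y = inv_into (Hom C X Y) (amap F)" for X Y
  have lift: "lift X Y w \<in> Hom C X Y" "amap F (lift X Y w) = w"
    if "X \<in> Obj C" "Y \<in> Obj C" "w \<in> Hom D (omap F X) (omap F Y)" for X Y w
    using ff[OF that(1,2)] that(3) unfolding lift_def bij_betw_def
    by (metis inv_into_into, metis f_inv_into_f)
  have faith: "f = g" if "f \<in> Hom C X Y" "g \<in> Hom C X Y" "amap F f = amap F g" for f g X Y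
    using ff[of X Y] that C.Hom_obj[OF that(1)] unfolding bij_betw_def by (meson inj_onD)
  \<comment> \<open>The triple carries the object, the isomorphism and its inverse, so that one
    choice fixes all three consistently.\<close>
  define Q where "Q Z t \<longleftrightarrow> fst t \<in> Obj C \<and> fst (snd t) \<in> Hom D (omap F (fst t)) Z \<and>
      snd (snd t) \<in> Hom D Z (omap F (fst t)) \<and>
      Comp D (snd (snd t)) (fst (snd t)) = Ident D (omap F (fst t)) \<and>
      Comp D (fst (snd t)) (snd (snd t)) = Ident D Z" for Z and t :: "'o \<times> 'b \<times> 'b"
  have "\<exists>t. Q Z t" if Z: "Z \<in> Obj D" for Z
  proof -
    obtain X \<epsilon> where X: "X \<in> Obj C" and \<epsilon>: "\<epsilon> \<in> Hom D (omap F X) Z" "is_iso D \<epsilon>"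
      using es[OF Z] unfolding isomorphic_objects_def by blast
    obtain \<epsilon>' where "\<epsilon>' \<in> Hom D Z (omap F X)"
      "Comp D \<epsilon>' \<epsilon> = Ident D (omap F X)" "Comp D \<epsilon> \<epsilon>' = Ident D Z"
      using \<epsilon>(2) unfolding is_iso_def HomD[OF \<epsilon>(1)] by blast
    then show ?thesis
      unfolding Q_def using X \<epsilon>(1) by (intro exI[of _ "(X, \<epsilon>, \<epsilon>')"]) simp
  qed
  then obtain t where t: "\<forall>Z\<in>Obj D. Q Z (t Z)"
    using bchoice[of "Obj D" Q] by blast
  define G0 \<epsilon> \<epsilon>' where "G0 Z = fst (t Z)" and "\<epsilon> Z = fst (snd (t Z))" and "\<epsilon>' Z = snd (snd (t Z))" for Z
  have G0: "Z \<in> Obj D \<Longrightarrow> G0 Z \<in> Obj C"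
    and \<epsilon>: "Z \<in> Obj D \<Longrightarrow> \<epsilon> Z \<in> Hom D (omap F (G0 Z)) Z"
    and \<epsilon>': "Z \<in> Obj D \<Longrightarrow> \<epsilon>' Z \<in> Hom D Z (omap F (G0 Z))"
    and \<epsilon>'\<epsilon>: "Z \<in> Obj D \<Longrightarrow> Comp D (\<epsilon>' Z) (\<epsilon> Z) = Ident D (omap F (G0 Z))"
    and \<epsilon>\<epsilon>': "Z \<in> Obj D \<Longrightarrow> Comp D (\<epsilon> Z) (\<epsilon>' Z) = Ident D Z" for Z
    using t unfolding Q_def G0_def \<epsilon>_def \<epsilon>'_def by simp_all
  define conj where "conj v = Comp D (\<epsilon>' (Cod D v)) (Comp D v (\<epsilon> (Dom D v)))" for v
  define G where "G = \<lparr>omap = G0, amap = (\<lambda>v. lift (G0 (Dom D v)) (G0 (Cod D v)) (conj v))\<rparr>"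
  have conj: "conj v \<in> Hom D (omap F (G0 Y)) (omap F (G0 Z))"
    and \<epsilon>conj: "Comp D (\<epsilon> Z) (conj v) = Comp D v (\<epsilon> Y)" if v: "v \<in> Hom D Y Z" for v Y Z
  proof -
    note Y = D.Hom_obj(1)[OF v] and Z = D.Hom_obj(2)[OF v]
    have v\<epsilon>: "Comp D v (\<epsilon> Y) \<in> Hom D (omap F (G0 Y)) Z"
      by (rule D.comp_in_hom[OF \<epsilon>[OF Y] v])
    have eq: "conj v = Comp D (\<epsilon>' Z) (Comp D v (\<epsilon> Y))"
      unfolding conj_def HomD(2,3)[OF v] ..
    show "conj v \<in> Hom D (omap F (G0 Y)) (omap F (G0 Z))"
      unfolding eq by (rule D.comp_in_hom[OF v\<epsilon> \<epsilon>'[OF Z]])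
    show "Comp D (\<epsilon> Z) (conj v) = Comp D v (\<epsilon> Y)"
      unfolding eq D.comp_assoc[OF v\<epsilon> \<epsilon>'[OF Z] \<epsilon>[OF Z]] \<epsilon>\<epsilon>'[OF Z] by (rule D.comp_ident_left[OF v\<epsilon>])
  qed
  have \<epsilon>_cancel: "a = b" if "a \<in> Hom D W (omap F (G0 Z))" "b \<in> Hom D W (omap F (G0 Z))"
    "Comp D (\<epsilon> Z) a = Comp D (\<epsilon> Z) b" "Z \<in> Obj D" for a b W Z
  proof -
    have "Comp D (\<epsilon>' Z) (Comp D (\<epsilon> Z) x) = x" if "x \<in> Hom D W (omap F (G0 Z))" for x
      using D.comp_assoc[OF that \<epsilon>[OF \<open>Z \<in> Obj D\<close>] \<epsilon>'[OF \<open>Z \<in> Obj D\<close>]] \<epsilon>'\<epsilon>[OF \<open>Z \<in> Obj D\<close>]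
        D.comp_ident_left[OF that] by simp
    then show "a = b" using that by metis
  qed
  have Ga: "amap G v \<in> Hom C (G0 Y) (G0 Z)" and FG: "amap F (amap G v) = conj v"
    if v: "v \<in> Hom D Y Z" for v Y Z
    unfolding G_def using lift[OF G0 G0 conj[OF v]] D.Hom_obj[OF v] HomD[OF v] by simp_all
  have G: "is_functor D C G"
    unfolding is_functor_def
  proof (intro conjI ballI impI)
    fix Z assume Z: "Z \<in> Obj D"
    show "omap G Z \<in> Obj C" using Z G0 by (simp add: G_def)
    show "amap G (Ident D Z) = Ident C (omap G Z)"
    proof (rule faith)
      note I = D.ident_in_hom[OF Z]
      show "amap G (Ident D Z) \<in> Hom C (G0 Z) (G0 Z)" by (rule Ga[OF I])
      show "Ident C (omap G Z) \<in> Hom C (G0 Z) (G0 Z)"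
        using C.ident_in_hom[OF G0[OF Z]] by (simp add: G_def)
      have "conj (Ident D Z) = Ident D (omap F (G0 Z))"
        by (rule \<epsilon>_cancel[OF conj[OF I] D.ident_in_hom[OF Fo[OF G0[OF Z]]] _ Z])
          (simp add: \<epsilon>conj[OF I] D.comp_ident_left[OF \<epsilon>[OF Z]] D.comp_ident_right[OF \<epsilon>[OF Z]])
      then show "amap F (amap G (Ident D Z)) = amap F (Ident C (omap G Z))"
        using FG[OF I] Fi[OF G0[OF Z]] by (simp add: G_def)
    qed
  next
    fix f assume "f \<in> Arr D"
    then show "amap G f \<in> Hom C (omap G (Dom D f)) (omap G (Cod D f))"
      using Ga[OF Arr_Hom] by (simp add: G_def)
  next
    fix f g assume f: "f \<in> Arr D" and g: "g \<in> Arr D" and "Dom D g = Cod D f"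
    then have f': "f \<in> Hom D (Dom D f) (Dom D g)" and g': "g \<in> Hom D (Dom D g) (Cod D g)"
      unfolding Hom_def by auto
    note gf = D.comp_in_hom[OF f' g']
    show "amap G (Comp D g f) = Comp C (amap G g) (amap G f)"
    proof (rule faith[OF Ga[OF gf] C.comp_in_hom[OF Ga[OF f'] Ga[OF g']]])
      note Z = D.Hom_obj(2)[OF g'] and Y = D.Hom_obj(1)[OF g'] and X = D.Hom_obj(1)[OF f']
      have "conj (Comp D g f) = Comp D (conj g) (conj f)"
      proof (rule \<epsilon>_cancel[OF conj[OF gf] D.comp_in_hom[OF conj[OF f'] conj[OF g']] _ Z])
        show "Comp D (\<epsilon> (Cod D g)) (conj (Comp D g f)) =
            Comp D (\<epsilon> (Cod D g)) (Comp D (conj g) (conj f))"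
          unfolding D.comp_assoc[OF conj[OF f'] conj[OF g'] \<epsilon>[OF Z]] \<epsilon>conj[OF gf] \<epsilon>conj[OF g']
            D.comp_assoc[OF conj[OF f'] \<epsilon>[OF Y] g', symmetric] \<epsilon>conj[OF f']
            D.comp_assoc[OF \<epsilon>[OF X] f' g'] ..
      qed
      then show "amap F (amap G (Comp D g f)) = amap F (Comp C (amap G g) (amap G f))"
        unfolding FG[OF gf] Fc[OF Ga[OF f'] Ga[OF g']] FG[OF f'] FG[OF g'] .
    qed
  qed
  have oG: "omap G = G0" by (simp add: G_def)
  have "naturally_isomorphic D D (comp_functor F G) id_functor"
    unfolding naturally_isomorphic_def
  proof (intro exI[of _ \<epsilon>] conjI ballI)
    fix Z assume Z: "Z \<in> Obj D"
    show "\<epsilon> Z \<in> Hom D (omap (comp_functor F G) Z) (omap id_functor Z)"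
      using \<epsilon>[OF Z] by (simp add: comp_functor_def id_functor_def oG)
    show "is_iso D (\<epsilon> Z)"
      unfolding is_iso_def using HomD[OF \<epsilon>[OF Z]] \<epsilon>'[OF Z] \<epsilon>'\<epsilon>[OF Z] \<epsilon>\<epsilon>'[OF Z] by auto
  next
    fix f assume "f \<in> Arr D"
    then show "Comp D (\<epsilon> (Cod D f)) (amap (comp_functor F G) f) =
        Comp D (amap id_functor f) (\<epsilon> (Dom D f))"
      using \<epsilon>conj[OF Arr_Hom] FG[OF Arr_Hom] by (simp add: comp_functor_def id_functor_def)
  qed
  moreover have "naturally_isomorphic C C (comp_functor G F) id_functor"
  proof -
    \<comment> \<open>The component is forced by the requirement that its image under
      \<open>F\<close> be \<epsilon>; its inverse is the lift of \<open>\<epsilon>'\<close>.\<close>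
    define \<eta> where "\<eta> X = lift (G0 (omap F X)) X (\<epsilon> (omap F X))" for X
    have \<eta>: "\<eta> X \<in> Hom C (G0 (omap F X)) X" "amap F (\<eta> X) = \<epsilon> (omap F X)" if "X \<in> Obj C" for X
      unfolding \<eta>_def using lift[OF G0[OF Fo[OF that]] that \<epsilon>[OF Fo[OF that]]] by auto
    have "is_iso C (\<eta> X)" if X: "X \<in> Obj C" for X
    proof -
      note FX = Fo[OF X] and GX = G0[OF Fo[OF X]]
      note k = lift[OF X GX \<epsilon>'[OF FX]]
      have "Comp C (lift X (G0 (omap F X)) (\<epsilon>' (omap F X))) (\<eta> X) = Ident C (G0 (omap F X))"
        by (rule faith[OF C.comp_in_hom[OF \<eta>(1)[OF X] k(1)] C.ident_in_hom[OF GX]])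
          (simp add: Fc[OF \<eta>(1)[OF X] k(1)] k(2) \<eta>(2)[OF X] \<epsilon>'\<epsilon>[OF FX] Fi[OF GX])
      moreover have "Comp C (\<eta> X) (lift X (G0 (omap F X)) (\<epsilon>' (omap F X))) = Ident C X"
        by (rule faith[OF C.comp_in_hom[OF k(1) \<eta>(1)[OF X]] C.ident_in_hom[OF X]])
          (simp add: Fc[OF k(1) \<eta>(1)[OF X]] k(2) \<eta>(2)[OF X] \<epsilon>\<epsilon>'[OF FX] Fi[OF X])
      ultimately show ?thesis
        unfolding is_iso_def using HomD[OF \<eta>(1)[OF X]] k(1) by auto
    qed
    moreover have "Comp C (\<eta> Y) (amap G (amap F f)) = Comp C f (\<eta> X)" if f: "f \<in> Hom C X Y" for f X Y
    proof -
      note X = C.Hom_obj(1)[OF f] and Y = C.Hom_obj(2)[OF f]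
      note Ff = Fa[OF f]
      show ?thesis
        by (rule faith[OF C.comp_in_hom[OF Ga[OF Ff] \<eta>(1)[OF Y]] C.comp_in_hom[OF \<eta>(1)[OF X] f]])
          (simp add: Fc[OF Ga[OF Ff] \<eta>(1)[OF Y]] Fc[OF \<eta>(1)[OF X] f] FG[OF Ff] \<eta>(2)[OF X] \<eta>(2)[OF Y] \<epsilon>conj[OF Ff])
    qed
    ultimately show ?thesis
      unfolding naturally_isomorphic_def
      by (intro exI[of _ \<eta>]) (auto simp: comp_functor_def id_functor_def oG \<eta>(1) dest: Arr_Hom)
  qed
  ultimately show ?thesis
    unfolding equivalent_categories_def using F G by blast
qed

section \<open>The category of Stone spaces\<close>

type_synonym 'u Stone_arrow = "'u topology \<times> ('u \<Rightarrow> 'u) \<times> 'u topology"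

definition fun_of :: "'u Stone_arrow \<Rightarrow> 'u \<Rightarrow> 'u" where
  "fun_of m = fst (snd m)"

text \<open>Arrows of \<open>Stone\<close> have to be extensional; the restriction makes any
  continuous function admissible.\<close>

definition arrow :: "'u topology \<Rightarrow> ('u \<Rightarrow> 'u) \<Rightarrow> 'u topology \<Rightarrow> 'u Stone_arrow" where
  "arrow X f Y = (X, restrict f (topspace X), Y)"

lemma Obj_Stone:
  fixes X :: "'u topology"
  shows "X \<in> Obj Stone \<longleftrightarrow> Stone_space X \<and> small TYPE('u) (topspace X)"
  unfolding Stone_def by simp

lemma Obj_StoneD:
  fixes X :: "'u topology"
  assumes "X \<in> Obj Stone"
  shows "Stone_space X" "small TYPE('u) (topspace X)" "compact_space X" "Hausdorff_space X"
  using assms Stone_space_compact Stone_space_Hausdorff unfolding Obj_Stone by auto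

lemma Hom_Stone_iff:
  fixes X Y :: "'u topology"
  shows "m \<in> Hom Stone X Y \<longleftrightarrow> X \<in> Obj Stone \<and> Y \<in> Obj Stone \<and> m = (X, fun_of m, Y) \<and>
    continuous_map X Y (fun_of m) \<and> fun_of m \<in> extensional (topspace X)"
  unfolding Hom_def Stone_def fun_of_def by (cases m) auto

lemma Hom_StoneD:
  assumes "m \<in> Hom Stone X Y"
  shows "X \<in> Obj Stone" "Y \<in> Obj Stone" "continuous_map X Y (fun_of m)"
  using assms unfolding Hom_Stone_iff by auto

lemma fun_of_in: "m \<in> Hom Stone X Y \<Longrightarrow> x \<in> topspace X \<Longrightarrow> fun_of m x \<in> topspace Y"
  using continuous_map_funspace[OF Hom_StoneD(3), of m X Y] by (simp add: Pi_iff)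

lemma Stone_ext:
  assumes "m \<in> Hom Stone X Y" "m' \<in> Hom Stone X Y"
    and "\<And>x. x \<in> topspace X \<Longrightarrow> fun_of m x = fun_of m' x"
  shows "m = m'"
proof -
  have "fun_of m = fun_of m'"
    using assms unfolding Hom_Stone_iff by (intro extensionalityI[of _ "topspace X"]) auto
  then show ?thesis
    using assms(1,2) unfolding Hom_Stone_iff by metis
qed

lemma fun_of_arrow: "x \<in> topspace X \<Longrightarrow> fun_of (arrow X f Y) x = f x"
  unfolding fun_of_def arrow_def by simp

lemma arrow_Hom:
  assumes "X \<in> Obj Stone" "Y \<in> Obj Stone" "continuous_map X Y f"
  shows "arrow X f Y \<in> Hom Stone X Y"
proof -
  have "continuous_map X Y (restrict f (topspace X))"
    by (rule continuous_map_eq[OF assms(3)]) simp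
  then show ?thesis
    using assms(1,2) unfolding Hom_Stone_iff by (simp add: arrow_def fun_of_def)
qed

lemma Comp_Stone:
  assumes "f \<in> Hom Stone X Y" "g \<in> Hom Stone Y Z"
  shows "Comp Stone g f = arrow X (\<lambda>x. fun_of g (fun_of f x)) Z"
proof -
  obtain f' g' where "f = (X, f', Y)" "g = (Y, g', Z)"
    using assms unfolding Hom_Stone_iff by metis
  then show ?thesis by (simp add: Stone_def arrow_def fun_of_def compose_def)
qed

lemma fun_of_comp:
  "f \<in> Hom Stone X Y \<Longrightarrow> g \<in> Hom Stone Y Z \<Longrightarrow> x \<in> topspace X \<Longrightarrow>
    fun_of (Comp Stone g f) x = fun_of g (fun_of f x)"
  by (simp add: Comp_Stone fun_of_arrow)

lemma Ident_Stone: "Ident Stone X = arrow X (\<lambda>x. x) X"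
  unfolding Stone_def arrow_def by simp

lemma fun_of_Ident: "x \<in> topspace X \<Longrightarrow> fun_of (Ident Stone X) x = x"
  by (simp add: Ident_Stone fun_of_arrow)

lemma Comp_Stone_Hom:
  assumes f: "f \<in> Hom Stone X Y" and g: "g \<in> Hom Stone Y Z"
  shows "Comp Stone g f \<in> Hom Stone X Z"
  unfolding Comp_Stone[OF f g]
  using continuous_map_compose[OF Hom_StoneD(3)[OF f] Hom_StoneD(3)[OF g]]
  by (intro arrow_Hom Hom_StoneD(1)[OF f] Hom_StoneD(2)[OF g]) (simp add: comp_def)

lemma Ident_Stone_Hom: "X \<in> Obj Stone \<Longrightarrow> Ident Stone X \<in> Hom Stone X X"
  unfolding Ident_Stone by (intro arrow_Hom) auto

lemma category_Stone: "category Stone"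
proof
  fix f assume "f \<in> Arr Stone"
  then show "Dom Stone f \<in> Obj Stone" "Cod Stone f \<in> Obj Stone"
    unfolding Stone_def by auto
next
  fix f X Y assume f: "f \<in> Hom Stone X Y"
  note IX = Ident_Stone_Hom[OF Hom_StoneD(1)[OF f]] and IY = Ident_Stone_Hom[OF Hom_StoneD(2)[OF f]]
  show "Comp Stone f (Ident Stone X) = f"
    by (rule Stone_ext[OF Comp_Stone_Hom[OF IX f] f]) (simp add: fun_of_comp[OF IX f] fun_of_Ident)
  show "Comp Stone (Ident Stone Y) f = f"
    by (rule Stone_ext[OF Comp_Stone_Hom[OF f IY] f]) (simp add: fun_of_comp[OF f IY] fun_of_Ident fun_of_in[OF f])
next
  fix f g h W X Y Z assume f: "f \<in> Hom Stone W X" and g: "g \<in> Hom Stone X Y" and h: "h \<in> Hom Stone Y Z"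
  note gf = Comp_Stone_Hom[OF f g] and hg = Comp_Stone_Hom[OF g h]
  show "Comp Stone h (Comp Stone g f) = Comp Stone (Comp Stone h g) f"
    by (rule Stone_ext[OF Comp_Stone_Hom[OF gf h] Comp_Stone_Hom[OF f hg]])
      (simp add: fun_of_comp[OF gf h] fun_of_comp[OF f hg] fun_of_comp[OF f g] fun_of_comp[OF g h] fun_of_in[OF f])
qed (rule Ident_Stone_Hom Comp_Stone_Hom; assumption)+

interpretation Stone: category Stone
  by (rule category_Stone)

text \<open>The inverse is continuous by compactness: its composite with the injective map
  \<open>fun_of m\<close> is the identity of a Hausdorff space.\<close>

lemma Stone_is_isoI:
  assumes m: "m \<in> Hom Stone X Y" and bij: "bij_betw (fun_of m) (topspace X) (topspace Y)"
  shows "is_iso Stone m"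
proof -
  let ?g = "inv_into (topspace X) (fun_of m)"
  note X = Hom_StoneD(1)[OF m] and Y = Hom_StoneD(2)[OF m]
  have inv: "fun_of m (?g y) = y" if "y \<in> topspace Y" for y
    using that bij by (simp add: bij_betw_inv_into_right)
  have gX: "?g y \<in> topspace X" if "y \<in> topspace Y" for y
    using that bij unfolding bij_betw_def by (metis inv_into_into)
  have "continuous_map Y X ?g"
  proof (rule continuous_map_inj_reflect)
    show "compact_space X" "Hausdorff_space Y" using X Y Obj_StoneD by auto
    show "continuous_map X Y (fun_of m)" by (rule Hom_StoneD(3)[OF m])
    show "inj_on (fun_of m) (topspace X)" using bij by (simp add: bij_betw_def)
    show "?g \<in> topspace Y \<rightarrow> topspace X" using gX by simp
    show "continuous_map Y Y (\<lambda>z. fun_of m (?g z))"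
      by (rule continuous_map_eq[OF continuous_map_id]) (simp add: inv)
  qed
  then have g: "arrow Y ?g X \<in> Hom Stone Y X" by (rule arrow_Hom[OF Y X])
  have "Comp Stone (arrow Y ?g X) m = Ident Stone X"
    by (rule Stone_ext[OF Comp_Stone_Hom[OF m g] Ident_Stone_Hom[OF X]])
      (use bij in \<open>simp add: fun_of_comp[OF m g] fun_of_Ident fun_of_arrow fun_of_in[OF m] bij_betw_inv_into_left\<close>)
  moreover have "Comp Stone m (arrow Y ?g X) = Ident Stone Y"
    by (rule Stone_ext[OF Comp_Stone_Hom[OF g m] Ident_Stone_Hom[OF Y]])
      (simp add: fun_of_comp[OF g m] fun_of_Ident fun_of_arrow inv)
  ultimately show ?thesis
    unfolding is_iso_def using g HomD[OF m] by auto
qed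


section \<open>Closed subsets as subobjects of a Stone space\<close>

definition range_of :: "'u Stone_arrow \<Rightarrow> 'u set" where
  "range_of m = fun_of m ` topspace (Dom Stone m)"

definition incl :: "'u topology \<Rightarrow> 'u set \<Rightarrow> 'u Stone_arrow" where
  "incl X K = arrow (subtopology X K) (\<lambda>x. x) X"

definition closed_sub :: "'u topology \<Rightarrow> 'u set \<Rightarrow> 'u Stone_arrow set" where
  "closed_sub X K = subobject Stone X (incl X K)"

lemma range_of_Hom: "m \<in> Hom Stone A X \<Longrightarrow> range_of m = fun_of m ` topspace A"
  unfolding range_of_def by (simp add: HomD)

lemma closedin_rng:
  assumes "m \<in> Hom Stone A X"
  shows "closedin X (range_of m)"
proof -
  have "closed_map A X (fun_of m)"
    using continuous_imp_closed_map[OF Hom_StoneD(3)[OF assms]]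
      Obj_StoneD(3)[OF Hom_StoneD(1)[OF assms]] Obj_StoneD(4)[OF Hom_StoneD(2)[OF assms]] by blast
  then show ?thesis
    unfolding range_of_Hom[OF assms] closed_map_def by simp
qed

lemma range_of_comp:
  assumes "f \<in> Hom Stone X Y" "g \<in> Hom Stone Y Z"
  shows "range_of (Comp Stone g f) = fun_of g ` range_of f"
  unfolding range_of_Hom[OF Comp_Stone_Hom[OF assms]] range_of_Hom[OF assms(1)] image_image
  using fun_of_comp[OF assms] by (intro image_cong) auto

context
  assumes inaccessible: "inaccessible TYPE('u)"
begin

lemma discrete_in_Obj: "finite A \<Longrightarrow> discrete_topology (A :: 'u set) \<in> Obj Stone"
  unfolding Obj_Stone by (simp add: small_finite[OF inaccessible] Stone_space_discrete)

definition point :: "'u topology" where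
  "point = discrete_topology {undefined}"

definition elem :: "'u topology \<Rightarrow> 'u \<Rightarrow> 'u Stone_arrow" where
  "elem X x = arrow point (\<lambda>_. x) X"

lemma topspace_point: "topspace point = {undefined}"
  unfolding point_def by simp

lemma point_Obj: "point \<in> Obj Stone"
  unfolding point_def by (rule discrete_in_Obj) simp

lemma elem_Hom: "X \<in> Obj Stone \<Longrightarrow> x \<in> topspace X \<Longrightarrow> elem X x \<in> Hom Stone point X"
  unfolding elem_def by (intro arrow_Hom point_Obj) (auto simp: point_def)

lemma fun_of_elem: "fun_of (elem X x) undefined = x"
  unfolding elem_def by (simp add: fun_of_arrow topspace_point)

text \<open>Two points of \<open>A\<close> are two arrows from the one-point space, so cancelling
  against these already gives injectivity.\<close>

lemma monos_into_Stone_iff: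
  fixes A X :: "'u topology"
  assumes m: "m \<in> Hom Stone A X"
  shows "m \<in> monos_into Stone X \<longleftrightarrow> inj_on (fun_of m) (topspace A)"
proof
  assume mono: "m \<in> monos_into Stone X"
  show "inj_on (fun_of m) (topspace A)"
  proof (rule inj_onI)
    fix x y assume x: "x \<in> topspace A" and y: "y \<in> topspace A" and eq: "fun_of m x = fun_of m y"
    note ex = elem_Hom[OF Hom_StoneD(1)[OF m] x] and ey = elem_Hom[OF Hom_StoneD(1)[OF m] y]
    have "Comp Stone m (elem A x) = Comp Stone m (elem A y)"
      by (rule Stone_ext[OF Comp_Stone_Hom[OF ex m] Comp_Stone_Hom[OF ey m]])
        (simp add: fun_of_comp[OF ex m] fun_of_comp[OF ey m] topspace_point fun_of_elem eq)
    then have "elem A x = elem A y"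
      using monos_intoD[OF mono, of "elem A x" point "elem A y"] ex ey HomD(2)[OF m] by simp
    then show "x = y" using fun_of_elem by metis
  qed
next
  assume inj: "inj_on (fun_of m) (topspace A)"
  show "m \<in> monos_into Stone X"
  proof (rule monos_intoI[OF m])
    fix W f g assume f: "f \<in> Hom Stone W A" and g: "g \<in> Hom Stone W A"
      and eq: "Comp Stone m f = Comp Stone m g"
    have "fun_of f x = fun_of g x" if x: "x \<in> topspace W" for x
    proof -
      have "fun_of m (fun_of f x) = fun_of m (fun_of g x)"
        using fun_of_comp[OF f m x] fun_of_comp[OF g m x] eq by simp
      then show ?thesis by (rule inj_onD[OF inj _ fun_of_in[OF f x] fun_of_in[OF g x]])
    qed
    then show "f = g" by (rule Stone_ext[OF f g])
  qed
qed

text \<open>Once ranges are nested, the lift through the injective \<open>m\<close> exists on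
  points, and compactness of the domain of \<open>m\<close> makes it continuous. Questions about
  subobjects thereby become questions about ranges.\<close>

lemma factors_through_Stone_iff:
  fixes W X :: "'u topology"
  assumes g: "g \<in> Hom Stone W X" and m: "m \<in> monos_into Stone X"
  shows "factors_through Stone g m \<longleftrightarrow> range_of g \<subseteq> range_of m"
proof -
  let ?A = "Dom Stone m"
  note mH = monos_into_Hom[OF m]
  have inj: "inj_on (fun_of m) (topspace ?A)"
    using m monos_into_Stone_iff[OF mH] by simp
  show ?thesis
    unfolding factors_through_iff[OF g mH]
  proof
    assume "\<exists>h\<in>Hom Stone W ?A. Comp Stone m h = g"
    then obtain h where h: "h \<in> Hom Stone W ?A" "Comp Stone m h = g" by blast
    have "range_of g = fun_of m ` range_of h"
      using range_of_comp[OF h(1) mH] h(2) by simp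
    also have "\<dots> \<subseteq> fun_of m ` topspace ?A"
      using fun_of_in[OF h(1)] unfolding range_of_Hom[OF h(1)] by (intro image_mono) auto
    finally show "range_of g \<subseteq> range_of m" unfolding range_of_Hom[OF mH] .
  next
    assume subobject: "range_of g \<subseteq> range_of m"
    let ?h = "\<lambda>w. inv_into (topspace ?A) (fun_of m) (fun_of g w)"
    have in_img: "fun_of g w \<in> fun_of m ` topspace ?A" if "w \<in> topspace W" for w
      using subobject that unfolding range_of_Hom[OF g] range_of_Hom[OF mH] by blast
    have mh: "fun_of m (?h w) = fun_of g w" if "w \<in> topspace W" for w
      by (rule f_inv_into_f[OF in_img[OF that]])
    have "continuous_map W ?A ?h"
    proof (rule continuous_map_inj_reflect)
      show "compact_space ?A" "Hausdorff_space X"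
        using Obj_StoneD Hom_StoneD[OF mH] by auto
      show "continuous_map ?A X (fun_of m)" by (rule Hom_StoneD(3)[OF mH])
      show "inj_on (fun_of m) (topspace ?A)" by (rule inj)
      show "?h \<in> topspace W \<rightarrow> topspace ?A"
        using inv_into_into[OF in_img] by blast
      show "continuous_map W X (\<lambda>z. fun_of m (?h z))"
        by (rule continuous_map_eq[OF Hom_StoneD(3)[OF g]]) (simp add: mh)
    qed
    then have h: "arrow W ?h ?A \<in> Hom Stone W ?A"
      by (rule arrow_Hom[OF Hom_StoneD(1)[OF g] Hom_StoneD(1)[OF mH]])
    have "Comp Stone m (arrow W ?h ?A) = g"
      by (rule Stone_ext[OF Comp_Stone_Hom[OF h mH] g]) (simp add: fun_of_comp[OF h mH] fun_of_arrow mh)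
    then show "\<exists>h\<in>Hom Stone W ?A. Comp Stone m h = g" using h by blast
  qed
qed

lemma incl_mono:
  fixes X :: "'u topology"
  assumes X: "X \<in> Obj Stone" and K: "closedin X K"
  shows "incl X K \<in> monos_into Stone X" "range_of (incl X K) = K"
proof -
  have t: "topspace (subtopology X K) = K"
    using closedin_subset[OF K] by (rule topspace_subtopology_subset)
  have "subtopology X K \<in> Obj Stone"
    using Stone_space_subtopology[OF Obj_StoneD(1)[OF X] K]
      small_subset[OF Obj_StoneD(2)[OF X] closedin_subset[OF K]] unfolding Obj_Stone t by simp
  then have H: "incl X K \<in> Hom Stone (subtopology X K) X"
    unfolding incl_def by (intro arrow_Hom X) simp_all
  have fun_of: "fun_of (incl X K) x = x" if "x \<in> K" for x
    unfolding incl_def using that by (simp add: fun_of_arrow t del: topspace_subtopology)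
  show "range_of (incl X K) = K"
    unfolding range_of_Hom[OF H] t using fun_of by simp
  show "incl X K \<in> monos_into Stone X"
    unfolding monos_into_Stone_iff[OF H] t using fun_of by (simp add: inj_on_def)
qed

text \<open>A monomorphism and the inclusion of its range have the same range, so closed sets are
  canonical representatives.\<close>

lemma sub_Stone:
  fixes X :: "'u topology"
  assumes "X \<in> Obj Stone" "m \<in> monos_into Stone X"
  shows "subobject Stone X m = closed_sub X (range_of m)"
proof -
  note mH = monos_into_Hom[OF assms(2)]
  note i = incl_mono[OF assms(1) closedin_rng[OF mH]]
  show ?thesis
    unfolding closed_sub_def Stone.sub_eq_iff[OF assms(2) i(1)]
    using factors_through_Stone_iff[OF mH i(1)] factors_through_Stone_iff[OF monos_into_Hom[OF i(1)] assms(2)]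
      i(2) by simp
qed

lemma lattice_of_sets_Stone:
  fixes X :: "'u topology"
  assumes X: "X \<in> Obj Stone"
  shows "lattice_of_sets (Sub Stone X) (closed_sub X) {K. closedin X K} (topspace X)"
proof
  show "eq (Sub Stone X) = (=)" by (rule eq_Sub)
  show "carrier (Sub Stone X) = closed_sub X ` {K. closedin X K}"
    unfolding carrier_Sub
  proof (intro equalityI subsetI)
    fix S assume "S \<in> subobject Stone X ` monos_into Stone X"
    then obtain m where m: "m \<in> monos_into Stone X" "S = subobject Stone X m" by blast
    then show "S \<in> closed_sub X ` {K. closedin X K}"
      using sub_Stone[OF X m(1)] closedin_rng[OF monos_into_Hom[OF m(1)]] by simp
  next
    fix S assume "S \<in> closed_sub X ` {K. closedin X K}"
    then show "S \<in> subobject Stone X ` monos_into Stone X"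
      unfolding closed_sub_def using incl_mono(1)[OF X] by auto
  qed
  fix A B assume "A \<in> {K. closedin X K}" "B \<in> {K. closedin X K}"
  then have A: "closedin X A" and B: "closedin X B" by simp_all
  show "closed_sub X A \<sqsubseteq>\<^bsub>Sub Stone X\<^esub> closed_sub X B \<longleftrightarrow> A \<subseteq> B"
    unfolding closed_sub_def Stone.le_Sub[OF incl_mono(1)[OF X A] incl_mono(1)[OF X B]]
      factors_through_Stone_iff[OF monos_into_Hom[OF incl_mono(1)[OF X A]] incl_mono(1)[OF X B]]
      incl_mono(2)[OF X A] incl_mono(2)[OF X B] ..
  show "A \<inter> B \<in> {K. closedin X K}" "A \<union> B \<in> {K. closedin X K}"
    using A B by auto
  show "A \<subseteq> topspace X" using A by (rule closedin_subset)
qed auto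

section \<open>Size and filtrality of the lattices of closed sets\<close>

lemma well_powered_Stone: "well_powered TYPE('u) (Stone :: ('u topology, _) cat)"
  unfolding well_powered_def
proof
  fix X :: "'u topology" assume X: "X \<in> Obj Stone"
  have "{K. closedin X K} \<subseteq> Pow (topspace X)"
    using closedin_subset by blast
  then show "small TYPE('u) (carrier (Sub Stone X))"
    unfolding lattice_of_sets.carrier_L[OF lattice_of_sets_Stone[OF X]]
    by (intro small_image small_subset[OF small_Pow[OF inaccessible Obj_StoneD(2)[OF X]]])
qed

text \<open>The embedding half is clopen separation of a point from a closed set. For surjectivity,
  compactness recovers a filter \<open>\<G>\<close> from the closed set
  \<open>\<Inter>\<G>\<close>.\<close>

lemma strongly_filtral_Stone: "strongly_filtral (Stone :: ('u topology, _) cat)"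
  unfolding strongly_filtral_def
proof
  fix X :: "'u topology" assume X: "X \<in> Obj Stone"
  interpret L: lattice_of_sets "Sub Stone X" "closed_sub X" "{K. closedin X K}" "topspace X"
    by (rule lattice_of_sets_Stone[OF X])
  note S = Obj_StoneD(1)[OF X]
  have clopens: "L.clopens = {V. clopen_in X V}"
    unfolding L.clopens_def clopen_in_def openin_closedin_eq[of X] by (auto dest: closedin_subset)
  show "filtral_lattice (Sub Stone X)"
    unfolding L.filtral_lattice_iff clopens
  proof (intro conjI ballI allI impI)
    fix A A' assume "A \<in> {K. closedin X K}" "A' \<in> {K. closedin X K}"
      and le: "\<forall>B\<in>{V. clopen_in X V}. A' \<subseteq> B \<longrightarrow> A \<subseteq> B"
    then have A: "closedin X A" and A': "closedin X A'" by simp_all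
    show "A \<subseteq> A'"
    proof (rule subsetI, rule ccontr)
      fix x assume x: "x \<in> A" "x \<notin> A'"
      then have "x \<in> topspace X" using closedin_subset[OF A] by blast
      then obtain V where "clopen_in X V" "A' \<subseteq> V" "x \<notin> V"
        using Stone_space_clopen_separation[OF S A' _ x(2)] by metis
      then show False using le x(1) by blast
    qed
  next
    fix \<G> assume G: "set_filter {V. clopen_in X V} \<G>"
    then have G_clopen: "\<And>V. V \<in> \<G> \<Longrightarrow> clopen_in X V" and "\<G> \<noteq> {}"
      and up: "\<And>V W. V \<in> \<G> \<Longrightarrow> clopen_in X W \<Longrightarrow> V \<subseteq> W \<Longrightarrow> W \<in> \<G>"
      and int: "\<And>V W. V \<in> \<G> \<Longrightarrow> W \<in> \<G> \<Longrightarrow> V \<inter> W \<in> \<G>"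
      unfolding set_filter_def by auto
    have closed: "closedin X (\<Inter>\<G>)"
      using G_clopen \<open>\<G> \<noteq> {}\<close> unfolding clopen_in_def by blast
    have "B \<in> \<G>" if B: "clopen_in X B" "\<Inter>\<G> \<subseteq> B" for B
    proof (rule ccontr)
      assume "B \<notin> \<G>"
      \<comment> \<open>By upward closure no member of the filter lies inside \<open>B\<close>.
        Hence the closed sets \<open>V - B\<close> have the finite intersection property, and a
        common point lies in \<open>\<Inter>\<G>\<close> but outside \<open>B\<close>.\<close>
      let ?\<U> = "(\<lambda>V. V - B) ` \<G>"
      have "\<forall>C\<in>?\<U>. closedin X C"
        using G_clopen B(1) unfolding clopen_in_def by (auto intro: closedin_diff)
      moreover have "\<Inter>\<F> \<noteq> {}" if \<F>: "finite \<F>" "\<F> \<subseteq> ?\<U>" for \<F>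
      proof -
        obtain \<G>' where \<G>': "finite \<G>'" "\<G>' \<subseteq> \<G>" "\<F> = (\<lambda>V. V - B) ` \<G>'"
          using finite_subset_image[OF \<F>] by auto
        have "\<exists>W\<in>\<G>. \<forall>V\<in>\<G>'. W \<subseteq> V"
          using \<G>'(1,2)
        proof (induction rule: finite_induct)
          case empty
          then show ?case using \<open>\<G> \<noteq> {}\<close> by blast
        next
          case (insert V \<G>'')
          then obtain W where W: "W \<in> \<G>" "\<forall>V\<in>\<G>''. W \<subseteq> V" by blast
          then have "V \<inter> W \<in> \<G>" using int insert.prems by blast
          then show ?case using W(2) by (intro bexI[of _ "V \<inter> W"]) auto
        qed
        then obtain W where W: "W \<in> \<G>" "\<forall>V\<in>\<G>'. W \<subseteq> V" by blast
        have "\<not> W \<subseteq> B" using up[OF W(1) B(1)] \<open>B \<notin> \<G>\<close> by blast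
        then show ?thesis using W(2) \<G>'(3) by auto
      qed
      ultimately have "\<Inter>?\<U> \<noteq> {}"
        using Obj_StoneD(3)[OF X] unfolding compact_space_fip by metis
      then show False using B(2) \<open>\<G> \<noteq> {}\<close> by auto
    qed
    then have "\<G> = {B \<in> {V. clopen_in X V}. \<Inter>\<G> \<subseteq> B}"
      using G_clopen by auto
    then show "\<exists>A\<in>{K. closedin X K}. \<G> = {B \<in> {V. clopen_in X V}. A \<subseteq> B}"
      using closed by (intro bexI[of _ "\<Inter>\<G>"]) simp_all
  qed
qed

section \<open>Images, pullbacks and finite joins as ranges, preimages and unions\<close>

lemma is_image_Stone_iff:
  fixes X Y :: "'u topology"
  assumes f: "f \<in> Hom Stone X Y"
  shows "is_image Stone f S \<longleftrightarrow> S = closed_sub Y (range_of f)"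
proof -
  note Y = Hom_StoneD(2)[OF f]
  note i = incl_mono[OF Y closedin_rng[OF f]]
  have fact: "factors_through Stone f n \<longleftrightarrow> range_of f \<subseteq> range_of n" if "n \<in> monos_into Stone Y" for n
    by (rule factors_through_Stone_iff[OF f that])
  have fact': "factors_through Stone m n \<longleftrightarrow> range_of m \<subseteq> range_of n"
    if "m \<in> monos_into Stone Y" "n \<in> monos_into Stone Y" for m n
    by (rule factors_through_Stone_iff[OF monos_into_Hom[OF that(1)] that(2)])
  show ?thesis
    unfolding Stone.is_image_iff[OF f]
  proof
    assume "\<exists>m\<in>monos_into Stone Y. S = subobject Stone Y m \<and> factors_through Stone f m \<and>
      (\<forall>n\<in>monos_into Stone Y. factors_through Stone f n \<longrightarrow> factors_through Stone m n)"
    then obtain m where m: "m \<in> monos_into Stone Y" "S = subobject Stone Y m" "range_of f \<subseteq> range_of m"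
      and least: "\<forall>n\<in>monos_into Stone Y. factors_through Stone f n \<longrightarrow> factors_through Stone m n"
      using fact by blast
    have "range_of m \<subseteq> range_of f"
      using least i fact[OF i(1)] fact'[OF m(1) i(1)] by simp
    then have "range_of m = range_of f" using m(3) by simp
    then show "S = closed_sub Y (range_of f)"
      using sub_Stone[OF Y m(1)] m(2) by simp
  next
    assume "S = closed_sub Y (range_of f)"
    then show "\<exists>m\<in>monos_into Stone Y. S = subobject Stone Y m \<and> factors_through Stone f m \<and>
      (\<forall>n\<in>monos_into Stone Y. factors_through Stone f n \<longrightarrow> factors_through Stone m n)"
      using i fact fact' by (intro bexI[OF _ i(1)]) (simp add: closed_sub_def)
  qed
qed

lemma pullback_sub_Stone:
  fixes X Y :: "'u topology"
  assumes f: "f \<in> Hom Stone X Y" and K: "closedin Y K"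
  shows "pullback_sub Stone f (closed_sub Y K) = closed_sub X {x \<in> topspace X. fun_of f x \<in> K}"
proof -
  note X = Hom_StoneD(1)[OF f] and Y = Hom_StoneD(2)[OF f]
  have K': "closedin X {x \<in> topspace X. fun_of f x \<in> K}"
    by (rule closedin_continuous_map_preimage[OF Hom_StoneD(3)[OF f] K])
  note i = incl_mono[OF Y K] and i' = incl_mono[OF X K']
  show ?thesis
    unfolding closed_sub_def
  proof (rule Stone.pullback_sub_eq[OF i(1) f i'(1)])
    fix W g assume g: "g \<in> Hom Stone W X"
    have "range_of g \<subseteq> topspace X" using fun_of_in[OF g] unfolding range_of_Hom[OF g] by blast
    then show "factors_through Stone g (incl X {x \<in> topspace X. fun_of f x \<in> K}) \<longleftrightarrow>
        factors_through Stone (Comp Stone f g) (incl Y K)"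
      unfolding factors_through_Stone_iff[OF g i'(1)]
        factors_through_Stone_iff[OF Comp_Stone_Hom[OF g f] i(1)] i(2) i'(2) range_of_comp[OF g f] by auto
  qed
qed

text \<open>A compatible pair of points is a cone with vertex the one-point space, so the universal
  property alone produces \<open>c\<close>, whatever the pullback looks like.\<close>

lemma pullback_Stone_points:
  assumes pb: "is_pullback Stone f g p q"
    and a: "a \<in> topspace (Dom Stone f)" and b: "b \<in> topspace (Dom Stone g)" and ab: "fun_of f a = fun_of g b"
  shows "\<exists>c\<in>topspace (Dom Stone p). fun_of p c = a \<and> fun_of q c = (b :: 'u)"
proof -
  note H = is_pullback_Hom[OF pb]
  note ea = elem_Hom[OF Hom_StoneD(1)[OF H(1)] a] and eb = elem_Hom[OF Hom_StoneD(1)[OF H(2)] b]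
  have eq: "Comp Stone f (elem (Dom Stone f) a) = Comp Stone g (elem (Dom Stone g) b)"
    by (rule Stone_ext[OF Comp_Stone_Hom[OF ea H(1)] Comp_Stone_Hom[OF eb H(2)]])
      (simp add: fun_of_comp[OF ea H(1)] fun_of_comp[OF eb H(2)] topspace_point fun_of_elem ab)
  obtain h where h: "h \<in> Hom Stone point (Dom Stone p)"
    "Comp Stone p h = elem (Dom Stone f) a" "Comp Stone q h = elem (Dom Stone g) b"
    by (rule is_pullback_universal[OF pb ea eb eq])
  have u: "undefined \<in> topspace point" by (simp add: topspace_point)
  show ?thesis
    using fun_of_comp[OF h(1) H(3) u] fun_of_comp[OF h(1) H(4) u] h(2,3) fun_of_in[OF h(1) u]
    by (intro bexI[of _ "fun_of h undefined"]) (simp_all add: fun_of_elem)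
qed

lemma image_stable_Stone:
  fixes f g :: "'u Stone_arrow"
  assumes pb: "is_pullback Stone f g p q" and S: "is_image Stone f S"
  shows "is_image Stone q (pullback_sub Stone g S)"
proof -
  note H = is_pullback_Hom[OF pb]
  \<comment> \<open>On closed sets, stability of images says that the range of \<open>q\<close> is
    the preimage of the range of \<open>f\<close>.\<close>
  have "range_of q = {x \<in> topspace (Dom Stone g). fun_of g x \<in> range_of f}"
  proof (intro equalityI subsetI)
    fix y assume "y \<in> range_of q"
    then obtain c where c: "c \<in> topspace (Dom Stone p)" "y = fun_of q c"
      unfolding range_of_Hom[OF H(4)] by blast
    have "fun_of g y = fun_of f (fun_of p c)"
      using fun_of_comp[OF H(3,1) c(1)] fun_of_comp[OF H(4,2) c(1)] H(5) c(2) by simp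
    then show "y \<in> {x \<in> topspace (Dom Stone g). fun_of g x \<in> range_of f}"
      using c fun_of_in[OF H(3) c(1)] fun_of_in[OF H(4) c(1)] unfolding range_of_Hom[OF H(1)] by simp
  next
    fix y assume "y \<in> {x \<in> topspace (Dom Stone g). fun_of g x \<in> range_of f}"
    then obtain a where "y \<in> topspace (Dom Stone g)" "a \<in> topspace (Dom Stone f)" "fun_of f a = fun_of g y"
      unfolding range_of_Hom[OF H(1)] by auto
    then show "y \<in> range_of q"
      using pullback_Stone_points[OF pb, of a y] unfolding range_of_Hom[OF H(4)] by blast
  qed
  moreover have "S = closed_sub (Cod Stone f) (range_of f)"
    using S is_image_Stone_iff[OF H(1)] by simp
  ultimately show ?thesis
    using is_image_Stone_iff[OF H(4)] pullback_sub_Stone[OF H(2) closedin_rng[OF H(1)]] by simp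
qed

lemma is_lub_Stone_iff:
  fixes X :: "'u topology"
  assumes X: "X \<in> Obj Stone" and fin: "finite \<A>" and closed: "\<And>A. A \<in> \<A> \<Longrightarrow> closedin X A"
  shows "is_lub (Sub Stone X) S (closed_sub X ` \<A>) \<longleftrightarrow> S = closed_sub X (\<Union>\<A>)"
proof -
  interpret L: lattice_of_sets "Sub Stone X" "closed_sub X" "{K. closedin X K}" "topspace X"
    by (rule lattice_of_sets_Stone[OF X])
  have subobject: "\<A> \<subseteq> {K. closedin X K}" using closed by blast
  have U: "closedin X (\<Union>\<A>)" by (rule closedin_Union[OF fin closed])
  show ?thesis
    unfolding L.Upper_L[OF subobject] using U
    by (subst L.least_L) (auto intro!: arg_cong[where f = "closed_sub X"])
qed

end

section \<open>Limits and coproducts of Stone spaces\<close>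

lemma continuous_map_from_sum:
  assumes "\<And>i. i \<in> I \<Longrightarrow> continuous_map (X i) Y (\<lambda>x. f (i, x))"
  shows "continuous_map (sum_topology X I) Y f"
  unfolding continuous_map_def
proof (intro conjI allI impI)
  show "f \<in> topspace (sum_topology X I) \<rightarrow> topspace Y"
  proof
    fix p assume "p \<in> topspace (sum_topology X I)"
    then obtain i x where "p = (i, x)" "i \<in> I" "x \<in> topspace (X i)" by auto
    then show "f p \<in> topspace Y"
      using continuous_map_funspace[OF assms[of i]] by auto
  qed
  fix U assume U: "openin Y U"
  show "openin (sum_topology X I) {p \<in> topspace (sum_topology X I). f p \<in> U}"
    unfolding openin_sum_topology
  proof (intro conjI ballI)
    show "{p \<in> topspace (sum_topology X I). f p \<in> U} \<subseteq> Sigma I (topspace \<circ> X)" by auto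
    fix i assume i: "i \<in> I"
    have "{x. (i, x) \<in> {p \<in> topspace (sum_topology X I). f p \<in> U}} = {x \<in> topspace (X i). f (i, x) \<in> U}"
      using i by auto
    then show "openin (X i) {x. (i, x) \<in> {p \<in> topspace (sum_topology X I). f p \<in> U}}"
      using openin_continuous_map_preimage[OF assms[OF i] U] by simp
  qed
qed

text \<open>Finiteness of \<open>I\<close> makes the sum compact. Points in one summand are
  separated by a clopen of that summand, points in different summands by a whole summand.\<close>

lemma Stone_space_sum:
  assumes fin: "finite I" and X: "\<And>i. i \<in> I \<Longrightarrow> Stone_space (X i)"
  shows "Stone_space (sum_topology X I)"
proof (rule Stone_spaceI)
  have "compactin (sum_topology X I) (\<Union>((\<lambda>i. Pair i ` topspace (X i)) ` I))"
  proof (rule compactin_Union)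
    fix S assume "S \<in> (\<lambda>i. Pair i ` topspace (X i)) ` I"
    then obtain i where i: "i \<in> I" "S = Pair i ` topspace (X i)" by blast
    have "compactin (X i) (topspace (X i))"
      using Stone_space_compact[OF X[OF i(1)]] by (simp add: compact_space_def)
    then show "compactin (sum_topology X I) S"
      unfolding i(2) by (rule image_compactin) (simp add: continuous_map_component_injection i(1))
  qed (use fin in simp)
  moreover have "\<Union>((\<lambda>i. Pair i ` topspace (X i)) ` I) = topspace (sum_topology X I)" by auto
  ultimately show "compact_space (sum_topology X I)" by (simp add: compact_space_def)
next
  fix p q assume "p \<in> topspace (sum_topology X I)" "q \<in> topspace (sum_topology X I)" "p \<noteq> q"
  then have pq: "p \<in> Sigma I (topspace \<circ> X)" "q \<in> Sigma I (topspace \<circ> X)" by simp_all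
  obtain i x where p: "p = (i, x)" "i \<in> I" "x \<in> topspace (X i)" using pq(1) by auto
  obtain j y where q: "q = (j, y)" "j \<in> I" "y \<in> topspace (X j)" using pq(2) by auto
  have clopen: "clopen_in (sum_topology X I) (Pair i ` V)" if "clopen_in (X i) V" for V
    using that p(2) open_map_component_injection[of i I X] closed_map_component_injection[of i I X]
    unfolding clopen_in_def open_map_def closed_map_def by blast
  have whole: "clopen_in (X i) (topspace (X i))" by (simp add: clopen_in_def)
  show "\<exists>V. clopen_in (sum_topology X I) V \<and> p \<in> V \<and> q \<notin> V"
  proof (cases "i = j")
    case True
    have "closedin (X i) {y}"
      using closedin_Hausdorff_singleton[OF Stone_space_Hausdorff[OF X[OF p(2)]]] q(3) True by simp
    moreover have "x \<notin> {y}" using \<open>p \<noteq> q\<close> p(1) q(1) True by simp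
    ultimately obtain V where V: "clopen_in (X i) V" "{y} \<subseteq> V" "x \<notin> V"
      using Stone_space_clopen_separation[OF X[OF p(2)] _ p(3)] by metis
    show ?thesis
      using clopen[OF clopen_in_complement[OF V(1)]] V p q True
      by (intro exI[of _ "Pair i ` (topspace (X i) - V)"]) auto
  next
    case False
    then show ?thesis
      using clopen[OF whole] p q by (intro exI[of _ "Pair i ` topspace (X i)"]) auto
  qed
qed

context
  assumes inaccessible: "inaccessible TYPE('u)"
begin

lemma Stone_code:
  fixes W :: "'x topology"
  assumes "Stone_space W" "small TYPE('u) (topspace W)"
  shows "\<exists>(X :: 'u topology) h g. X \<in> Obj Stone \<and> continuous_map W X h \<and> continuous_map X W g \<and>
    (\<forall>w\<in>topspace W. g (h w) = w) \<and> (\<forall>x\<in>topspace X. h (g x) = x)"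
proof -
  obtain X :: "'u topology" and h where X: "Stone_space X" "small TYPE('u) (topspace X)"
    and h: "homeomorphic_map W X h"
    by (rule Stone_space_code[OF assms])
  obtain g where "homeomorphic_maps W X h g"
    using h homeomorphic_map_maps by blast
  then show ?thesis
    using X unfolding homeomorphic_maps_def Obj_Stone by (intro exI[of _ X] exI[of _ h] exI[of _ g]) simp
qed

text \<open>The limit consists of the compatible families in the product, a closed set because the
  spaces are Hausdorff. Only objects of the shape index the product, so smallness of
  \<open>Obj J\<close> bounds it.\<close>

lemma has_limits_of_shape_Stone:
  fixes J :: "('j, 'b) cat"
  assumes J: "category J" and small_J: "small TYPE('u) (Obj J)"
  shows "has_limits_of_shape J (Stone :: ('u topology, _) cat)"
  unfolding has_limits_of_shape_def
proof (intro allI impI)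
  fix D :: "('j, 'b, 'u topology, 'u Stone_arrow) fctr" assume D: "is_functor J Stone D"
  have Y: "omap D j \<in> Obj Stone" if "j \<in> Obj J" for j
    using D that unfolding is_functor_def by blast
  have Du: "amap D u \<in> Hom Stone (omap D (Dom J u)) (omap D (Cod J u))" if "u \<in> Arr J" for u
    using D that unfolding is_functor_def by blast
  have dom: "Dom J u \<in> Obj J" "Cod J u \<in> Obj J" if "u \<in> Arr J" for u
    using category.dom_in_obj[OF J that] category.cod_in_obj[OF J that] by auto
  let ?P = "product_topology (omap D) (Obj J)"
  define L where "L = topspace ?P \<inter>
    (\<Inter>u\<in>Arr J. {x \<in> topspace ?P. fun_of (amap D u) (x (Dom J u)) = x (Cod J u)})"
  have L_iff: "x \<in> L \<longleftrightarrow> x \<in> topspace ?P \<and> (\<forall>u\<in>Arr J. fun_of (amap D u) (x (Dom J u)) = x (Cod J u))" for x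
    unfolding L_def by blast
  have "closedin ?P {x \<in> topspace ?P. fun_of (amap D u) (x (Dom J u)) = x (Cod J u)}" if u: "u \<in> Arr J" for u
  proof (rule closedin_continuous_maps_eq)
    show "Hausdorff_space (omap D (Cod J u))"
      using Obj_StoneD(4)[OF Y[OF dom(2)[OF u]]] .
    show "continuous_map ?P (omap D (Cod J u)) (\<lambda>x. fun_of (amap D u) (x (Dom J u)))"
      using continuous_map_compose[OF continuous_map_product_projection[OF dom(1)[OF u], of "omap D"]
          Hom_StoneD(3)[OF Du[OF u]]] by (simp add: comp_def)
    show "continuous_map ?P (omap D (Cod J u)) (\<lambda>x. x (Cod J u))"
      by (rule continuous_map_product_projection[OF dom(2)[OF u]])
  qed
  \<comment> \<open>Closed sets admit only nonempty intersections, hence the separate case of a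
    shape without arrows.\<close>
  then have L_closed: "closedin ?P L"
  proof (cases "Arr J = {}")
    case True
    then have "L = topspace ?P" unfolding L_def by simp
    then show ?thesis using closedin_topspace by metis
  next
    case False
    then show ?thesis
      unfolding L_def
      using \<open>\<And>u. u \<in> Arr J \<Longrightarrow> closedin ?P {x \<in> topspace ?P. fun_of (amap D u) (x (Dom J u)) = x (Cod J u)}\<close>
      by (intro closedin_Int closedin_topspace closedin_Inter) auto
  qed
  let ?W = "subtopology ?P L"
  have tW: "topspace ?W = L"
    by (rule topspace_subtopology_subset[OF closedin_subset[OF L_closed]])
  have Stone_W: "Stone_space ?W"
    by (rule Stone_space_subtopology[OF Stone_space_product[OF Obj_StoneD(1)[OF Y]] L_closed])
  have small_W: "small TYPE('u) (topspace ?W)"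
    unfolding tW
  proof (rule small_subset)
    show "small TYPE('u) (\<Pi>\<^sub>E j\<in>Obj J. topspace (omap D j))"
      by (rule small_PiE[OF inaccessible small_J Obj_StoneD(2)[OF Y]])
    show "L \<subseteq> (\<Pi>\<^sub>E j\<in>Obj J. topspace (omap D j))"
      using closedin_subset[OF L_closed] by simp
  qed
  obtain X :: "'u topology" and h g where X: "X \<in> Obj Stone"
    and h: "continuous_map ?W X h" and g: "continuous_map X ?W g"
    and gh_all: "\<forall>w\<in>topspace ?W. g (h w) = w" and hg_all: "\<forall>x\<in>topspace X. h (g x) = x"
    using Stone_code[OF Stone_W small_W] by (elim exE conjE)
  note gh = bspec[OF gh_all] and hg = bspec[OF hg_all]
  have gL: "g x \<in> L" if "x \<in> topspace X" for x
    using continuous_map_funspace[OF g] that tW by (auto simp: Pi_iff)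
  define \<mu> where "\<mu> j = arrow X (\<lambda>x. g x j) (omap D j)" for j
  have \<mu>: "\<mu> j \<in> Hom Stone X (omap D j)" if j: "j \<in> Obj J" for j
    unfolding \<mu>_def
  proof (rule arrow_Hom[OF X Y[OF j]])
    have "continuous_map ?W (omap D j) (\<lambda>x. x j)"
      by (rule continuous_map_from_subtopology[OF continuous_map_product_projection[OF j]])
    then show "continuous_map X (omap D j) (\<lambda>x. g x j)"
      using continuous_map_compose[OF g] by (force simp: comp_def)
  qed
  have fun_of_\<mu>: "fun_of (\<mu> j) x = g x j" if "x \<in> topspace X" for j x
    unfolding \<mu>_def by (rule fun_of_arrow[OF that])
  have "is_limit J Stone D X \<mu>"
    unfolding is_limit_def is_cone_def
  proof (intro conjI ballI allI impI X)
    fix j assume "j \<in> Obj J"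
    then show "\<mu> j \<in> Hom Stone X (omap D j)" by (rule \<mu>)
  next
    fix u assume u: "u \<in> Arr J"
    note H = \<mu>[OF dom(1)[OF u]] and H' = \<mu>[OF dom(2)[OF u]]
    show "Comp Stone (amap D u) (\<mu> (Dom J u)) = \<mu> (Cod J u)"
    proof (rule Stone_ext[OF Comp_Stone_Hom[OF H Du[OF u]] H'])
      fix x assume x: "x \<in> topspace X"
      show "fun_of (Comp Stone (amap D u) (\<mu> (Dom J u))) x = fun_of (\<mu> (Cod J u)) x"
        unfolding fun_of_comp[OF H Du[OF u] x] fun_of_\<mu>[OF x] using gL[OF x] u unfolding L_iff by blast
    qed
  next
    fix K \<nu>
    assume "K \<in> Obj Stone \<and> (\<forall>j\<in>Obj J. \<nu> j \<in> Hom Stone K (omap D j)) \<and>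
      (\<forall>u\<in>Arr J. Comp Stone (amap D u) (\<nu> (Dom J u)) = \<nu> (Cod J u))"
    then have K: "K \<in> Obj Stone" and \<nu>: "\<And>j. j \<in> Obj J \<Longrightarrow> \<nu> j \<in> Hom Stone K (omap D j)"
      and nat: "\<And>u. u \<in> Arr J \<Longrightarrow> Comp Stone (amap D u) (\<nu> (Dom J u)) = \<nu> (Cod J u)" by auto
    \<comment> \<open>The compatible family that the cone defines at \<open>k\<close>; applying
      \<open>h\<close> turns it into a point of the recoded limit.\<close>
    let ?t = "\<lambda>k. restrict (\<lambda>j. fun_of (\<nu> j) k) (Obj J)"
    have tL: "?t k \<in> L" if k: "k \<in> topspace K" for k
      unfolding L_iff
    proof (intro conjI ballI)
      show "?t k \<in> topspace ?P" using fun_of_in[OF \<nu> k] by simp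
      fix u assume u: "u \<in> Arr J"
      show "fun_of (amap D u) (?t k (Dom J u)) = ?t k (Cod J u)"
        using fun_of_comp[OF \<nu>[OF dom(1)[OF u]] Du[OF u] k] nat[OF u] dom[OF u] by simp
    qed
    have "continuous_map K ?P ?t"
      unfolding continuous_map_componentwise using Hom_StoneD(3)[OF \<nu>] by auto
    then have "continuous_map K ?W ?t"
      by (rule continuous_map_into_subtopology) (use tL in blast)
    then have "continuous_map K X (\<lambda>k. h (?t k))"
      using continuous_map_compose[OF _ h] by (force simp: comp_def)
    then have tH: "arrow K (\<lambda>k. h (?t k)) X \<in> Hom Stone K X"
      by (rule arrow_Hom[OF K X])
    have gt: "g (h (?t k)) = ?t k" if "k \<in> topspace K" for k
      using gh tL[OF that] tW by blast
    have ht: "h (?t k) \<in> topspace X" if "k \<in> topspace K" for k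
      using continuous_map_funspace[OF h] tL[OF that] tW by blast
    show "\<exists>!h. h \<in> Hom Stone K X \<and> (\<forall>j\<in>Obj J. Comp Stone (\<mu> j) h = \<nu> j)"
    proof (rule ex1I)
      have "Comp Stone (\<mu> j) (arrow K (\<lambda>k. h (?t k)) X) = \<nu> j" if j: "j \<in> Obj J" for j
        by (rule Stone_ext[OF Comp_Stone_Hom[OF tH \<mu>[OF j]] \<nu>[OF j]])
          (use j in \<open>simp add: fun_of_comp[OF tH \<mu>[OF j]] fun_of_arrow fun_of_\<mu>[OF ht] gt\<close>)
      then show "arrow K (\<lambda>k. h (?t k)) X \<in> Hom Stone K X \<and>
          (\<forall>j\<in>Obj J. Comp Stone (\<mu> j) (arrow K (\<lambda>k. h (?t k)) X) = \<nu> j)"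
        using tH by blast
    next
      fix v assume "v \<in> Hom Stone K X \<and> (\<forall>j\<in>Obj J. Comp Stone (\<mu> j) v = \<nu> j)"
      then have v: "v \<in> Hom Stone K X" and v\<mu>: "\<And>j. j \<in> Obj J \<Longrightarrow> Comp Stone (\<mu> j) v = \<nu> j" by auto
      show "v = arrow K (\<lambda>k. h (?t k)) X"
      proof (rule Stone_ext[OF v tH])
        fix k assume k: "k \<in> topspace K"
        note vk = fun_of_in[OF v k]
        have "g (fun_of v k) = ?t k"
        proof (rule PiE_ext[of _ "Obj J" "\<lambda>j. topspace (omap D j)"])
          show "g (fun_of v k) \<in> (\<Pi>\<^sub>E j\<in>Obj J. topspace (omap D j))"
            "?t k \<in> (\<Pi>\<^sub>E j\<in>Obj J. topspace (omap D j))"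
            using gL[OF vk] tL[OF k] unfolding L_iff by simp_all
          fix j assume j: "j \<in> Obj J"
          show "g (fun_of v k) j = ?t k j"
            using fun_of_comp[OF v \<mu>[OF j] k] v\<mu>[OF j] fun_of_\<mu>[OF vk] j by simp
        qed
        then show "fun_of v k = fun_of (arrow K (\<lambda>k. h (?t k)) X) k"
          using hg[OF vk] by (simp add: fun_of_arrow k)
      qed
    qed
  qed
  then show "\<exists>L \<mu>. is_limit J Stone D L \<mu>" by blast
qed

lemma complete_Stone: "complete_category TYPE('u) (Stone :: ('u topology, _) cat)"
  unfolding complete_category_def using has_limits_of_shape_Stone by blast

lemma has_finite_limits_Stone: "has_finite_limits (Stone :: ('u topology, _) cat)"
  unfolding has_finite_limits_def using has_limits_of_shape_Stone small_finite[OF inaccessible] by blast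

lemma regular_Stone: "regular_category (Stone :: ('u topology, _) cat)"
  unfolding regular_category_def
proof (intro conjI ballI allI impI)
  fix f :: "'u Stone_arrow" assume "f \<in> Arr Stone"
  then show "\<exists>S. is_image Stone f S"
    using is_image_Stone_iff[OF inaccessible Arr_Hom] by blast
next
  fix f g p q and S :: "'u Stone_arrow set" assume "is_pullback Stone f g p q \<and> is_image Stone f S"
  then show "is_image Stone q (pullback_sub Stone g S)"
    using image_stable_Stone[OF inaccessible] by blast
qed (rule category_Stone has_finite_limits_Stone)+

lemma coherent_Stone: "coherent_category (Stone :: ('u topology, _) cat)"
  unfolding coherent_category_def
proof (intro conjI ballI allI impI)
  show "regular_category (Stone :: ('u topology, _) cat)" by (rule regular_Stone)
next
  fix X :: "'u topology" and A assume X: "X \<in> Obj Stone" and "A \<subseteq> carrier (Sub Stone X)" "finite A"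
  then have subobject: "A \<subseteq> closed_sub X ` {K. closedin X K}"
    using lattice_of_sets.carrier_L[OF lattice_of_sets_Stone[OF inaccessible X]] by simp
  obtain \<A> where \<A>: "\<A> \<subseteq> {K. closedin X K}" "finite \<A>" "A = closed_sub X ` \<A>"
    using finite_subset_image[OF \<open>finite A\<close> subobject] by (elim exE conjE)
  have "closedin X K" if "K \<in> \<A>" for K using \<A>(1) that by blast
  from is_lub_Stone_iff[OF inaccessible X \<A>(2) this]
  show "\<exists>S. is_lub (Sub Stone X) S A" unfolding \<A>(3) by simp
next
  fix f :: "'u Stone_arrow" and A S
  assume "f \<in> Arr Stone" and "A \<subseteq> carrier (Sub Stone (Cod Stone f))"
    and AS: "finite A \<and> is_lub (Sub Stone (Cod Stone f)) S A"
  define X Y where "X = Dom Stone f" and "Y = Cod Stone f"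
  have f: "f \<in> Hom Stone X Y" using Arr_Hom[OF \<open>f \<in> Arr Stone\<close>] by (simp add: X_def Y_def)
  note X = Hom_StoneD(1)[OF f] and Y = Hom_StoneD(2)[OF f]
  have "A \<subseteq> closed_sub Y ` {K. closedin Y K}"
    using \<open>A \<subseteq> _\<close> lattice_of_sets.carrier_L[OF lattice_of_sets_Stone[OF inaccessible Y]] by (simp add: Y_def)
  then obtain \<A> where \<A>: "\<And>K. K \<in> \<A> \<Longrightarrow> closedin Y K" "finite \<A>" "A = closed_sub Y ` \<A>"
    using finite_subset_image[of A "closed_sub Y" "{K. closedin Y K}"] AS by auto
  let ?pre = "\<lambda>K. {x \<in> topspace X. fun_of f x \<in> K}"
  have pre: "closedin X (?pre K)" if "closedin Y K" for K
    by (rule closedin_continuous_map_preimage[OF Hom_StoneD(3)[OF f] that])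
  have S: "S = closed_sub Y (\<Union>\<A>)"
    using AS is_lub_Stone_iff[OF inaccessible Y \<A>(2,1)] unfolding \<A>(3) Y_def by simp
  have A_eq: "pullback_sub Stone f ` A = closed_sub X ` ?pre ` \<A>"
    unfolding \<A>(3) image_image using pullback_sub_Stone[OF inaccessible f] \<A>(1) by (intro image_cong) auto
  have S_eq: "pullback_sub Stone f S = closed_sub X (?pre (\<Union>\<A>))"
    unfolding S by (rule pullback_sub_Stone[OF inaccessible f closedin_Union[OF \<A>(2,1)]])
  \<comment> \<open>Preservation of joins comes down to preimages commuting with unions.\<close>
  have Un_eq: "?pre (\<Union>\<A>) = \<Union>(?pre ` \<A>)" by auto
  have closed: "closedin X B" if "B \<in> ?pre ` \<A>" for B
    using that pre \<A>(1) by auto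
  have "is_lub (Sub Stone X) (pullback_sub Stone f S) (pullback_sub Stone f ` A)"
    unfolding A_eq S_eq Un_eq
    by (rule is_lub_Stone_iff[OF inaccessible X finite_imageI[OF \<A>(2)] closed, THEN iffD2, OF _ refl])
  then show "is_lub (Sub Stone (Dom Stone f)) (pullback_sub Stone f S) (pullback_sub Stone f ` A)"
    by (simp add: X_def)
qed

lemma has_finite_coproducts_Stone: "has_finite_coproducts (Stone :: ('u topology, _) cat)"
  unfolding has_finite_coproducts_def
proof (intro allI impI)
  fix n :: nat and X :: "nat \<Rightarrow> 'u topology" assume "\<forall>i<n. X i \<in> Obj Stone"
  then have X: "X i \<in> Obj Stone" if "i \<in> {..<n}" for i using that by simp
  let ?W = "sum_topology X {..<n}"
  have Stone_W: "Stone_space ?W"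
    by (rule Stone_space_sum) (simp_all add: Obj_StoneD(1)[OF X])
  have small_W: "small TYPE('u) (topspace ?W)"
  proof -
    have "small TYPE('u) (Sigma {..<n} (topspace \<circ> X))"
      by (rule small_Sigma[OF inaccessible]) (simp_all add: small_finite[OF inaccessible] Obj_StoneD(2)[OF X])
    then show ?thesis by simp
  qed
  obtain S :: "'u topology" and h g where S: "S \<in> Obj Stone"
    and h: "continuous_map ?W S h" and g: "continuous_map S ?W g"
    and gh_all: "\<forall>w\<in>topspace ?W. g (h w) = w" and hg_all: "\<forall>x\<in>topspace S. h (g x) = x"
    using Stone_code[OF Stone_W small_W] by (elim exE conjE)
  note gh = bspec[OF gh_all] and hg = bspec[OF hg_all]
  define \<iota> where "\<iota> i = arrow (X i) (\<lambda>x. h (i, x)) S" for i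
  have \<iota>: "\<iota> i \<in> Hom Stone (X i) S" if i: "i \<in> {..<n}" for i
    unfolding \<iota>_def
  proof (rule arrow_Hom[OF X[OF i] S])
    show "continuous_map (X i) S (\<lambda>x. h (i, x))"
      using continuous_map_compose[OF continuous_map_component_injection[OF i] h] by (simp add: comp_def)
  qed
  have fun_of_\<iota>: "fun_of (\<iota> i) x = h (i, x)" if "x \<in> topspace (X i)" for i x
    unfolding \<iota>_def by (rule fun_of_arrow[OF that])
  have "is_coproduct Stone {..<n} X S \<iota>"
    unfolding is_coproduct_def
  proof (intro conjI ballI allI impI S)
    fix i assume i: "i \<in> {..<n}"
    show "X i \<in> Obj Stone" by (rule X[OF i])
    show "\<iota> i \<in> Hom Stone (X i) S" by (rule \<iota>[OF i])
  next
    fix Y :: "'u topology" and \<phi>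
    assume Y: "Y \<in> Obj Stone" and "\<forall>i\<in>{..<n}. \<phi> i \<in> Hom Stone (X i) Y"
    then have \<phi>: "\<phi> i \<in> Hom Stone (X i) Y" if "i \<in> {..<n}" for i using that by blast
    \<comment> \<open>The copairing on pairs \<open>(i, x)\<close>; \<open>g\<close> recovers the
      summand and the element from a point of the recoded sum.\<close>
    let ?c = "\<lambda>p. fun_of (\<phi> (fst p)) (snd p)"
    have "continuous_map ?W Y ?c"
      by (rule continuous_map_from_sum) (simp add: Hom_StoneD(3)[OF \<phi>])
    then have "continuous_map S Y (\<lambda>s. ?c (g s))"
      using continuous_map_compose[OF g] by (force simp: comp_def)
    then have c: "arrow S (\<lambda>s. ?c (g s)) Y \<in> Hom Stone S Y"
      by (rule arrow_Hom[OF S Y])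
    have gh': "g (h (i, x)) = (i, x)" if "i \<in> {..<n}" "x \<in> topspace (X i)" for i x
      by (rule gh) (use that in simp)
    show "\<exists>!k. k \<in> Hom Stone S Y \<and> (\<forall>i\<in>{..<n}. Comp Stone k (\<iota> i) = \<phi> i)"
    proof (rule ex1I)
      have "Comp Stone (arrow S (\<lambda>s. ?c (g s)) Y) (\<iota> i) = \<phi> i" if i: "i \<in> {..<n}" for i
      proof (rule Stone_ext[OF Comp_Stone_Hom[OF \<iota>[OF i] c] \<phi>[OF i]])
        fix x assume x: "x \<in> topspace (X i)"
        have "h (i, x) \<in> topspace S" using fun_of_in[OF \<iota>[OF i] x] fun_of_\<iota>[OF x] by simp
        then show "fun_of (Comp Stone (arrow S (\<lambda>s. ?c (g s)) Y) (\<iota> i)) x = fun_of (\<phi> i) x"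
          unfolding fun_of_comp[OF \<iota>[OF i] c x] fun_of_\<iota>[OF x] by (simp add: fun_of_arrow gh'[OF i x])
      qed
      then show "arrow S (\<lambda>s. ?c (g s)) Y \<in> Hom Stone S Y \<and>
          (\<forall>i\<in>{..<n}. Comp Stone (arrow S (\<lambda>s. ?c (g s)) Y) (\<iota> i) = \<phi> i)"
        using c by blast
    next
      fix k assume "k \<in> Hom Stone S Y \<and> (\<forall>i\<in>{..<n}. Comp Stone k (\<iota> i) = \<phi> i)"
      then have k: "k \<in> Hom Stone S Y" and k\<iota>: "\<And>i. i \<in> {..<n} \<Longrightarrow> Comp Stone k (\<iota> i) = \<phi> i" by auto
      show "k = arrow S (\<lambda>s. ?c (g s)) Y"
      proof (rule Stone_ext[OF k c])
        fix s assume s: "s \<in> topspace S"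
        have "g s \<in> topspace ?W" using continuous_map_funspace[OF g] s by blast
        then obtain i x where ix: "g s = (i, x)" "i \<in> {..<n}" "x \<in> topspace (X i)" by auto
        then have "s = fun_of (\<iota> i) x" using hg[OF s] fun_of_\<iota>[OF ix(3)] by simp
        then have "fun_of k s = fun_of (\<phi> i) x"
          using fun_of_comp[OF \<iota>[OF ix(2)] k ix(3)] k\<iota>[OF ix(2)] by simp
        then show "fun_of k s = fun_of (arrow S (\<lambda>s. ?c (g s)) Y) s"
          using ix(1) by (simp add: fun_of_arrow s)
      qed
    qed
  qed
  then show "\<exists>S \<iota>. is_coproduct Stone {..<n} X S \<iota>" by blast
qed

section \<open>Initial and terminal spaces, disjoint coproducts and well-pointedness\<close>

lemma is_initial_Stone:
  fixes E :: "'u topology"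
  assumes E: "E \<in> Obj Stone" "topspace E = {}"
  shows "is_initial Stone E"
  unfolding is_initial_def
proof (intro conjI ballI E(1))
  fix X :: "'u topology" assume X: "X \<in> Obj Stone"
  have "continuous_map E X (\<lambda>x. x)" using E(2) by (simp add: null_topspace_iff_trivial)
  then have "arrow E (\<lambda>x. x) X \<in> Hom Stone E X" by (rule arrow_Hom[OF E(1) X])
  moreover have "f = g" if "f \<in> Hom Stone E X" "g \<in> Hom Stone E X" for f g
    by (rule Stone_ext[OF that]) (simp add: E(2))
  ultimately show "\<exists>!f. f \<in> Hom Stone E X" by blast
qed

lemma positive_Stone: "positive_category (Stone :: ('u topology, _) cat)"
  unfolding positive_category_def
proof (intro conjI allI impI)
  show "coherent_category (Stone :: ('u topology, _) cat)" by (rule coherent_Stone)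
  show "has_finite_coproducts (Stone :: ('u topology, _) cat)" by (rule has_finite_coproducts_Stone)
next
  fix X and S :: "'u topology" and \<iota> p q
  assume "is_coproduct Stone {0, 1 :: nat} X S \<iota> \<and> is_pullback Stone (\<iota> 0) (\<iota> 1) p q"
  then have cop: "is_coproduct Stone {0, 1 :: nat} X S \<iota>" and pb: "is_pullback Stone (\<iota> 0) (\<iota> 1) p q"
    by auto
  note H = is_pullback_Hom[OF pb]
  have \<iota>: "X i \<in> Obj Stone" "\<iota> i \<in> Hom Stone (X i) S" if "i \<in> {0, 1}" for i
    using cop that unfolding is_coproduct_def by blast+
  \<comment> \<open>Disjointness is asked of an arbitrary coproduct, so it is tested by a map
    \<open>k\<close> to a two-point space, constant \<open>a\<close> on one summand and
    \<open>b\<close> on the other. A point of the pullback would give \<open>a = b\<close>.\<close>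
  obtain a b :: 'u where ab: "a \<noteq> b" by (rule inaccessible_two_elements[OF inaccessible])
  let ?T = "discrete_topology {a, b}"
  have T: "?T \<in> Obj Stone" by (rule discrete_in_Obj[OF inaccessible]) simp
  let ?\<phi> = "\<lambda>i :: nat. arrow (X i) (\<lambda>_. if i = 0 then a else b) ?T"
  have \<phi>: "?\<phi> i \<in> Hom Stone (X i) ?T" if "i \<in> {0, 1}" for i
    by (rule arrow_Hom[OF \<iota>(1)[OF that] T]) simp
  have "\<exists>!k. k \<in> Hom Stone S ?T \<and> (\<forall>i\<in>{0, 1}. Comp Stone k (\<iota> i) = ?\<phi> i)"
    by (rule cop[unfolded is_coproduct_def, THEN conjunct2, THEN conjunct2, rule_format, OF T \<phi>])
  then obtain k where kk: "k \<in> Hom Stone S ?T \<and> (\<forall>i\<in>{0, 1}. Comp Stone k (\<iota> i) = ?\<phi> i)"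
    by (rule ex1E)
  note k = conjunct1[OF kk] bspec[OF conjunct2[OF kk]]
  note \<iota>0 = \<iota>(2)[of 0, OF insertI1] and \<iota>1 = \<iota>(2)[of 1, OF insertI2[OF singletonI]]
  have "topspace (Dom Stone p) = {}"
  proof (rule ccontr)
    assume "topspace (Dom Stone p) \<noteq> {}"
    then obtain c where c: "c \<in> topspace (Dom Stone p)" by blast
    have p: "fun_of p c \<in> topspace (X 0)" using fun_of_in[OF H(3) c] HomD(2)[OF \<iota>0] by simp
    have q: "fun_of q c \<in> topspace (X 1)" using fun_of_in[OF H(4) c] HomD(2)[OF \<iota>1] by simp
    have "fun_of (\<iota> 0) (fun_of p c) = fun_of (\<iota> 1) (fun_of q c)"
      using fun_of_comp[OF H(3,1) c] fun_of_comp[OF H(4,2) c] H(5) by simp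
    then have "fun_of (?\<phi> 0) (fun_of p c) = fun_of (?\<phi> 1) (fun_of q c)"
      unfolding k(2)[of 0, OF insertI1, symmetric] k(2)[of 1, OF insertI2[OF singletonI], symmetric]
        fun_of_comp[OF \<iota>0 k(1) p] fun_of_comp[OF \<iota>1 k(1) q] by (rule arg_cong)
    then show False using ab unfolding fun_of_arrow[OF p] fun_of_arrow[OF q] by simp
  qed
  then show "is_initial Stone (Dom Stone p)"
    by (rule is_initial_Stone[OF Hom_StoneD(1)[OF H(3)]])
qed

lemma is_terminal_point: "is_terminal Stone (point :: 'u topology)"
  unfolding is_terminal_def
proof (intro conjI ballI point_Obj[OF inaccessible])
  fix X :: "'u topology" assume X: "X \<in> Obj Stone"
  have "arrow X (\<lambda>_. undefined) point \<in> Hom Stone X point"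
    by (rule arrow_Hom[OF X point_Obj[OF inaccessible]]) (simp add: topspace_point[OF inaccessible])
  moreover have "f = g" if f: "f \<in> Hom Stone X point" and g: "g \<in> Hom Stone X point" for f g
    by (rule Stone_ext[OF that]) (use fun_of_in[OF f] fun_of_in[OF g] in \<open>simp add: topspace_point[OF inaccessible]\<close>)
  ultimately show "\<exists>!f. f \<in> Hom Stone X point" by blast
qed

lemma non_trivial_Stone: "non_trivial (Stone :: ('u topology, _) cat)"
  unfolding non_trivial_def
proof (intro exI conjI notI)
  let ?E = "discrete_topology {} :: 'u topology"
  have "?E \<in> Obj Stone" by (rule discrete_in_Obj[OF inaccessible]) simp
  then show "is_initial Stone ?E" by (rule is_initial_Stone) simp
  show "is_terminal Stone (point :: 'u topology)" by (rule is_terminal_point)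
  assume "isomorphic_objects Stone ?E point"
  then obtain f g where "f \<in> Hom Stone ?E point" "g \<in> Hom Stone (Cod Stone f) (Dom Stone f)"
    unfolding isomorphic_objects_def is_iso_def by blast
  then have "g \<in> Hom Stone point ?E" by (simp add: HomD)
  then show False
    using fun_of_in[of g point ?E undefined] topspace_point[OF inaccessible] by simp
qed

lemma well_pointed_Stone: "well_pointed TYPE('u) (Stone :: ('u topology, _) cat)"
  unfolding well_pointed_def
proof (intro conjI allI impI)
  show "\<exists>T. is_terminal Stone (T :: 'u topology)" using is_terminal_point by blast
  fix T :: "'u topology" assume "is_terminal Stone T"
  then have T: "T \<in> Obj Stone" and "\<exists>!f. f \<in> Hom Stone point T"
    using point_Obj[OF inaccessible] unfolding is_terminal_def by auto
  \<comment> \<open>\<open>T\<close> is any terminal object. An arrow from the one-point space gives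
    it an element \<open>t\<close>, at which composites with constant arrows are evaluated.\<close>
  then obtain e where e: "e \<in> Hom Stone point T" by blast
  then obtain t where t: "t \<in> topspace T"
    using fun_of_in[OF e] topspace_point[OF inaccessible] by auto
  have small_Hom: "small TYPE('u) (Hom Stone T X)" if X: "X \<in> Obj Stone" for X :: "'u topology"
  proof (rule small_inj)
    show "small TYPE('u) (\<Pi>\<^sub>E x\<in>topspace T. topspace X)"
      by (rule small_PiE[OF inaccessible Obj_StoneD(2)[OF T] Obj_StoneD(2)[OF X]])
    show "inj_on fun_of (Hom Stone T X)"
      by (rule inj_onI) (metis Stone_ext)
    show "fun_of ` Hom Stone T X \<subseteq> (\<Pi>\<^sub>E x\<in>topspace T. topspace X)"
    proof (rule image_subsetI)
      fix m assume m: "m \<in> Hom Stone T X"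
      have "fun_of m \<in> extensional (topspace T)" using m unfolding Hom_Stone_iff by simp
      then show "fun_of m \<in> (\<Pi>\<^sub>E x\<in>topspace T. topspace X)"
        using fun_of_in[OF m] by (simp add: PiE_iff)
    qed
  qed
  show "faithful_functor Stone (set_cat TYPE('u)) (pt Stone T)"
    unfolding faithful_functor_def
  proof (intro conjI ballI)
    show "is_functor Stone (set_cat TYPE('u)) (pt Stone T)"
      unfolding is_functor_def
    proof (intro conjI ballI impI)
      fix X :: "'u topology" assume X: "X \<in> Obj Stone"
      show "omap (pt Stone T) X \<in> Obj (set_cat TYPE('u))"
        using small_Hom[OF X] by (simp add: pt_def set_cat_def)
      have "restrict (\<lambda>x. Comp Stone (Ident Stone X) x) (Hom Stone T X) = restrict (\<lambda>x. x) (Hom Stone T X)"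
        by (rule restrict_ext) (rule Stone.comp_ident_left)
      then show "amap (pt Stone T) (Ident Stone X) = Ident (set_cat TYPE('u)) (omap (pt Stone T) X)"
        using HomD(2,3)[OF Ident_Stone_Hom[OF X]] by (simp add: pt_def set_cat_def)
    next
      fix f :: "'u Stone_arrow" assume "f \<in> Arr Stone"
      then have f: "f \<in> Hom Stone (Dom Stone f) (Cod Stone f)" by (rule Arr_Hom)
      show "amap (pt Stone T) f \<in>
          Hom (set_cat TYPE('u)) (omap (pt Stone T) (Dom Stone f)) (omap (pt Stone T) (Cod Stone f))"
        unfolding Hom_def[of "set_cat TYPE('u)"]
        by (simp add: pt_def set_cat_def PiE_iff small_Hom[OF Hom_StoneD(1)[OF f]]
            small_Hom[OF Hom_StoneD(2)[OF f]] Comp_Stone_Hom[OF _ f])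
    next
      fix f g :: "'u Stone_arrow" assume "f \<in> Arr Stone" "g \<in> Arr Stone" "Dom Stone g = Cod Stone f"
      then have f: "f \<in> Hom Stone (Dom Stone f) (Cod Stone f)"
        and g: "g \<in> Hom Stone (Cod Stone f) (Cod Stone g)" unfolding Hom_def by auto
      note gf = Comp_Stone_Hom[OF f g]
      have "restrict (\<lambda>x. Comp Stone (Comp Stone g f) x) (Hom Stone T (Dom Stone f)) =
          compose (Hom Stone T (Dom Stone f))
            (restrict (\<lambda>x. Comp Stone g x) (Hom Stone T (Cod Stone f)))
            (restrict (\<lambda>x. Comp Stone f x) (Hom Stone T (Dom Stone f)))"
        unfolding compose_def
        by (rule restrict_ext) (simp add: Comp_Stone_Hom[OF _ f] Stone.comp_assoc[OF _ f g])
      then show "amap (pt Stone T) (Comp Stone g f) =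
          Comp (set_cat TYPE('u)) (amap (pt Stone T) g) (amap (pt Stone T) f)"
        using HomD(2,3)[OF gf] \<open>Dom Stone g = Cod Stone f\<close> by (simp add: pt_def set_cat_def)
    qed
    fix X Y :: "'u topology" assume X: "X \<in> Obj Stone" and "Y \<in> Obj Stone"
    show "inj_on (amap (pt Stone T)) (Hom Stone X Y)"
    proof (rule inj_onI)
      fix f g assume f: "f \<in> Hom Stone X Y" and g: "g \<in> Hom Stone X Y"
        and eq: "amap (pt Stone T) f = amap (pt Stone T) g"
      have eq': "Comp Stone f x = Comp Stone g x" if "x \<in> Hom Stone T X" for x
      proof -
        have "restrict (\<lambda>x. Comp Stone f x) (Hom Stone T X) = restrict (\<lambda>x. Comp Stone g x) (Hom Stone T X)"
          using eq HomD(2)[OF f] HomD(2)[OF g] by (simp add: pt_def)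
        then show ?thesis using that by (metis restrict_apply')
      qed
      show "f = g"
      proof (rule Stone_ext[OF f g])
        fix x assume x: "x \<in> topspace X"
        have c: "arrow T (\<lambda>_. x) X \<in> Hom Stone T X"
          by (rule arrow_Hom[OF T X]) (simp add: x)
        show "fun_of f x = fun_of g x"
          using fun_of_comp[OF c f t] fun_of_comp[OF c g t] eq'[OF c] by (simp add: fun_of_arrow t)
      qed
    qed
  qed
qed

end

section \<open>Pullbacks and products from limits\<close>

text \<open>The arrows \<open>3\<close> and \<open>4\<close> are the two legs into the object
  \<open>2\<close>; the smaller numbers are the identities. Of two composable arrows at least one is
  an identity, and \<open>Comp\<close> returns the other.\<close>

definition cospan_shape :: "(nat, nat) cat" where
  "cospan_shape = \<lparr>Obj = {0, 1, 2}, Arr = {0, 1, 2, 3, 4},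
     Dom = (\<lambda>u. if u = 3 then 0 else if u = 4 then 1 else u),
     Cod = (\<lambda>u. if u = 3 \<or> u = 4 then 2 else u),
     Ident = (\<lambda>j. j), Comp = (\<lambda>v u. if v \<le> 2 then u else v)\<rparr>"

lemma category_cospan_shape: "category cospan_shape"
  by unfold_locales (auto simp: cospan_shape_def Hom_def split: if_splits)

definition discrete_shape :: "'i set \<Rightarrow> ('i, 'i) cat" where
  "discrete_shape I = \<lparr>Obj = I, Arr = I, Dom = (\<lambda>i. i), Cod = (\<lambda>i. i),
     Ident = (\<lambda>i. i), Comp = (\<lambda>v u. u)\<rparr>"

lemma category_discrete_shape: "category (discrete_shape I)"
  by unfold_locales (auto simp: discrete_shape_def Hom_def)

context category
begin

lemma pullback_exists:
  assumes lim: "has_finite_limits C" and f: "f \<in> Hom C A Y" and g: "g \<in> Hom C X Y"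
  obtains p q where "is_pullback C f g p q"
proof -
  define D where "D = \<lparr>omap = (\<lambda>j :: nat. if j = 0 then A else if j = 1 then X else Y),
    amap = (\<lambda>u :: nat. if u = 3 then f else if u = 4 then g
      else Ident C (if u = 0 then A else if u = 1 then X else Y))\<rparr>"
  note A = Hom_obj(1)[OF f] and X = Hom_obj(1)[OF g] and Y = Hom_obj(2)[OF f]
  note ids = ident_in_hom[OF A] ident_in_hom[OF X] ident_in_hom[OF Y]
  note id_laws = comp_ident_left[OF f] comp_ident_right[OF f] comp_ident_left[OF g] comp_ident_right[OF g]
    comp_ident_left[OF ids(1)] comp_ident_left[OF ids(2)] comp_ident_left[OF ids(3)]
  have "is_functor cospan_shape C D"
    unfolding is_functor_def using A X Y f g ids id_laws
    by (auto simp: cospan_shape_def D_def)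
  moreover have "has_limits_of_shape cospan_shape C"
  proof -
    have "finite (Obj cospan_shape)" "finite (Arr cospan_shape)" by (simp_all add: cospan_shape_def)
    then show ?thesis
      using lim category_cospan_shape unfolding has_finite_limits_def by blast
  qed
  ultimately obtain L \<mu> where lim: "is_limit cospan_shape C D L \<mu>"
    unfolding has_limits_of_shape_def by blast
  have ball: "(\<forall>j\<in>Obj cospan_shape. R j) \<longleftrightarrow> R 0 \<and> R 1 \<and> R 2" for R
    by (simp add: cospan_shape_def)
  \<comment> \<open>The component at \<open>2\<close> is determined by either of the others and
    identities impose nothing, so a cone is a commuting square.\<close>
  have cone: "is_cone cospan_shape C D K \<nu> \<longleftrightarrow>
      \<nu> 0 \<in> Hom C K A \<and> \<nu> 1 \<in> Hom C K X \<and> \<nu> 2 \<in> Hom C K Y \<and>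
      Comp C f (\<nu> 0) = \<nu> 2 \<and> Comp C g (\<nu> 1) = \<nu> 2" for K \<nu>
    unfolding is_cone_def ball
    using comp_ident_left[of "\<nu> 0" K A] comp_ident_left[of "\<nu> 1" K X] comp_ident_left[of "\<nu> 2" K Y]
      Hom_obj(1)[of "\<nu> 0" K A]
    by (auto simp: cospan_shape_def D_def)
  have \<mu>: "\<mu> 0 \<in> Hom C L A" "\<mu> 1 \<in> Hom C L X" "Comp C f (\<mu> 0) = \<mu> 2" "Comp C g (\<mu> 1) = \<mu> 2"
    using lim unfolding is_limit_def cone by auto
  have "is_pullback C f g (\<mu> 0) (\<mu> 1)"
  proof (rule is_pullbackI[OF f g \<mu>(1,2)])
    show "Comp C f (\<mu> 0) = Comp C g (\<mu> 1)" using \<mu> by simp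
    fix W a b assume a: "a \<in> Hom C W A" and b: "b \<in> Hom C W X" and ab: "Comp C f a = Comp C g b"
    define \<nu> where "\<nu> j = (if j = 0 then a else if j = 1 then b else Comp C f a)" for j :: nat
    have "is_cone cospan_shape C D W \<nu>"
      unfolding cone using a b ab comp_in_hom[OF a f] by (simp add: \<nu>_def)
    then have ex: "\<exists>!h. h \<in> Hom C W L \<and> (\<forall>j\<in>Obj cospan_shape. Comp C (\<mu> j) h = \<nu> j)"
      using lim unfolding is_limit_def by blast
    have "(\<forall>j\<in>Obj cospan_shape. Comp C (\<mu> j) h = \<nu> j) \<longleftrightarrow> Comp C (\<mu> 0) h = a \<and> Comp C (\<mu> 1) h = b"
      if h: "h \<in> Hom C W L" for h
      unfolding ball using comp_assoc[OF h \<mu>(1) f] \<mu>(3) by (auto simp: \<nu>_def)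
    then show "\<exists>!h. h \<in> Hom C W L \<and> Comp C (\<mu> 0) h = a \<and> Comp C (\<mu> 1) h = b"
      using ex by (simp cong: conj_cong)
  qed
  then show thesis by (rule that)
qed

text \<open>Later arguments see the product only through its points from \<open>T\<close>, so the
  universal property is kept for that one domain. Indices have type \<open>'u\<close> because
  completeness is tested on shapes in \<open>'u\<close>.\<close>

lemma product_points_exist:
  fixes X :: "'u \<Rightarrow> 'o"
  assumes lim: "complete_category TYPE('u) C" and I: "small TYPE('u) I"
    and X: "\<And>i. i \<in> I \<Longrightarrow> X i \<in> Obj C" and T: "T \<in> Obj C"
  obtains P \<pi> where "P \<in> Obj C" "\<forall>i\<in>I. \<pi> i \<in> Hom C P (X i)"
    "\<forall>x. (\<forall>i\<in>I. x i \<in> Hom C T (X i)) \<longrightarrow> (\<exists>w\<in>Hom C T P. \<forall>i\<in>I. Comp C (\<pi> i) w = x i)"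
    "\<forall>w\<in>Hom C T P. \<forall>w'\<in>Hom C T P.
      (\<forall>i\<in>I. Comp C (\<pi> i) w = Comp C (\<pi> i) w') \<longrightarrow> w = w'"
proof -
  define D where "D = \<lparr>omap = X, amap = (\<lambda>i. Ident C (X i))\<rparr>"
  have "is_functor (discrete_shape I) C D"
    unfolding is_functor_def using X ident_in_hom comp_ident_left[OF ident_in_hom]
    by (simp add: discrete_shape_def D_def)
  moreover have "has_limits_of_shape (discrete_shape I) C"
  proof -
    have "small TYPE('u) (Obj (discrete_shape I))" "small TYPE('u) (Arr (discrete_shape I))"
      using I by (simp_all add: discrete_shape_def)
    then show ?thesis
      using lim category_discrete_shape unfolding complete_category_def by blast
  qed
  ultimately obtain P \<pi> where lim: "is_limit (discrete_shape I) C D P \<pi>"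
    unfolding has_limits_of_shape_def by blast
  have cone: "is_cone (discrete_shape I) C D K \<nu> \<longleftrightarrow> K \<in> Obj C \<and> (\<forall>i\<in>I. \<nu> i \<in> Hom C K (X i))" for K \<nu>
    unfolding is_cone_def by (auto simp: discrete_shape_def D_def comp_ident_left)
  have \<pi>: "\<pi> i \<in> Hom C P (X i)" if "i \<in> I" for i
    using lim that unfolding is_limit_def cone by auto
  have P: "P \<in> Obj C" using lim unfolding is_limit_def cone by blast
  have ex: "\<exists>!h. h \<in> Hom C T P \<and> (\<forall>i\<in>I. Comp C (\<pi> i) h = x i)"
    if "\<And>i. i \<in> I \<Longrightarrow> x i \<in> Hom C T (X i)" for x
  proof -
    have "is_cone (discrete_shape I) C D T x" unfolding cone using T that by blast
    then have "\<exists>!h. h \<in> Hom C T P \<and> (\<forall>i\<in>Obj (discrete_shape I). Comp C (\<pi> i) h = x i)"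
      using lim unfolding is_limit_def by blast
    then show ?thesis by (simp add: discrete_shape_def)
  qed
  show thesis
  proof (rule that[OF P]; intro ballI allI impI)
    show "\<pi> i \<in> Hom C P (X i)" if "i \<in> I" for i by (rule \<pi>[OF that])
  next
    fix x assume "\<forall>i\<in>I. x i \<in> Hom C T (X i)"
    then have "\<exists>!h. h \<in> Hom C T P \<and> (\<forall>i\<in>I. Comp C (\<pi> i) h = x i)" by (intro ex) simp
    then show "\<exists>w\<in>Hom C T P. \<forall>i\<in>I. Comp C (\<pi> i) w = x i" by blast
  next
    fix w w' assume w: "w \<in> Hom C T P" and w': "w' \<in> Hom C T P"
      and eq: "\<forall>i\<in>I. Comp C (\<pi> i) w = Comp C (\<pi> i) w'"
    have "\<exists>!h. h \<in> Hom C T P \<and> (\<forall>i\<in>I. Comp C (\<pi> i) h = Comp C (\<pi> i) w)"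
      by (rule ex) (rule comp_in_hom[OF w \<pi>])
    then obtain h where
      h: "\<forall>y. y \<in> Hom C T P \<and> (\<forall>i\<in>I. Comp C (\<pi> i) y = Comp C (\<pi> i) w) \<longrightarrow> y = h"
      by (rule ex1E)
    have "w' = h" using w' eq by (intro h[rule_format]) simp
    moreover have "w = h" using w by (intro h[rule_format]) simp
    ultimately show "w = w'" by simp
  qed
qed

text \<open>Two arrows out of \<open>X\<close> agree after \<open>p\<close> by initiality, hence
  also after the identity, which factors through \<open>p\<close>. In what follows this takes the
  place of strictness of the initial object.\<close>

lemma retract_initial:
  assumes Z: "is_initial C Z" and h: "h \<in> Hom C X Z" and p: "p \<in> Hom C Z X"
    and ph: "Comp C p h = Ident C X"
  shows "is_initial C X"
  unfolding is_initial_def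
proof (intro conjI ballI)
  show "X \<in> Obj C" by (rule Hom_obj(1)[OF h])
  fix Y assume Y: "Y \<in> Obj C"
  obtain u where u: "u \<in> Hom C Z Y" using Z Y unfolding is_initial_def by blast
  have "v = v'" if v: "v \<in> Hom C X Y" and v': "v' \<in> Hom C X Y" for v v'
  proof -
    have "Comp C v p = Comp C v' p"
      using Z Y comp_in_hom[OF p v] comp_in_hom[OF p v'] unfolding is_initial_def by blast
    then show ?thesis
      using comp_assoc[OF h p v] comp_assoc[OF h p v'] ph comp_ident_right[OF v] comp_ident_right[OF v']
      by simp
  qed
  then show "\<exists>!v. v \<in> Hom C X Y" using comp_in_hom[OF h u] by blast
qed

end


section \<open>Points in a positive, well-pointed and strongly filtral category\<close>

text \<open>Points are arrows of type \<open>'a\<close>, while spaces in \<open>Stone\<close> have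
  points in \<open>'u\<close>; \<open>code\<close> transfers the points of each object. Such
  injections exist because well-pointedness makes each set of points small.\<close>

locale filtral_category = category C for C :: "('o, 'a) cat" +
  fixes T :: 'o and code :: "'o \<Rightarrow> 'a \<Rightarrow> 'u"
  assumes inaccessible: "inaccessible TYPE('u)"
    and positive: "positive_category C"
    and non_trivial: "non_trivial C"
    and well_pointed: "well_pointed TYPE('u) C"
    and strongly_filtral: "strongly_filtral C"
    and complete: "complete_category TYPE('u) C"
    and terminal: "is_terminal C T"
    and inj_code: "X \<in> Obj C \<Longrightarrow> inj_on (code X) (Hom C T X)"
begin

lemma finite_limits: "has_finite_limits C"
  and coherent: "coherent_category C"
  and coproducts: "has_finite_coproducts C"
  using positive unfolding positive_category_def coherent_category_def regular_category_def by auto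

lemma disjoint: "is_coproduct C {0, 1 :: nat} X S \<iota> \<Longrightarrow> is_pullback C (\<iota> 0) (\<iota> 1) p q \<Longrightarrow> is_initial C (Dom C p)"
  using positive unfolding positive_category_def by blast

lemma T_Obj: "T \<in> Obj C"
  using terminal unfolding is_terminal_def by blast

lemma into_T_unique: "f \<in> Hom C X T \<Longrightarrow> g \<in> Hom C X T \<Longrightarrow> f = g"
  using terminal Hom_obj(1) unfolding is_terminal_def by blast

lemma functor_pt: "is_functor C (set_cat TYPE('u)) (pt C T)"
  using well_pointed terminal unfolding well_pointed_def faithful_functor_def by blast

lemma small_points: "X \<in> Obj C \<Longrightarrow> small TYPE('u) (Hom C T X)"
  using functor_pt unfolding is_functor_def by (simp add: pt_def set_cat_def)

lemma arrow_eqI: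
  assumes f: "f \<in> Hom C X Y" and g: "g \<in> Hom C X Y"
    and eq: "\<And>x. x \<in> Hom C T X \<Longrightarrow> Comp C f x = Comp C g x"
  shows "f = g"
proof -
  have "inj_on (amap (pt C T)) (Hom C X Y)"
    using well_pointed terminal Hom_obj[OF f] unfolding well_pointed_def faithful_functor_def by blast
  moreover have "amap (pt C T) f = amap (pt C T) g"
    using eq by (auto simp: pt_def HomD(2,3)[OF f] HomD(2,3)[OF g] intro: restrict_ext)
  ultimately show ?thesis using f g by (rule inj_onD)
qed

lemma mono_if_injective_on_points:
  assumes m: "m \<in> Hom C A X"
    and inj: "\<And>a b. a \<in> Hom C T A \<Longrightarrow> b \<in> Hom C T A \<Longrightarrow> Comp C m a = Comp C m b \<Longrightarrow> a = b"
  shows "m \<in> monos_into C X"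
proof (rule monos_intoI[OF m])
  fix W f g assume f: "f \<in> Hom C W A" and g: "g \<in> Hom C W A" and eq: "Comp C m f = Comp C m g"
  show "f = g"
  proof (rule arrow_eqI[OF f g])
    fix x assume x: "x \<in> Hom C T W"
    show "Comp C f x = Comp C g x"
      by (rule inj[OF comp_in_hom[OF x f] comp_in_hom[OF x g]])
        (simp add: comp_assoc[OF x f m] comp_assoc[OF x g m] eq)
  qed
qed

lemma point_mono: "x \<in> Hom C T X \<Longrightarrow> x \<in> monos_into C X"
  by (rule monos_intoI) (auto intro: into_T_unique)

lemma coproduct_exists:
  assumes "X \<in> Obj C"
  obtains S \<iota> where "is_coproduct C {0, 1 :: nat} (\<lambda>_. X) S \<iota>" "\<iota> 0 \<in> Hom C X S" "\<iota> 1 \<in> Hom C X S"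
proof -
  have "\<exists>S \<iota>. is_coproduct C {..<2 :: nat} (\<lambda>_. X) S \<iota>"
    by (rule coproducts[unfolded has_finite_coproducts_def, rule_format]) (rule assms)
  moreover have "{..<2} = {0, 1 :: nat}" by auto
  ultimately obtain S \<iota> where S: "is_coproduct C {0, 1 :: nat} (\<lambda>_. X) S \<iota>" by auto
  have "\<iota> i \<in> Hom C X S" if "i \<in> {0, 1}" for i
    using S that unfolding is_coproduct_def by (elim conjE) (drule bspec, assumption, elim conjE)
  then show thesis by (intro that[OF S]) (simp_all only: insert_iff simp_thms)
qed

text \<open>If the injections agree, the pair of identities lifts to their pullback, which makes
  \<open>X\<close> a retract of an initial object.\<close>

lemma initial_if_injections_agree:
  assumes S: "is_coproduct C {0, 1 :: nat} (\<lambda>_. X) S \<iota>"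
    and \<iota>: "\<iota> 0 \<in> Hom C X S" "\<iota> 1 \<in> Hom C X S" and eq: "\<iota> 0 = \<iota> 1"
  shows "is_initial C X"
proof -
  obtain p q where pb: "is_pullback C (\<iota> 0) (\<iota> 1) p q"
    by (rule pullback_exists[OF finite_limits \<iota>])
  note H = is_pullback_Hom[OF pb] and I = ident_in_hom[OF Hom_obj(1)[OF \<iota>(1)]]
  have dom: "Dom C (\<iota> 0) = X" "Dom C (\<iota> 1) = X" using HomD \<iota> by auto
  obtain h where h: "h \<in> Hom C X (Dom C p)" "Comp C p h = Ident C X"
    by (rule is_pullback_universal[OF pb, of "Ident C X" X "Ident C X"]) (use I dom eq in auto)
  show ?thesis
    using retract_initial[OF disjoint[OF S pb] h(1) _ h(2)] H(3) dom by simp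
qed

lemma initial_if_no_points:
  assumes X: "X \<in> Obj C" and empty: "Hom C T X = {}"
  shows "is_initial C X"
proof -
  obtain S \<iota> where S: "is_coproduct C {0, 1 :: nat} (\<lambda>_. X) S \<iota>" "\<iota> 0 \<in> Hom C X S" "\<iota> 1 \<in> Hom C X S"
    by (rule coproduct_exists[OF X])
  have "\<iota> 0 = \<iota> 1" by (rule arrow_eqI[OF S(2,3)]) (simp add: empty)
  then show ?thesis by (rule initial_if_injections_agree[OF S])
qed

text \<open>\<open>non_trivial\<close> concerns some initial \<open>Z\<close> and terminal
  \<open>T'\<close>. If \<open>T\<close> were initial, the arrow from \<open>Z\<close> to
  \<open>T'\<close> would be inverted by the composite through \<open>T\<close>.\<close>

lemma T_not_initial: "\<not> is_initial C T"
proof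
  assume T: "is_initial C T"
  obtain Z T' where Z: "is_initial C Z" and T': "is_terminal C T'" and no: "\<not> isomorphic_objects C Z T'"
    using non_trivial unfolding non_trivial_def by blast
  have obj: "Z \<in> Obj C" "T' \<in> Obj C" using Z T' unfolding is_initial_def is_terminal_def by auto
  obtain f a b where f: "f \<in> Hom C Z T'" and a: "a \<in> Hom C T' T" and b: "b \<in> Hom C T Z"
    using Z T terminal obj unfolding is_initial_def is_terminal_def by blast
  note g = comp_in_hom[OF a b]
  have "Comp C (Comp C b a) f = Ident C Z"
    using Z obj comp_in_hom[OF f g] ident_in_hom[OF obj(1)] unfolding is_initial_def by blast
  moreover have "Comp C f (Comp C b a) = Ident C T'"
    using T' obj comp_in_hom[OF g f] ident_in_hom[OF obj(2)] unfolding is_terminal_def by blast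
  ultimately have "is_iso C f" unfolding is_iso_def using HomD[OF f] g by auto
  then show False using no f unfolding isomorphic_objects_def by blast
qed

section \<open>Subobjects and the points that factor through them\<close>

definition points_in :: "'o \<Rightarrow> 'a \<Rightarrow> 'a set" where
  "points_in X m = {x \<in> Hom C T X. factors_through C x m}"

lemma points_in_iff:
  assumes "m \<in> Hom C A X"
  shows "x \<in> points_in X m \<longleftrightarrow> (\<exists>a\<in>Hom C T A. Comp C m a = x)"
proof -
  have "x \<in> Hom C T X" if "a \<in> Hom C T A" "Comp C m a = x" for a
    using comp_in_hom[OF that(1) assms] that(2) by simp
  then show ?thesis
    unfolding points_in_def using factors_through_iff[OF _ assms, of x T] by auto
qed

lemma points_in_mono:
  assumes m: "m \<in> monos_into C X" and n: "n \<in> monos_into C X" and le: "factors_through C m n"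
  shows "points_in X m \<subseteq> points_in X n"
  using factors_through_trans[OF _ monos_into_Hom[OF m] monos_into_Hom[OF n] _ le]
  unfolding points_in_def by blast

text \<open>The domain of \<open>m\<close> is then initial, so an arrow to the domain of
  \<open>n\<close> exists and the triangle commutes by uniqueness.\<close>

lemma factors_through_if_no_points:
  assumes m: "m \<in> monos_into C X" and n: "n \<in> monos_into C X" and empty: "points_in X m = {}"
  shows "factors_through C m n"
proof -
  note mH = monos_into_Hom[OF m] and nH = monos_into_Hom[OF n]
  have "Hom C T (Dom C m) = {}" using empty points_in_iff[OF mH] by blast
  then have init: "is_initial C (Dom C m)"
    by (rule initial_if_no_points[OF Hom_obj(1)[OF mH]])
  then obtain h where h: "h \<in> Hom C (Dom C m) (Dom C n)"
    using Hom_obj(1)[OF nH] unfolding is_initial_def by blast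
  have "Comp C n h = m"
    using init Hom_obj(2)[OF mH] comp_in_hom[OF h nH] mH unfolding is_initial_def by blast
  then show ?thesis unfolding factors_through_iff[OF mH nH] using h by blast
qed

lemma pullback_along:
  assumes m: "m \<in> monos_into C Y" and f: "f \<in> Hom C X Y"
  obtains n where "n \<in> monos_into C X" "pullback_sub C f (subobject C Y m) = subobject C X n"
    "\<forall>W. \<forall>g\<in>Hom C W X. factors_through C g n \<longleftrightarrow> factors_through C (Comp C f g) m"
proof -
  obtain p n where pb: "is_pullback C m f p n"
    by (rule pullback_exists[OF finite_limits monos_into_Hom[OF m] f])
  have n: "n \<in> monos_into C X"
    using pullback_mono[OF pb] m HomD(2)[OF f] unfolding monos_into_def by simp
  have fact: "factors_through C g n \<longleftrightarrow> factors_through C (Comp C f g) m" if "g \<in> Hom C W X" for W g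
    using factors_through_pullback[OF pb] that HomD(2)[OF f] by simp
  show thesis by (rule that[OF n pullback_sub_eq[OF m f n fact]]) (simp_all add: fact)
qed

lemma lub_pullback:
  assumes f: "f \<in> Hom C X Y" and A: "A \<subseteq> carrier (Sub C Y)" "finite A" and lub: "is_lub (Sub C Y) S A"
  shows "is_lub (Sub C X) (pullback_sub C f S) (pullback_sub C f ` A)"
  using coherent assms HomD[OF f] unfolding coherent_category_def by blast

lemma sub_carrier: "m \<in> monos_into C X \<Longrightarrow> subobject C X m \<in> carrier (Sub C X)"
  unfolding carrier_Sub by blast

lemma is_lub_sub_iff:
  assumes m: "m \<in> monos_into C X" and n: "n \<in> monos_into C X" and k: "k \<in> monos_into C X"
  shows "is_lub (Sub C X) (subobject C X k) {subobject C X m, subobject C X n} \<longleftrightarrow>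
    factors_through C m k \<and> factors_through C n k \<and>
    (\<forall>l\<in>monos_into C X. factors_through C m l \<longrightarrow> factors_through C n l \<longrightarrow> factors_through C k l)"
proof -
  have "Upper (Sub C X) {subobject C X m, subobject C X n} =
      subobject C X ` {l \<in> monos_into C X. factors_through C m l \<and> factors_through C n l}"
    unfolding Upper_def carrier_Sub using le_Sub m n by auto
  then have "(\<forall>u\<in>Upper (Sub C X) {subobject C X m, subobject C X n}. subobject C X k \<sqsubseteq>\<^bsub>Sub C X\<^esub> u) \<longleftrightarrow>
      (\<forall>l\<in>monos_into C X. factors_through C m l \<longrightarrow> factors_through C n l \<longrightarrow> factors_through C k l)"
    using le_Sub[OF k] by auto
  moreover have "subobject C X k \<in> Upper (Sub C X) {subobject C X m, subobject C X n} \<longleftrightarrow>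
      factors_through C m k \<and> factors_through C n k"
    unfolding Upper_def
    using le_Sub[OF m k] le_Sub[OF n k] sub_carrier[OF m] sub_carrier[OF n] sub_carrier[OF k] by auto
  moreover have "Upper (Sub C X) {subobject C X m, subobject C X n} \<subseteq> carrier (Sub C X)"
    unfolding Upper_def by blast
  ultimately show ?thesis unfolding least_def by simp
qed

text \<open>The join is pulled back along a point \<open>x\<close> to \<open>Sub T\<close>, where it
  stays a join. If \<open>x\<close> lay in neither part, both pulled back parts would have no
  points, the identity being the only point of \<open>T\<close>. The first would then lie below the
  second, and so would the join, which contains that identity.\<close>

lemma points_in_lub:
  assumes m: "m \<in> monos_into C X" and n: "n \<in> monos_into C X" and k: "k \<in> monos_into C X"
    and lub: "is_lub (Sub C X) (subobject C X k) {subobject C X m, subobject C X n}"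
  shows "points_in X k = points_in X m \<union> points_in X n"
proof
  show "points_in X m \<union> points_in X n \<subseteq> points_in X k"
    using lub points_in_mono[OF m k] points_in_mono[OF n k] unfolding is_lub_sub_iff[OF m n k] by blast
  show "points_in X k \<subseteq> points_in X m \<union> points_in X n"
  proof
    fix x assume xk: "x \<in> points_in X k"
    then have x: "x \<in> Hom C T X" unfolding points_in_def by blast
    note I = ident_in_hom[OF T_Obj]
    obtain m' where m': "m' \<in> monos_into C T" "pullback_sub C x (subobject C X m) = subobject C T m'"
      "\<forall>W. \<forall>g\<in>Hom C W T. factors_through C g m' \<longleftrightarrow> factors_through C (Comp C x g) m"
      by (rule pullback_along[OF m x])
    obtain n' where n': "n' \<in> monos_into C T" "pullback_sub C x (subobject C X n) = subobject C T n'"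
      "\<forall>W. \<forall>g\<in>Hom C W T. factors_through C g n' \<longleftrightarrow> factors_through C (Comp C x g) n"
      by (rule pullback_along[OF n x])
    obtain k' where k': "k' \<in> monos_into C T" "pullback_sub C x (subobject C X k) = subobject C T k'"
      "\<forall>W. \<forall>g\<in>Hom C W T. factors_through C g k' \<longleftrightarrow> factors_through C (Comp C x g) k"
      by (rule pullback_along[OF k x])
    have lub': "is_lub (Sub C T) (subobject C T k') {subobject C T m', subobject C T n'}"
      using lub_pullback[OF x _ _ lub] sub_carrier[OF m] sub_carrier[OF n] m'(2) n'(2) k'(2) by simp
    have Ik': "factors_through C (Ident C T) k'"
      using k'(3)[rule_format, OF I] xk comp_ident_right[OF x] unfolding points_in_def by simp
    have no_points: "points_in T l = {}" if "\<not> factors_through C (Ident C T) l" for l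
      using that into_T_unique[OF _ I] unfolding points_in_def by auto
    show "x \<in> points_in X m \<union> points_in X n"
    proof (rule ccontr)
      assume "x \<notin> points_in X m \<union> points_in X n"
      then have nm: "\<not> factors_through C (Ident C T) m'" and nn: "\<not> factors_through C (Ident C T) n'"
        using m'(3)[rule_format, OF I] n'(3)[rule_format, OF I] comp_ident_right[OF x] x unfolding points_in_def by auto
      have "factors_through C m' n'"
        by (rule factors_through_if_no_points[OF m'(1) n'(1) no_points[OF nm]])
      moreover have "factors_through C n' n'"
        by (rule factors_through_refl[OF monos_into_Hom[OF n'(1)]])
      ultimately have "factors_through C k' n'"
        using lub' n'(1) unfolding is_lub_sub_iff[OF m'(1) n'(1) k'(1)] by blast
      then have "factors_through C (Ident C T) n'"
        by (rule factors_through_trans[OF I monos_into_Hom[OF k'(1)] monos_into_Hom[OF n'(1)] Ik'])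
      then show False using nn by blast
    qed
  qed
qed

text \<open>The witness is the pullback of \<open>m\<close> along \<open>n\<close>, composed with
  \<open>n\<close>. Describing it by all arrows that factor through it yields its order properties
  and its points at once.\<close>

lemma meet_exists:
  assumes m: "m \<in> monos_into C X" and n: "n \<in> monos_into C X"
  obtains k where "k \<in> monos_into C X"
    "\<forall>W. \<forall>g\<in>Hom C W X.
      factors_through C g k \<longleftrightarrow> factors_through C g m \<and> factors_through C g n"
proof -
  note nH = monos_into_Hom[OF n]
  obtain q where q: "q \<in> monos_into C (Dom C n)" "pullback_sub C n (subobject C X m) = subobject C (Dom C n) q"
    "\<forall>W. \<forall>g\<in>Hom C W (Dom C n). factors_through C g q \<longleftrightarrow> factors_through C (Comp C n g) m"
    by (rule pullback_along[OF m nH])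
  note qH = monos_into_Hom[OF q(1)]
  note kH = comp_in_hom[OF qH nH]
  have k: "Comp C n q \<in> monos_into C X"
  proof (rule monos_intoI[OF kH])
    fix W f g assume f: "f \<in> Hom C W (Dom C q)" and g: "g \<in> Hom C W (Dom C q)"
      and eq: "Comp C (Comp C n q) f = Comp C (Comp C n q) g"
    have "Comp C q f = Comp C q g"
      by (rule monos_intoD[OF n comp_in_hom[OF f qH] comp_in_hom[OF g qH]])
        (simp add: comp_assoc[OF f qH nH] comp_assoc[OF g qH nH] eq)
    then show "f = g" by (rule monos_intoD[OF q(1) f g])
  qed
  have "factors_through C g (Comp C n q) \<longleftrightarrow> factors_through C g m \<and> factors_through C g n"
    if g: "g \<in> Hom C W X" for W g
  proof
    assume "factors_through C g (Comp C n q)"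
    then obtain h where h: "h \<in> Hom C W (Dom C q)" "Comp C (Comp C n q) h = g"
      unfolding factors_through_iff[OF g kH] by blast
    note qh = comp_in_hom[OF h(1) qH]
    have g_eq: "Comp C n (Comp C q h) = g" using comp_assoc[OF h(1) qH nH] h(2) by simp
    have "factors_through C (Comp C q h) q"
      unfolding factors_through_iff[OF qh qH] using h(1) by blast
    then have "factors_through C g m" using q(3)[rule_format, OF qh] g_eq by simp
    moreover have "factors_through C g n"
      unfolding factors_through_iff[OF g nH] using qh g_eq by blast
    ultimately show "factors_through C g m \<and> factors_through C g n" ..
  next
    assume "factors_through C g m \<and> factors_through C g n"
    then obtain h where h: "h \<in> Hom C W (Dom C n)" "Comp C n h = g" and gm: "factors_through C g m"
      unfolding factors_through_iff[OF g nH] by blast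
    have "factors_through C h q" using q(3)[rule_format, OF h(1)] h(2) gm by simp
    then obtain l where l: "l \<in> Hom C W (Dom C q)" "Comp C q l = h"
      unfolding factors_through_iff[OF h(1) qH] by blast
    have "Comp C (Comp C n q) l = g" using comp_assoc[OF l(1) qH nH] l(2) h(2) by simp
    then show "factors_through C g (Comp C n q)"
      unfolding factors_through_iff[OF g kH] using l(1) by blast
  qed
  then show thesis by (intro that[OF k]) simp
qed

lemma points_in_Hom: "points_in X m \<subseteq> Hom C T X"
  unfolding points_in_def by blast

lemma Ident_mono: "X \<in> Obj C \<Longrightarrow> Ident C X \<in> monos_into C X"
  by (rule monos_intoI[OF ident_in_hom]) (simp_all add: comp_ident_left)

lemma factors_through_Ident: "f \<in> Hom C W X \<Longrightarrow> factors_through C f (Ident C X)"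
  using factors_through_iff[OF _ ident_in_hom[OF Hom_obj(2)]] comp_ident_left by blast

lemma points_in_Ident: "X \<in> Obj C \<Longrightarrow> points_in X (Ident C X) = Hom C T X"
  unfolding points_in_def using factors_through_Ident by blast

lemma bottom_exists:
  assumes X: "X \<in> Obj C"
  obtains b where "b \<in> monos_into C X" "least (Sub C X) (subobject C X b) (carrier (Sub C X))"
    "is_lub (Sub C X) (subobject C X b) {}"
proof -
  obtain S where S: "is_lub (Sub C X) S {}"
    using coherent X unfolding coherent_category_def by blast
  have U: "Upper (Sub C X) {} = carrier (Sub C X)" unfolding Upper_def by simp
  then have "S \<in> carrier (Sub C X)" using S unfolding least_def by simp
  then obtain b where "b \<in> monos_into C X" "S = subobject C X b" unfolding carrier_Sub by blast
  then show thesis using that S U by simp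
qed

text \<open>A point in the bottom would pull it back to a bottom of \<open>Sub T\<close> through
  which the identity factors, so every subobject of \<open>T\<close> would be everything. One of
  them has initial domain, namely the pullback of one injection of \<open>T\<close> into
  \<open>T + T\<close> along the other, and \<open>T\<close> would be initial.\<close>

lemma points_in_bottom:
  assumes X: "X \<in> Obj C" and b: "b \<in> monos_into C X" and lub: "is_lub (Sub C X) (subobject C X b) {}"
  shows "points_in X b = {}"
proof (rule ccontr)
  assume "points_in X b \<noteq> {}"
  then obtain x where x: "x \<in> Hom C T X" "factors_through C x b" unfolding points_in_def by blast
  note I = ident_in_hom[OF T_Obj]
  obtain n where n: "n \<in> monos_into C T" "pullback_sub C x (subobject C X b) = subobject C T n"
    "\<forall>W. \<forall>g\<in>Hom C W T. factors_through C g n \<longleftrightarrow> factors_through C (Comp C x g) b"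
    by (rule pullback_along[OF b x(1)])
  have "is_lub (Sub C T) (subobject C T n) {}"
    using lub_pullback[OF x(1) _ _ lub] n(2) by simp
  then have least: "factors_through C n l" if "l \<in> monos_into C T" for l
    using that le_Sub[OF n(1) that] sub_carrier[OF that] unfolding least_def Upper_def by blast
  have In: "factors_through C (Ident C T) n"
    using n(3)[rule_format, OF I] x comp_ident_right[OF x(1)] by simp
  obtain S \<iota> where S: "is_coproduct C {0, 1 :: nat} (\<lambda>_. T) S \<iota>" "\<iota> 0 \<in> Hom C T S" "\<iota> 1 \<in> Hom C T S"
    by (rule coproduct_exists[OF T_Obj])
  obtain p q where pb: "is_pullback C (\<iota> 0) (\<iota> 1) p q"
    by (rule pullback_exists[OF finite_limits S(2,3)])
  have q: "q \<in> monos_into C T"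
    using pullback_mono[OF pb] point_mono[OF S(2)] HomD(2)[OF S(3)] unfolding monos_into_def by simp
  note qH = monos_into_Hom[OF q]
  have "factors_through C (Ident C T) q"
    by (rule factors_through_trans[OF I monos_into_Hom[OF n(1)] qH In least[OF q]])
  then obtain h where h: "h \<in> Hom C T (Dom C q)" "Comp C q h = Ident C T"
    unfolding factors_through_iff[OF I qH] by blast
  have "is_initial C (Dom C q)"
    using disjoint[OF S(1) pb] is_pullback_Hom(4)[OF pb] HomD(2) by metis
  then have "is_initial C T" by (rule retract_initial[OF _ h(1) qH h(2)])
  then show False using T_not_initial by blast
qed

text \<open>The operations of \<open>Sub C X\<close> are values of \<open>SOME\<close>, so a witness
  for each has to be produced before its defining property can be used. Disjointness follows because
  the meet lies below a subobject without points.\<close>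

lemma complemented_points:
  assumes X: "X \<in> Obj C" and a: "a \<in> monos_into C X" and b: "b \<in> monos_into C X"
    and meet: "subobject C X a \<sqinter>\<^bsub>Sub C X\<^esub> subobject C X b = \<bottom>\<^bsub>Sub C X\<^esub>"
    and join: "subobject C X a \<squnion>\<^bsub>Sub C X\<^esub> subobject C X b = \<top>\<^bsub>Sub C X\<^esub>"
  shows "points_in X a \<inter> points_in X b = {}"
    and "is_lub (Sub C X) (subobject C X (Ident C X)) {subobject C X a, subobject C X b}"
proof -
  obtain z where z: "z \<in> monos_into C X" "least (Sub C X) (subobject C X z) (carrier (Sub C X))"
    "is_lub (Sub C X) (subobject C X z) {}"
    by (rule bottom_exists[OF X])
  have "least (Sub C X) \<bottom>\<^bsub>Sub C X\<^esub> (carrier (Sub C X))"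
    unfolding bottom_def using z(2) by (rule someI)
  then have "\<bottom>\<^bsub>Sub C X\<^esub> \<in> carrier (Sub C X)" "\<bottom>\<^bsub>Sub C X\<^esub> \<sqsubseteq>\<^bsub>Sub C X\<^esub> subobject C X z"
    using sub_carrier[OF z(1)] unfolding least_def by auto
  then obtain z' where z': "z' \<in> monos_into C X" "\<bottom>\<^bsub>Sub C X\<^esub> = subobject C X z'" "factors_through C z' z"
    using le_Sub z(1) unfolding carrier_Sub by auto
  have "points_in X z' = {}"
    using points_in_mono[OF z'(1) z(1) z'(3)] points_in_bottom[OF X z(1,3)] by blast
  obtain k where k: "k \<in> monos_into C X"
    "\<forall>W. \<forall>g\<in>Hom C W X. factors_through C g k \<longleftrightarrow> factors_through C g a \<and> factors_through C g b"
    by (rule meet_exists[OF a b])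
  have Lower: "Lower (Sub C X) {subobject C X a, subobject C X b} =
      subobject C X ` {l \<in> monos_into C X. factors_through C l a \<and> factors_through C l b}"
    unfolding Lower_def carrier_Sub using le_Sub a b by auto
  have k_le: "factors_through C k a \<and> factors_through C k b"
    using k(2)[rule_format, OF monos_into_Hom[OF k(1)]] factors_through_refl[OF monos_into_Hom[OF k(1)]] by blast
  have "greatest (Sub C X) (subobject C X k) (Lower (Sub C X) {subobject C X a, subobject C X b})"
    unfolding greatest_def Lower carrier_Sub
    using k(1) k_le le_Sub[OF _ k(1)] k(2)[rule_format, OF monos_into_Hom] by auto
  then have "greatest (Sub C X) (subobject C X a \<sqinter>\<^bsub>Sub C X\<^esub> subobject C X b) (Lower (Sub C X) {subobject C X a, subobject C X b})"
    unfolding meet_def inf_def by (rule someI)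
  then have "subobject C X k \<sqsubseteq>\<^bsub>Sub C X\<^esub> subobject C X z'"
    unfolding meet z'(2) greatest_def Lower using k(1) k_le by blast
  then have kz: "factors_through C k z'" using le_Sub[OF k(1) z'(1)] by simp
  have "points_in X a \<inter> points_in X b \<subseteq> points_in X k"
    unfolding points_in_def using k(2) by blast
  also have "\<dots> \<subseteq> points_in X z'" by (rule points_in_mono[OF k(1) z'(1) kz])
  finally show "points_in X a \<inter> points_in X b = {}" using \<open>points_in X z' = {}\<close> by blast
  obtain S where "is_lub (Sub C X) S {subobject C X a, subobject C X b}"
    using coherent X sub_carrier[OF a] sub_carrier[OF b] unfolding coherent_category_def
    by (meson empty_subsetI finite.emptyI finite.insertI insert_subsetI)
  then have lub: "is_lub (Sub C X) \<top>\<^bsub>Sub C X\<^esub> {subobject C X a, subobject C X b}"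
    unfolding join[symmetric] join_def sup_def by (rule someI)
  have I: "Ident C X \<in> monos_into C X" by (rule Ident_mono[OF X])
  have "greatest (Sub C X) (subobject C X (Ident C X)) (carrier (Sub C X))"
    unfolding greatest_def carrier_Sub
    using I le_Sub[OF _ I] factors_through_Ident[OF monos_into_Hom] by auto
  then have "greatest (Sub C X) \<top>\<^bsub>Sub C X\<^esub> (carrier (Sub C X))"
    unfolding top_def by (rule someI)
  then obtain t where t: "t \<in> monos_into C X" "\<top>\<^bsub>Sub C X\<^esub> = subobject C X t"
    and "subobject C X (Ident C X) \<sqsubseteq>\<^bsub>Sub C X\<^esub> subobject C X t"
    using I unfolding greatest_def carrier_Sub by auto
  then have "subobject C X t = subobject C X (Ident C X)"
    using le_Sub[OF I t(1)] sub_eq_iff[OF t(1) I] factors_through_Ident[OF monos_into_Hom[OF t(1)]] by simp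
  then show "is_lub (Sub C X) (subobject C X (Ident C X)) {subobject C X a, subobject C X b}"
    using lub t(2) by simp
qed

text \<open>By filtrality \<open>n\<close> is the meet of the complemented subobjects \<open>a\<close> above it; a complement of
  \<open>a\<close> meets \<open>m\<close> in an object without points.\<close>

lemma factors_through_if_points:
  assumes m: "m \<in> monos_into C X" and n: "n \<in> monos_into C X"
    and sub_pts: "points_in X m \<subseteq> points_in X n"
  shows "factors_through C m n"
proof -
  note mH = monos_into_Hom[OF m]
  note X = Hom_obj(2)[OF mH] and A = Hom_obj(1)[OF mH]
  let ?\<phi> = "\<lambda>x. {y \<in> carrier (complemented_part (Sub C X)). x \<sqsubseteq>\<^bsub>Sub C X\<^esub> y}"
  have "filtral_lattice (Sub C X)"
    using strongly_filtral X unfolding strongly_filtral_def by blast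
  then have "?\<phi> (subobject C X n) \<subseteq> ?\<phi> (subobject C X m) \<longrightarrow> subobject C X m \<sqsubseteq>\<^bsub>Sub C X\<^esub> subobject C X n"
    using sub_carrier[OF m] sub_carrier[OF n]
    unfolding filtral_lattice_def Let_def order_emb_def filters_of_def by auto
  moreover have "subobject C X m \<sqsubseteq>\<^bsub>Sub C X\<^esub> y" if y: "y \<in> ?\<phi> (subobject C X n)" for y
  proof -
    obtain a b where a: "a \<in> monos_into C X" "y = subobject C X a" and b: "b \<in> monos_into C X"
      and meet: "subobject C X a \<sqinter>\<^bsub>Sub C X\<^esub> subobject C X b = \<bottom>\<^bsub>Sub C X\<^esub>"
      and join: "subobject C X a \<squnion>\<^bsub>Sub C X\<^esub> subobject C X b = \<top>\<^bsub>Sub C X\<^esub>"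
      and na: "subobject C X n \<sqsubseteq>\<^bsub>Sub C X\<^esub> subobject C X a"
      using y unfolding complemented_part_def carrier_Sub by auto
    have na': "factors_through C n a" using na le_Sub[OF n a(1)] by simp
    note compl = complemented_points[OF X a(1) b meet join]
    obtain a' where a': "a' \<in> monos_into C (Dom C m)" "pullback_sub C m (subobject C X a) = subobject C (Dom C m) a'"
      "\<forall>W. \<forall>g\<in>Hom C W (Dom C m). factors_through C g a' \<longleftrightarrow> factors_through C (Comp C m g) a"
      by (rule pullback_along[OF a(1) mH])
    obtain b' where b': "b' \<in> monos_into C (Dom C m)" "pullback_sub C m (subobject C X b) = subobject C (Dom C m) b'"
      "\<forall>W. \<forall>g\<in>Hom C W (Dom C m). factors_through C g b' \<longleftrightarrow> factors_through C (Comp C m g) b"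
      by (rule pullback_along[OF b mH])
    note I = Ident_mono[OF X] and I' = Ident_mono[OF A]
    \<comment> \<open>Complementarity is restricted to the domain of \<open>m\<close>: there the
      identity is the join of \<open>a'\<close> and \<open>b'\<close>. Once \<open>b'\<close> has no
      points it lies below \<open>a'\<close>, so \<open>a'\<close> is everything and
      \<open>m\<close> factors through \<open>a\<close>.\<close>
    have "pullback_sub C m (subobject C X (Ident C X)) = subobject C (Dom C m) (Ident C (Dom C m))"
      by (rule pullback_sub_eq[OF I mH I']) (simp add: factors_through_Ident factors_through_Ident[OF comp_in_hom[OF _ mH]])
    then have lub: "is_lub (Sub C (Dom C m)) (subobject C (Dom C m) (Ident C (Dom C m)))
        {subobject C (Dom C m) a', subobject C (Dom C m) b'}"
      using lub_pullback[OF mH _ _ compl(2)] sub_carrier[OF a(1)] sub_carrier[OF b] a'(2) b'(2) by simp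
    have "points_in (Dom C m) b' = {}"
    proof (rule ccontr)
      assume "points_in (Dom C m) b' \<noteq> {}"
      then obtain w where w: "w \<in> Hom C T (Dom C m)" "factors_through C w b'"
        unfolding points_in_def by blast
      have "Comp C m w \<in> points_in X m" using points_in_iff[OF mH] w(1) by blast
      then have "Comp C m w \<in> points_in X a"
        using sub_pts points_in_mono[OF n a(1) na'] by blast
      moreover have "Comp C m w \<in> points_in X b"
        using b'(3)[rule_format, OF w(1)] w comp_in_hom[OF w(1) mH] unfolding points_in_def by blast
      ultimately show False using compl(1) by blast
    qed
    then have "factors_through C b' a'"
      by (rule factors_through_if_no_points[OF b'(1) a'(1)])
    then have "factors_through C (Ident C (Dom C m)) a'"
      using lub a'(1) factors_through_refl[OF monos_into_Hom[OF a'(1)]]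
      unfolding is_lub_sub_iff[OF a'(1) b'(1) I'] by blast
    then have "factors_through C m a"
      using a'(3)[rule_format, OF ident_in_hom[OF A]] comp_ident_right[OF mH] by simp
    then show ?thesis using le_Sub[OF m a(1)] a(2) by simp
  qed
  ultimately have "subobject C X m \<sqsubseteq>\<^bsub>Sub C X\<^esub> subobject C X n" by blast
  then show ?thesis using le_Sub[OF m n] by simp
qed

end

section \<open>The spectrum functor\<close>

context filtral_category
begin

definition coded_points :: "'o \<Rightarrow> 'a \<Rightarrow> 'u set" where
  "coded_points X m = code X ` points_in X m"

definition closed_sets :: "'o \<Rightarrow> 'u set set" where
  "closed_sets X = coded_points X ` monos_into C X"

definition decode :: "'o \<Rightarrow> 'u \<Rightarrow> 'a" where
  "decode X = inv_into (Hom C T X) (code X)"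

text \<open>The choice among monomorphisms with the same points is harmless: they represent the same
  subobject.\<close>

definition sub_of :: "'o \<Rightarrow> 'u set \<Rightarrow> 'a set" where
  "sub_of X A = subobject C X (SOME m. m \<in> monos_into C X \<and> coded_points X m = A)"

lemma decode_code: "x \<in> Hom C T X \<Longrightarrow> decode X (code X x) = x"
  unfolding decode_def by (rule inv_into_f_f[OF inj_code[OF Hom_obj(2)]])

lemma decode_Hom: "u \<in> code X ` Hom C T X \<Longrightarrow> decode X u \<in> Hom C T X"
  unfolding decode_def by (rule inv_into_into)

lemma code_decode: "u \<in> code X ` Hom C T X \<Longrightarrow> code X (decode X u) = u"
  unfolding decode_def by (rule f_inv_into_f)

lemma coded_points_subset_iff:
  assumes m: "m \<in> monos_into C X" and n: "n \<in> monos_into C X"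
  shows "coded_points X m \<subseteq> coded_points X n \<longleftrightarrow> factors_through C m n"
proof -
  have X: "X \<in> Obj C" by (rule Hom_obj(2)[OF monos_into_Hom[OF m]])
  show ?thesis
    unfolding coded_points_def inj_on_image_subset_iff[OF inj_code[OF X] points_in_Hom points_in_Hom]
    using factors_through_if_points[OF m n] points_in_mono[OF m n] by blast
qed

lemma sub_of_coded_points:
  assumes m: "m \<in> monos_into C X"
  shows "sub_of X (coded_points X m) = subobject C X m"
proof -
  let ?n = "SOME n. n \<in> monos_into C X \<and> coded_points X n = coded_points X m"
  have "?n \<in> monos_into C X \<and> coded_points X ?n = coded_points X m"
    by (rule someI[of _ m]) (simp add: m)
  then have n: "?n \<in> monos_into C X" and eq: "coded_points X ?n = coded_points X m" by auto
  show ?thesis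
    unfolding sub_of_def sub_eq_iff[OF n m]
    using coded_points_subset_iff[OF n m] coded_points_subset_iff[OF m n] eq by simp
qed

lemma mem_coded_points: "x \<in> Hom C T X \<Longrightarrow> code X x \<in> coded_points X m \<longleftrightarrow> factors_through C x m"
  unfolding coded_points_def
  using inj_on_image_mem_iff[OF inj_code[OF Hom_obj(2)] _ points_in_Hom]
  by (simp add: points_in_def)

lemma closed_setsE:
  assumes "A \<in> closed_sets X"
  obtains m where "m \<in> monos_into C X" "A = coded_points X m"
  using assms unfolding closed_sets_def by blast

lemma filtral_lattice_of_sets_closed_sets:
  assumes X: "X \<in> Obj C"
  shows "filtral_lattice_of_sets (Sub C X) (sub_of X) (closed_sets X) (code X ` Hom C T X)"
proof unfold_locales
  show "eq (Sub C X) = (=)" by (rule eq_Sub)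
  show "carrier (Sub C X) = sub_of X ` closed_sets X"
    unfolding carrier_Sub closed_sets_def image_image
    by (rule image_cong) (simp_all add: sub_of_coded_points)
  show "filtral_lattice (Sub C X)"
    using strongly_filtral X unfolding strongly_filtral_def by blast
  obtain b where "b \<in> monos_into C X" "points_in X b = {}"
    using bottom_exists[OF X] points_in_bottom[OF X] by metis
  then show "{} \<in> closed_sets X" unfolding closed_sets_def coded_points_def by force
  show "code X ` Hom C T X \<in> closed_sets X"
    unfolding closed_sets_def coded_points_def
    using Ident_mono[OF X] points_in_Ident[OF X] by force
next
  fix A B assume "A \<in> closed_sets X" "B \<in> closed_sets X"
  then obtain m n where m: "m \<in> monos_into C X" "A = coded_points X m"
    and n: "n \<in> monos_into C X" "B = coded_points X n"
    using closed_setsE by metis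
  show "sub_of X A \<sqsubseteq>\<^bsub>Sub C X\<^esub> sub_of X B \<longleftrightarrow> A \<subseteq> B"
    unfolding m(2) n(2) sub_of_coded_points[OF m(1)] sub_of_coded_points[OF n(1)]
      le_Sub[OF m(1) n(1)] coded_points_subset_iff[OF m(1) n(1)] ..
  obtain k where k: "k \<in> monos_into C X"
    "\<forall>W. \<forall>g\<in>Hom C W X. factors_through C g k \<longleftrightarrow> factors_through C g m \<and> factors_through C g n"
    by (rule meet_exists[OF m(1) n(1)])
  have "points_in X k = points_in X m \<inter> points_in X n"
    unfolding points_in_def using k(2) by blast
  then have "coded_points X k = A \<inter> B"
    unfolding m(2) n(2) coded_points_def
    by (simp add: inj_on_image_Int[OF inj_code[OF X] points_in_Hom points_in_Hom])
  then show "A \<inter> B \<in> closed_sets X" unfolding closed_sets_def using k(1) by blast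
  have "\<exists>S. is_lub (Sub C X) S {subobject C X m, subobject C X n}"
    using coherent X sub_carrier[OF m(1)] sub_carrier[OF n(1)] unfolding coherent_category_def
    by (meson empty_subsetI finite.emptyI finite.insertI insert_subsetI)
  then obtain S where S: "is_lub (Sub C X) S {subobject C X m, subobject C X n}" by blast
  then have "S \<in> carrier (Sub C X)" unfolding least_def Upper_def by blast
  then obtain l where l: "l \<in> monos_into C X" "S = subobject C X l" unfolding carrier_Sub by blast
  have "coded_points X l = A \<union> B"
    using points_in_lub[OF m(1) n(1) l(1)] S
    unfolding m(2) n(2) l(2) coded_points_def by (simp add: image_Un)
  then show "A \<union> B \<in> closed_sets X" unfolding closed_sets_def using l(1) by blast
next
  fix A assume "A \<in> closed_sets X"
  then show "A \<subseteq> code X ` Hom C T X"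
    using points_in_Hom unfolding closed_sets_def coded_points_def by blast
next
  fix u assume "u \<in> code X ` Hom C T X"
  then obtain x where x: "x \<in> Hom C T X" "u = code X x" by blast
  \<comment> \<open>The only arrow from \<open>T\<close> to itself is the identity, so the subobject
    \<open>x\<close> has no other point. This makes singletons closed.\<close>
  have "points_in X x = {x}"
  proof -
    note I = ident_in_hom[OF T_Obj]
    have "Hom C T T = {Ident C T}"
    proof (intro equalityI subsetI)
      show "a \<in> {Ident C T}" if "a \<in> Hom C T T" for a
        unfolding singleton_iff by (rule into_T_unique[OF that I])
      show "a \<in> Hom C T T" if "a \<in> {Ident C T}" for a
        using that I unfolding singleton_iff by (rule ssubst)
    qed
    then have "y \<in> points_in X x \<longleftrightarrow> y = x" for y
      unfolding points_in_iff[OF x(1)] using comp_ident_right[OF x(1)] by auto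
    then show ?thesis by auto
  qed
  then have "coded_points X x = {u}" unfolding coded_points_def x(2) by simp
  then show "{u} \<in> closed_sets X" unfolding closed_sets_def using point_mono[OF x(1)] by blast
qed

section \<open>The spectrum on objects and arrows; functoriality and faithfulness\<close>

definition spec :: "'o \<Rightarrow> 'u topology" where
  "spec X = filtral_lattice_of_sets.set_space (closed_sets X) (code X ` Hom C T X)"

lemma topspace_spec: "X \<in> Obj C \<Longrightarrow> topspace (spec X) = code X ` Hom C T X"
  unfolding spec_def
  by (rule filtral_lattice_of_sets.topspace_space[OF filtral_lattice_of_sets_closed_sets])

lemma closedin_spec: "X \<in> Obj C \<Longrightarrow> closedin (spec X) A \<longleftrightarrow> A \<in> closed_sets X"
  unfolding spec_def
  by (rule filtral_lattice_of_sets.closedin_space[OF filtral_lattice_of_sets_closed_sets])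

lemma spec_Obj: "X \<in> Obj C \<Longrightarrow> spec X \<in> Obj Stone"
  unfolding Obj_Stone
  using filtral_lattice_of_sets.Stone_space_space[OF filtral_lattice_of_sets_closed_sets]
    small_image[OF small_points] topspace_spec unfolding spec_def by metis

definition spec_fun :: "'a \<Rightarrow> 'u \<Rightarrow> 'u" where
  "spec_fun f u = code (Cod C f) (Comp C f (decode (Dom C f) u))"

definition Spec :: "('o, 'a, 'u topology, 'u Stone_arrow) fctr" where
  "Spec = \<lparr>omap = spec, amap = (\<lambda>f. arrow (spec (Dom C f)) (spec_fun f) (spec (Cod C f)))\<rparr>"

lemma omap_Spec: "omap Spec = spec"
  unfolding Spec_def by simp

lemma code_in_spec: "x \<in> Hom C T X \<Longrightarrow> code X x \<in> topspace (spec X)"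
  using topspace_spec[OF Hom_obj(2)] by blast

lemma spec_point:
  assumes "X \<in> Obj C" "u \<in> topspace (spec X)"
  obtains x where "x \<in> Hom C T X" "u = code X x"
  using assms topspace_spec by blast

lemma spec_fun_code:
  assumes "f \<in> Hom C X Y" "x \<in> Hom C T X"
  shows "spec_fun f (code X x) = code Y (Comp C f x)"
  unfolding spec_fun_def HomD[OF assms(1)] decode_code[OF assms(2)] ..

text \<open>The preimage of the points of \<open>m\<close> is the set of points of the pullback of
  \<open>m\<close> along \<open>f\<close>, hence closed.\<close>

lemma Spec_Hom:
  assumes f: "f \<in> Hom C X Y"
  shows "amap Spec f \<in> Hom Stone (spec X) (spec Y)"
proof -
  note X = Hom_obj(1)[OF f] and Y = Hom_obj(2)[OF f]
  have "continuous_map (spec X) (spec Y) (spec_fun f)"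
    unfolding continuous_map_closedin
  proof (intro conjI allI impI)
    show "spec_fun f \<in> topspace (spec X) \<rightarrow> topspace (spec Y)"
    proof
      fix u assume "u \<in> topspace (spec X)"
      then obtain x where x: "x \<in> Hom C T X" "u = code X x" by (rule spec_point[OF X])
      then show "spec_fun f u \<in> topspace (spec Y)"
        using spec_fun_code[OF f x(1)] code_in_spec[OF comp_in_hom[OF x(1) f]] by simp
    qed
    fix K assume "closedin (spec Y) K"
    then obtain m where m: "m \<in> monos_into C Y" "K = coded_points Y m"
      unfolding closedin_spec[OF Y] by (rule closed_setsE)
    obtain n where n: "n \<in> monos_into C X" "pullback_sub C f (subobject C Y m) = subobject C X n"
      "\<forall>W. \<forall>g\<in>Hom C W X. factors_through C g n \<longleftrightarrow> factors_through C (Comp C f g) m"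
      by (rule pullback_along[OF m(1) f])
    have mem: "spec_fun f (code X x) \<in> K \<longleftrightarrow> code X x \<in> coded_points X n" if x: "x \<in> Hom C T X" for x
      unfolding m(2) spec_fun_code[OF f x] mem_coded_points[OF x] mem_coded_points[OF comp_in_hom[OF x f]]
      using n(3) x by blast
    have "{u \<in> topspace (spec X). spec_fun f u \<in> K} = coded_points X n"
    proof (intro equalityI subsetI)
      fix u assume u: "u \<in> {u \<in> topspace (spec X). spec_fun f u \<in> K}"
      then obtain x where "x \<in> Hom C T X" "u = code X x" using spec_point[OF X, of u] by blast
      then show "u \<in> coded_points X n" using mem u by simp
    next
      fix u assume u: "u \<in> coded_points X n"
      then obtain x where "x \<in> Hom C T X" "u = code X x"
        unfolding coded_points_def points_in_def by blast
      then show "u \<in> {u \<in> topspace (spec X). spec_fun f u \<in> K}"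
        using mem u code_in_spec by simp
    qed
    then show "closedin (spec X) {u \<in> topspace (spec X). spec_fun f u \<in> K}"
      unfolding closedin_spec[OF X] closed_sets_def using n(1) by simp
  qed
  then show ?thesis
    unfolding Spec_def using HomD[OF f] arrow_Hom[OF spec_Obj[OF X] spec_Obj[OF Y]] by simp
qed

lemma fun_of_Spec:
  assumes f: "f \<in> Hom C X Y" and x: "x \<in> Hom C T X"
  shows "fun_of (amap Spec f) (code X x) = code Y (Comp C f x)"
  unfolding Spec_def using HomD[OF f] fun_of_arrow[OF code_in_spec[OF x]] spec_fun_code[OF f x] by simp

lemma code_inj: "x \<in> Hom C T X \<Longrightarrow> y \<in> Hom C T X \<Longrightarrow> code X x = code X y \<Longrightarrow> x = y"
  using inj_onD[OF inj_code[OF Hom_obj(2)]] by blast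

lemma is_functor_Spec: "is_functor C Stone Spec"
  unfolding is_functor_def omap_Spec
proof (intro conjI ballI impI)
  fix X assume X: "X \<in> Obj C"
  show "spec X \<in> Obj Stone" by (rule spec_Obj[OF X])
  note I = ident_in_hom[OF X]
  show "amap Spec (Ident C X) = Ident Stone (spec X)"
  proof (rule Stone_ext[OF Spec_Hom[OF I] Ident_Stone_Hom[OF spec_Obj[OF X]]])
    fix u assume u: "u \<in> topspace (spec X)"
    then obtain x where x: "x \<in> Hom C T X" "u = code X x" by (rule spec_point[OF X])
    show "fun_of (amap Spec (Ident C X)) u = fun_of (Ident Stone (spec X)) u"
      using fun_of_Spec[OF I x(1)] x(2) fun_of_Ident[OF u] comp_ident_left[OF x(1)] by simp
  qed
next
  fix f assume "f \<in> Arr C"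
  then show "amap Spec f \<in> Hom Stone (spec (Dom C f)) (spec (Cod C f))"
    by (rule Spec_Hom[OF Arr_Hom])
next
  fix f g assume "f \<in> Arr C" "g \<in> Arr C" "Dom C g = Cod C f"
  then have f: "f \<in> Hom C (Dom C f) (Cod C f)" and g: "g \<in> Hom C (Cod C f) (Cod C g)"
    unfolding Hom_def by auto
  note gf = comp_in_hom[OF f g]
  show "amap Spec (Comp C g f) = Comp Stone (amap Spec g) (amap Spec f)"
  proof (rule Stone_ext[OF Spec_Hom[OF gf] Comp_Stone_Hom[OF Spec_Hom[OF f] Spec_Hom[OF g]]])
    fix u assume u: "u \<in> topspace (spec (Dom C f))"
    then obtain x where x: "x \<in> Hom C T (Dom C f)" "u = code (Dom C f) x"
      by (rule spec_point[OF Hom_obj(1)[OF f]])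
    show "fun_of (amap Spec (Comp C g f)) u = fun_of (Comp Stone (amap Spec g) (amap Spec f)) u"
      unfolding x(2) fun_of_comp[OF Spec_Hom[OF f] Spec_Hom[OF g] code_in_spec[OF x(1)]]
        fun_of_Spec[OF gf x(1)] fun_of_Spec[OF f x(1)]
        fun_of_Spec[OF g comp_in_hom[OF x(1) f]] comp_assoc[OF x(1) f g] ..
  qed
qed

lemma Spec_faithful:
  assumes f: "f \<in> Hom C X Y" and g: "g \<in> Hom C X Y" and eq: "amap Spec f = amap Spec g"
  shows "f = g"
proof (rule arrow_eqI[OF f g])
  fix x assume x: "x \<in> Hom C T X"
  show "Comp C f x = Comp C g x"
    by (rule code_inj[OF comp_in_hom[OF x f] comp_in_hom[OF x g]])
      (use fun_of_Spec[OF f x] fun_of_Spec[OF g x] eq in simp)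
qed

section \<open>Maps into spectra: fullness and essential surjectivity\<close>

lemma Spec_mono_inj:
  assumes m: "m \<in> monos_into C X"
  shows "inj_on (fun_of (amap Spec m)) (topspace (spec (Dom C m)))"
proof (rule inj_onI)
  note mH = monos_into_Hom[OF m]
  fix u v assume "u \<in> topspace (spec (Dom C m))" "v \<in> topspace (spec (Dom C m))"
    and eq: "fun_of (amap Spec m) u = fun_of (amap Spec m) v"
  then obtain a b where a: "a \<in> Hom C T (Dom C m)" "u = code (Dom C m) a"
    and b: "b \<in> Hom C T (Dom C m)" "v = code (Dom C m) b"
    using spec_point[OF Hom_obj(1)[OF mH]] by metis
  have "Comp C m a = Comp C m b"
    by (rule code_inj[OF comp_in_hom[OF a(1) mH] comp_in_hom[OF b(1) mH]])
      (use eq fun_of_Spec[OF mH a(1)] fun_of_Spec[OF mH b(1)] a(2) b(2) in simp)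
  then show "u = v" using monos_intoD[OF m a(1) b(1)] a(2) b(2) by simp
qed

lemma coded_points_image:
  assumes m: "m \<in> Hom C A X"
  shows "coded_points X m = fun_of (amap Spec m) ` topspace (spec A)"
proof -
  have "points_in X m = Comp C m ` Hom C T A"
    by (intro equalityI subsetI) (auto simp: points_in_iff[OF m])
  then show ?thesis
    unfolding coded_points_def topspace_spec[OF Hom_obj(1)[OF m]] image_image
    using fun_of_Spec[OF m] by (simp add: image_image)
qed

text \<open>At this point a continuous map into \<open>spec P\<close> need not come from an arrow into \<open>P\<close>, but its
  image, being closed, comes from a subobject of \<open>P\<close>.\<close>

lemma image_is_subobject:
  assumes h: "continuous_map Z (spec P) h" and Z: "Z \<in> Obj Stone" and P: "P \<in> Obj C"
  obtains m where "m \<in> monos_into C P" "h ` topspace Z = fun_of (amap Spec m) ` topspace (spec (Dom C m))"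
proof -
  have "closed_map Z (spec P) h"
    using continuous_imp_closed_map[OF h] Obj_StoneD(3)[OF Z] Obj_StoneD(4)[OF spec_Obj[OF P]] by blast
  then have "closedin (spec P) (h ` topspace Z)" unfolding closed_map_def by simp
  then obtain m where m: "m \<in> monos_into C P" "h ` topspace Z = coded_points P m"
    unfolding closedin_spec[OF P] by (rule closed_setsE)
  then show thesis using that coded_points_image[OF monos_into_Hom[OF m(1)]] by simp
qed

text \<open>The hypothesis \<open>sep\<close> is the uniqueness half of a product. With compactness
  of \<open>spec P\<close> it makes componentwise continuity enough, without identifying the
  topology of \<open>spec P\<close>.\<close>

lemma continuous_into_spec_product:
  assumes P: "P \<in> Obj C" and \<pi>: "\<And>i. i \<in> I \<Longrightarrow> \<pi> i \<in> Hom C P (X i)"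
    and sep: "\<And>w w'. w \<in> Hom C T P \<Longrightarrow> w' \<in> Hom C T P \<Longrightarrow>
      (\<And>i. i \<in> I \<Longrightarrow> Comp C (\<pi> i) w = Comp C (\<pi> i) w') \<Longrightarrow> w = w'"
    and w: "\<And>z. z \<in> topspace Z \<Longrightarrow> w z \<in> Hom C T P"
    and cont: "\<And>i. i \<in> I \<Longrightarrow> continuous_map Z (spec (X i)) (\<lambda>z. code (X i) (Comp C (\<pi> i) (w z)))"
  shows "continuous_map Z (spec P) (\<lambda>z. code P (w z))"
proof (rule continuous_map_into_compact[of "spec P" I "\<lambda>i. spec (X i)" "\<lambda>i. fun_of (amap Spec (\<pi> i))"])
  show "compact_space (spec P)" by (rule Obj_StoneD(3)[OF spec_Obj[OF P]])
  show "Hausdorff_space (spec (X i))" if "i \<in> I" for i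
    by (rule Obj_StoneD(4)[OF spec_Obj[OF Hom_obj(2)[OF \<pi>[OF that]]]])
  show "continuous_map (spec P) (spec (X i)) (fun_of (amap Spec (\<pi> i)))" if "i \<in> I" for i
    by (rule Hom_StoneD(3)[OF Spec_Hom[OF \<pi>[OF that]]])
  show "u = v" if u: "u \<in> topspace (spec P)" and v: "v \<in> topspace (spec P)"
    and eq: "\<And>i. i \<in> I \<Longrightarrow> fun_of (amap Spec (\<pi> i)) u = fun_of (amap Spec (\<pi> i)) v" for u v
  proof -
    obtain a where a: "a \<in> Hom C T P" "u = code P a" by (rule spec_point[OF P u])
    obtain b where b: "b \<in> Hom C T P" "v = code P b" by (rule spec_point[OF P v])
    have "a = b"
    proof (rule sep[OF a(1) b(1)])
      fix i assume i: "i \<in> I"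
      show "Comp C (\<pi> i) a = Comp C (\<pi> i) b"
        by (rule code_inj[OF comp_in_hom[OF a(1) \<pi>[OF i]] comp_in_hom[OF b(1) \<pi>[OF i]]])
          (use eq[OF i] fun_of_Spec[OF \<pi>[OF i] a(1)] fun_of_Spec[OF \<pi>[OF i] b(1)] a(2) b(2) in simp)
    qed
    then show "u = v" using a(2) b(2) by simp
  qed
  show "(\<lambda>z. code P (w z)) \<in> topspace Z \<rightarrow> topspace (spec P)"
    using code_in_spec[OF w] by blast
  show "continuous_map Z (spec (X i)) (\<lambda>z. fun_of (amap Spec (\<pi> i)) (code P (w z)))" if "i \<in> I" for i
    by (rule continuous_map_eq[OF cont[OF that]]) (simp add: fun_of_Spec[OF \<pi>[OF that] w])
qed

text \<open>Every point of \<open>X\<close> lies in \<open>r\<close>, so the identity, a subobject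
  with the same points, factors through \<open>r\<close>.\<close>

lemma section_if_surjective_on_points:
  assumes r: "r \<in> monos_into C X" and surj: "\<And>x. x \<in> Hom C T X \<Longrightarrow> \<exists>a\<in>Hom C T (Dom C r). Comp C r a = x"
  obtains s where "s \<in> Hom C X (Dom C r)" "Comp C r s = Ident C X"
proof -
  note rH = monos_into_Hom[OF r]
  note X = Hom_obj(2)[OF rH]
  have "points_in X (Ident C X) \<subseteq> points_in X r"
    unfolding points_in_Ident[OF X] using surj points_in_iff[OF rH] by blast
  then have "factors_through C (Ident C X) r"
    by (rule factors_through_if_points[OF Ident_mono[OF X] r])
  then show thesis
    using that unfolding factors_through_iff[OF ident_in_hom[OF X] rH] by blast
qed

lemma Spec_full:
  assumes X: "X \<in> Obj C" and Y: "Y \<in> Obj C" and v: "v \<in> Hom Stone (spec X) (spec Y)"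
  shows "\<exists>f\<in>Hom C X Y. amap Spec f = v"
proof -
  \<comment> \<open>Products are available over index sets in \<open>'u\<close>, so a binary product
    is one indexed by two elements of \<open>'u\<close>.\<close>
  obtain i j :: 'u where ij: "i \<noteq> j" by (rule inaccessible_two_elements[OF inaccessible])
  define F where "F k = (if k = i then X else Y)" for k
  have "small TYPE('u) {i, j}" by (rule small_finite[OF inaccessible]) simp
  moreover have "F k \<in> Obj C" if "k \<in> {i, j}" for k using X Y by (simp add: F_def)
  ultimately obtain P \<pi> where P: "P \<in> Obj C" and \<pi>_all: "\<forall>k\<in>{i, j}. \<pi> k \<in> Hom C P (F k)"
    and ex: "\<forall>x. (\<forall>k\<in>{i, j}. x k \<in> Hom C T (F k)) \<longrightarrow> (\<exists>w\<in>Hom C T P. \<forall>k\<in>{i, j}. Comp C (\<pi> k) w = x k)"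
    and sep: "\<forall>w\<in>Hom C T P. \<forall>w'\<in>Hom C T P.
      (\<forall>k\<in>{i, j}. Comp C (\<pi> k) w = Comp C (\<pi> k) w') \<longrightarrow> w = w'"
    by (rule product_points_exist[OF complete _ _ T_Obj])
  note \<pi> = bspec[OF \<pi>_all]
  have \<pi>i: "\<pi> i \<in> Hom C P X" and \<pi>j: "\<pi> j \<in> Hom C P Y"
    using \<pi>[of i] \<pi>[of j] ij by (simp_all add: F_def)
  \<comment> \<open>The action that \<open>v\<close> prescribes on points, before any arrow
    realising it is known.\<close>
  define g where "g x = decode Y (fun_of v (code X x))" for x
  have g: "g x \<in> Hom C T Y" and code_g: "code Y (g x) = fun_of v (code X x)" if "x \<in> Hom C T X" for x
    using fun_of_in[OF v code_in_spec[OF that]] decode_Hom code_decode unfolding g_def topspace_spec[OF Y] by auto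
  have "\<exists>w. w \<in> Hom C T P \<and> Comp C (\<pi> i) w = x \<and> Comp C (\<pi> j) w = g x" if x: "x \<in> Hom C T X" for x
  proof -
    let ?x = "\<lambda>k. if k = i then x else g x"
    have "\<forall>k\<in>{i, j}. ?x k \<in> Hom C T (F k)" using x g[OF x] by (simp add: F_def)
    from ex[THEN spec, THEN mp, OF this] show ?thesis using ij by auto
  qed
  then have "\<forall>x\<in>Hom C T X. \<exists>w. w \<in> Hom C T P \<and> Comp C (\<pi> i) w = x \<and> Comp C (\<pi> j) w = g x"
    by (rule ballI)
  from bchoice[OF this] obtain w where
    w_all: "\<forall>x\<in>Hom C T X. w x \<in> Hom C T P \<and> Comp C (\<pi> i) (w x) = x \<and> Comp C (\<pi> j) (w x) = g x" ..
  have w: "w x \<in> Hom C T P" and wi: "Comp C (\<pi> i) (w x) = x" and wj: "Comp C (\<pi> j) (w x) = g x"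
    if "x \<in> Hom C T X" for x
    using bspec[OF w_all that] by simp_all
  have dec: "decode X u \<in> Hom C T X" "code X (decode X u) = u" if "u \<in> topspace (spec X)" for u
    using that decode_Hom code_decode unfolding topspace_spec[OF X] by auto
  \<comment> \<open>The point of \<open>P\<close> with components given by \<open>u\<close> and its
    image under \<open>v\<close>; the image of \<open>h\<close> is the graph of
    \<open>v\<close>.\<close>
  define h where "h u = code P (w (decode X u))" for u
  have h: "continuous_map (spec X) (spec P) h"
    unfolding h_def
  proof (rule continuous_into_spec_product[OF P \<pi>])
    show "a = b" if "a \<in> Hom C T P" "b \<in> Hom C T P"
      "\<And>k. k \<in> {i, j} \<Longrightarrow> Comp C (\<pi> k) a = Comp C (\<pi> k) b" for a b
      by (rule sep[rule_format, OF that])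
    show "w (decode X u) \<in> Hom C T P" if "u \<in> topspace (spec X)" for u
      by (rule w[OF dec(1)[OF that]])
    fix k assume k: "k \<in> {i, j}"
    show "continuous_map (spec X) (spec (F k)) (\<lambda>u. code (F k) (Comp C (\<pi> k) (w (decode X u))))"
    proof (cases "k = i")
      case True
      have "continuous_map (spec X) (spec X) (\<lambda>u. code X (Comp C (\<pi> i) (w (decode X u))))"
        by (rule continuous_map_eq[OF continuous_map_id]) (simp add: wi dec)
      then show ?thesis using True by (simp add: F_def)
    next
      case False
      then have kj: "k = j" using k by simp
      have "continuous_map (spec X) (spec Y) (\<lambda>u. code Y (Comp C (\<pi> j) (w (decode X u))))"
        by (rule continuous_map_eq[OF Hom_StoneD(3)[OF v]]) (simp add: wj dec code_g)
      then show ?thesis using kj ij by (simp add: F_def)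
    qed
  qed
  obtain m where m: "m \<in> monos_into C P"
    "h ` topspace (spec X) = fun_of (amap Spec m) ` topspace (spec (Dom C m))"
    by (rule image_is_subobject[OF h spec_Obj[OF X] P])
  note mH = monos_into_Hom[OF m(1)]
  note A = Hom_obj(1)[OF mH]
  have lift: "\<exists>a\<in>Hom C T (Dom C m). Comp C m a = w x" if x: "x \<in> Hom C T X" for x
  proof -
    have "h (code X x) \<in> fun_of (amap Spec m) ` topspace (spec (Dom C m))"
      using code_in_spec[OF x] m(2) by blast
    then obtain u where u: "u \<in> topspace (spec (Dom C m))" "h (code X x) = fun_of (amap Spec m) u" by blast
    obtain a where a: "a \<in> Hom C T (Dom C m)" "u = code (Dom C m) a" by (rule spec_point[OF A u(1)])
    have "code P (w x) = code P (Comp C m a)"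
      using u(2) a(2) fun_of_Spec[OF mH a(1)] decode_code[OF x] by (simp add: h_def)
    then have "w x = Comp C m a" by (rule code_inj[OF w[OF x] comp_in_hom[OF a(1) mH]])
    then show ?thesis using a(1) by auto
  qed
  \<comment> \<open>Together with \<open>lift\<close> this shows that the points of \<open>m\<close>
    are exactly those of the graph, each recovered from its first component.\<close>
  have graph: "Comp C m a = w (Comp C (\<pi> i) (Comp C m a))" if a: "a \<in> Hom C T (Dom C m)" for a
  proof -
    have "fun_of (amap Spec m) (code (Dom C m) a) \<in> h ` topspace (spec X)"
      using code_in_spec[OF a] m(2) by blast
    then obtain u where u: "u \<in> topspace (spec X)" "h u = fun_of (amap Spec m) (code (Dom C m) a)" by auto
    have "code P (w (decode X u)) = code P (Comp C m a)"
      using u(2) fun_of_Spec[OF mH a] by (simp add: h_def)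
    then have "w (decode X u) = Comp C m a"
      by (rule code_inj[OF w[OF dec(1)[OF u(1)]] comp_in_hom[OF a mH]])
    then show ?thesis using wi[OF dec(1)[OF u(1)]] by metis
  qed
  note rH = comp_in_hom[OF mH \<pi>i]
  have r_point: "Comp C (Comp C (\<pi> i) m) a = Comp C (\<pi> i) (Comp C m a)" if "a \<in> Hom C T (Dom C m)" for a
    by (rule comp_assoc[OF that mH \<pi>i, symmetric])
  \<comment> \<open>The first projection of the graph is injective on points by \<open>graph\<close>
    and surjective by \<open>lift\<close>, so it has a section. That section followed by the second
    projection is the arrow sought.\<close>
  have r: "Comp C (\<pi> i) m \<in> monos_into C X"
  proof (rule mono_if_injective_on_points[OF rH])
    fix a b assume a: "a \<in> Hom C T (Dom C m)" and b: "b \<in> Hom C T (Dom C m)"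
      and eq: "Comp C (Comp C (\<pi> i) m) a = Comp C (Comp C (\<pi> i) m) b"
    have "Comp C m a = Comp C m b"
      using graph[OF a] graph[OF b] eq r_point[OF a] r_point[OF b] by simp
    then show "a = b" by (rule monos_intoD[OF m(1) a b])
  qed
  obtain s where s: "s \<in> Hom C X (Dom C (Comp C (\<pi> i) m))" "Comp C (Comp C (\<pi> i) m) s = Ident C X"
  proof (rule section_if_surjective_on_points[OF r])
    fix x assume x: "x \<in> Hom C T X"
    obtain a where a: "a \<in> Hom C T (Dom C m)" "Comp C m a = w x" using lift[OF x] by blast
    then show "\<exists>a\<in>Hom C T (Dom C (Comp C (\<pi> i) m)). Comp C (Comp C (\<pi> i) m) a = x"
      using r_point[OF a(1)] wi[OF x] HomD(2)[OF rH] by auto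
  qed
  then have s: "s \<in> Hom C X (Dom C m)" "Comp C (Comp C (\<pi> i) m) s = Ident C X"
    using HomD(2)[OF rH] by simp_all
  note ms = comp_in_hom[OF s(1) mH]
  note f = comp_in_hom[OF ms \<pi>j]
  have "amap Spec (Comp C (\<pi> j) (Comp C m s)) = v"
  proof (rule Stone_ext[OF Spec_Hom[OF f] v])
    fix u assume "u \<in> topspace (spec X)"
    then obtain x where x: "x \<in> Hom C T X" "u = code X x" by (rule spec_point[OF X])
    note sx = comp_in_hom[OF x(1) s(1)]
    have "Comp C (\<pi> i) (Comp C m (Comp C s x)) = x"
      using r_point[OF sx] comp_assoc[OF x(1) s(1) rH] s(2) comp_ident_left[OF x(1)] by simp
    then have "Comp C m (Comp C s x) = w x" using graph[OF sx] by simp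
    then have "Comp C (Comp C (\<pi> j) (Comp C m s)) x = g x"
      using comp_assoc[OF x(1) ms \<pi>j] comp_assoc[OF x(1) s(1) mH] wj[OF x(1)] by simp
    then show "fun_of (amap Spec (Comp C (\<pi> j) (Comp C m s))) u = fun_of v u"
      using fun_of_Spec[OF f x(1)] x code_g[OF x(1)] by simp
  qed
  then show ?thesis using f by blast
qed

lemma continuous_map_clopen_choice:
  assumes V: "clopen_in Z V" and ab: "a \<in> topspace Y" "b \<in> topspace Y"
  shows "continuous_map Z Y (\<lambda>z. if z \<in> V then a else b)"
  unfolding continuous_map_def
proof (intro conjI allI impI)
  fix U
  have "{z \<in> topspace Z. (if z \<in> V then a else b) \<in> U} =
      (if a \<in> U then V \<inter> topspace Z else {}) \<union> (if b \<in> U then topspace Z - V else {})" by auto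
  moreover have "openin Z (V \<inter> topspace Z)" "openin Z (topspace Z - V)"
    using V clopen_in_complement[OF V] unfolding clopen_in_def by auto
  ultimately show "openin Z {z \<in> topspace Z. (if z \<in> V then a else b) \<in> U}" by auto
qed (use ab in simp)

text \<open>Here \<open>D = 1 + 1\<close>, and \<open>Z\<close> is embedded into a power of it by the characteristic functions of
  its clopen subsets.\<close>

lemma Spec_essentially_surjective:
  assumes Z: "Z \<in> Obj Stone"
  shows "\<exists>X\<in>Obj C. isomorphic_objects Stone (spec X) Z"
proof -
  obtain D \<iota> where D: "is_coproduct C {0, 1 :: nat} (\<lambda>_. T) D \<iota>"
    and \<iota>0: "\<iota> 0 \<in> Hom C T D" and \<iota>1: "\<iota> 1 \<in> Hom C T D"
    by (rule coproduct_exists[OF T_Obj])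
  note D_Obj = Hom_obj(2)[OF \<iota>0]
  \<comment> \<open>Equal injections would make \<open>T\<close> initial. The two distinct points of
    \<open>D\<close> serve as truth values of the characteristic functions.\<close>
  have ne: "\<iota> 0 \<noteq> \<iota> 1"
    using initial_if_injections_agree[OF D \<iota>0 \<iota>1] T_not_initial by blast
  let ?\<V> = "{V. clopen_in Z V}"
  have "?\<V> \<subseteq> Pow (topspace Z)" unfolding clopen_in_def using closedin_subset by blast
  then have small_V: "small TYPE('u) ?\<V>"
    by (rule small_subset[OF small_Pow[OF inaccessible Obj_StoneD(2)[OF Z]]])
  \<comment> \<open>The clopen sets are the coordinates; they are renamed by elements of
    \<open>'u\<close> to index an available product.\<close>
  obtain c :: "'u set \<Rightarrow> 'u" where c: "inj_on c ?\<V>"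
    by (rule small_code[OF small_V])
  let ?V = "inv_into ?\<V> c"
  have V: "clopen_in Z (?V i)" if "i \<in> c ` ?\<V>" for i
    using inv_into_into[OF that] by simp
  obtain P \<pi> where P: "P \<in> Obj C" and \<pi>_all: "\<forall>i\<in>c ` ?\<V>. \<pi> i \<in> Hom C P D"
    and ex: "\<forall>x. (\<forall>i\<in>c ` ?\<V>. x i \<in> Hom C T D) \<longrightarrow> (\<exists>w\<in>Hom C T P. \<forall>i\<in>c ` ?\<V>. Comp C (\<pi> i) w = x i)"
    and sep: "\<forall>w\<in>Hom C T P. \<forall>w'\<in>Hom C T P.
      (\<forall>i\<in>c ` ?\<V>. Comp C (\<pi> i) w = Comp C (\<pi> i) w') \<longrightarrow> w = w'"
    by (rule product_points_exist[OF complete small_image[OF small_V] D_Obj T_Obj])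
  note \<pi> = bspec[OF \<pi>_all]
  have "\<exists>w\<in>Hom C T P. \<forall>i\<in>c ` ?\<V>. Comp C (\<pi> i) w = (if z \<in> ?V i then \<iota> 0 else \<iota> 1)" for z
    by (rule ex[THEN spec, THEN mp]) (simp add: \<iota>0 \<iota>1[unfolded One_nat_def])
  then have "\<forall>z. \<exists>w. w \<in> Hom C T P \<and> (\<forall>i\<in>c ` ?\<V>. Comp C (\<pi> i) w = (if z \<in> ?V i then \<iota> 0 else \<iota> 1))"
    unfolding Bex_def by (rule allI)
  from choice[OF this] obtain w where
    w_all: "\<forall>z. w z \<in> Hom C T P \<and> (\<forall>i\<in>c ` ?\<V>. Comp C (\<pi> i) (w z) = (if z \<in> ?V i then \<iota> 0 else \<iota> 1))" ..
  have w: "w z \<in> Hom C T P" for z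
    by (rule conjunct1[OF spec[OF w_all]])
  have \<pi>w: "Comp C (\<pi> i) (w z) = (if z \<in> ?V i then \<iota> 0 else \<iota> 1)" if "i \<in> c ` ?\<V>" for z i
    by (rule bspec[OF conjunct2[OF spec[OF w_all]] that])
  define h where "h z = code P (w z)" for z
  have h: "continuous_map Z (spec P) h"
    unfolding h_def
  proof (rule continuous_into_spec_product[OF P \<pi>])
    show "a = b" if "a \<in> Hom C T P" "b \<in> Hom C T P"
      "\<And>i. i \<in> c ` ?\<V> \<Longrightarrow> Comp C (\<pi> i) a = Comp C (\<pi> i) b" for a b
      by (rule sep[rule_format, OF that])
    show "w z \<in> Hom C T P" for z by (rule w)
    fix i assume i: "i \<in> c ` ?\<V>"
    show "continuous_map Z (spec D) (\<lambda>z. code D (Comp C (\<pi> i) (w z)))"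
      by (rule continuous_map_eq[OF continuous_map_clopen_choice[OF V[OF i] code_in_spec[OF \<iota>0] code_in_spec[OF \<iota>1]]])
        (simp add: \<pi>w[OF i])
  qed
  have inj_h: "inj_on h (topspace Z)"
  proof (rule inj_onI, rule ccontr)
    fix y z assume y: "y \<in> topspace Z" and z: "z \<in> topspace Z" and eq: "h y = h z" and "y \<noteq> z"
    have "closedin Z {y}" by (rule closedin_Hausdorff_singleton[OF Obj_StoneD(4)[OF Z] y])
    moreover have "z \<notin> {y}" using \<open>y \<noteq> z\<close> by simp
    \<comment> \<open>The clopen \<open>U\<close> gives a coordinate in which \<open>w y\<close> and
      \<open>w z\<close> differ.\<close>
    ultimately obtain U where U: "clopen_in Z U" "{y} \<subseteq> U" "z \<notin> U"
      using Stone_space_clopen_separation[OF Obj_StoneD(1)[OF Z] _ z] by metis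
    have cU: "c U \<in> c ` ?\<V>" and VU: "?V (c U) = U"
      using U(1) inv_into_f_f[OF c] by auto
    have "w y = w z" using code_inj[OF w w] eq unfolding h_def by blast
    then show False using \<pi>w[OF cU, of y] \<pi>w[OF cU, of z] VU U(2,3) ne by simp
  qed
  obtain m where m: "m \<in> monos_into C P"
    "h ` topspace Z = fun_of (amap Spec m) ` topspace (spec (Dom C m))"
    by (rule image_is_subobject[OF h Z P])
  note mH = monos_into_Hom[OF m(1)]
  note A = Hom_obj(1)[OF mH]
  let ?A = "Dom C m"
  \<comment> \<open>As \<open>h\<close> maps \<open>Z\<close> injectively onto the points of
    \<open>m\<close>, its inverse identifies \<open>spec ?A\<close> with \<open>Z\<close>. It is
    continuous because \<open>h\<close> after it is the underlying map of
    \<open>amap Spec m\<close>.\<close>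
  let ?k = "\<lambda>u. inv_into (topspace Z) h (fun_of (amap Spec m) u)"
  have mem: "fun_of (amap Spec m) u \<in> h ` topspace Z" if "u \<in> topspace (spec ?A)" for u
    using that m(2) by blast
  have hk: "h (?k u) = fun_of (amap Spec m) u" if "u \<in> topspace (spec ?A)" for u
    by (rule f_inv_into_f[OF mem[OF that]])
  have kZ: "?k u \<in> topspace Z" if "u \<in> topspace (spec ?A)" for u
    by (rule inv_into_into[OF mem[OF that]])
  have k: "continuous_map (spec ?A) Z ?k"
  proof (rule continuous_map_inj_reflect)
    show "compact_space Z" by (rule Obj_StoneD(3)[OF Z])
    show "Hausdorff_space (spec P)" by (rule Obj_StoneD(4)[OF spec_Obj[OF P]])
    show "continuous_map Z (spec P) h" by (rule h)
    show "inj_on h (topspace Z)" by (rule inj_h)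
    show "?k \<in> topspace (spec ?A) \<rightarrow> topspace Z" using kZ by blast
    show "continuous_map (spec ?A) (spec P) (\<lambda>u. h (?k u))"
      by (rule continuous_map_eq[OF Hom_StoneD(3)[OF Spec_Hom[OF mH]]]) (simp add: hk)
  qed
  have kH: "arrow (spec ?A) ?k Z \<in> Hom Stone (spec ?A) Z"
    by (rule arrow_Hom[OF spec_Obj[OF A] Z k])
  have "bij_betw (fun_of (arrow (spec ?A) ?k Z)) (topspace (spec ?A)) (topspace Z)"
    unfolding bij_betw_def
  proof (intro conjI equalityI subsetI inj_onI)
    fix u v assume u: "u \<in> topspace (spec ?A)" and v: "v \<in> topspace (spec ?A)"
      and eq: "fun_of (arrow (spec ?A) ?k Z) u = fun_of (arrow (spec ?A) ?k Z) v"
    have "?k u = ?k v" using eq unfolding fun_of_arrow[OF u] fun_of_arrow[OF v] .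
    then have "h (?k u) = h (?k v)" by (rule arg_cong)
    then have "fun_of (amap Spec m) u = fun_of (amap Spec m) v" unfolding hk[OF u] hk[OF v] .
    then show "u = v" by (rule inj_onD[OF Spec_mono_inj[OF m(1)] _ u v])
  next
    fix z assume "z \<in> fun_of (arrow (spec ?A) ?k Z) ` topspace (spec ?A)"
    then obtain u where u: "u \<in> topspace (spec ?A)" "z = fun_of (arrow (spec ?A) ?k Z) u" by (rule imageE)
    show "z \<in> topspace Z" unfolding u(2) by (rule fun_of_in[OF kH u(1)])
  next
    fix z assume z: "z \<in> topspace Z"
    then obtain u where u: "u \<in> topspace (spec ?A)" "h z = fun_of (amap Spec m) u"
      using m(2) by blast
    have "?k u = z" using inv_into_f_f[OF inj_h z] unfolding u(2) .
    then have "z = fun_of (arrow (spec ?A) ?k Z) u" unfolding fun_of_arrow[OF u(1)] by (rule sym)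
    then show "z \<in> fun_of (arrow (spec ?A) ?k Z) ` topspace (spec ?A)"
      using u(1) by (rule image_eqI)
  qed
  then show ?thesis
    unfolding isomorphic_objects_def using A kH Stone_is_isoI[OF kH] by blast
qed

lemma equivalent_to_Stone: "equivalent_categories C (Stone :: ('u topology, _) cat)"
proof (rule equivalent_categoriesI[OF category_axioms category_Stone is_functor_Spec])
  fix X Y assume X: "X \<in> Obj C" and Y: "Y \<in> Obj C"
  show "bij_betw (amap Spec) (Hom C X Y) (Hom Stone (omap Spec X) (omap Spec Y))"
    unfolding bij_betw_def omap_Spec
  proof (intro conjI equalityI subsetI inj_onI)
    show "f = g" if "f \<in> Hom C X Y" "g \<in> Hom C X Y" "amap Spec f = amap Spec g" for f g
      by (rule Spec_faithful[OF that])
    show "v \<in> Hom Stone (spec X) (spec Y)" if "v \<in> amap Spec ` Hom C X Y" for v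
      using that Spec_Hom by blast
    show "v \<in> amap Spec ` Hom C X Y" if "v \<in> Hom Stone (spec X) (spec Y)" for v
      using Spec_full[OF X Y that] by blast
  qed
next
  fix Z :: "'u topology" assume "Z \<in> Obj Stone"
  then show "\<exists>X\<in>Obj C. isomorphic_objects Stone (omap Spec X) Z"
    unfolding omap_Spec by (rule Spec_essentially_surjective)
qed

end

theorem theorem7p6:
  fixes C :: "('o, 'a) cat"
  assumes "inaccessible TYPE('u)"
  shows "(positive_category (Stone :: ('u topology, _) cat) \<and>
          non_trivial (Stone :: ('u topology, _) cat) \<and>
          well_powered TYPE('u) (Stone :: ('u topology, _) cat) \<and>
          well_pointed TYPE('u) (Stone :: ('u topology, _) cat) \<and>
          strongly_filtral (Stone :: ('u topology, _) cat) \<and>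
          complete_category TYPE('u) (Stone :: ('u topology, _) cat)) \<and>
         (positive_category C \<and>
          non_trivial C \<and>
          well_powered TYPE('u) C \<and>
          well_pointed TYPE('u) C \<and>
          strongly_filtral C \<and>
          complete_category TYPE('u) C \<longrightarrow>
          equivalent_categories C (Stone :: ('u topology, _) cat))"
proof (intro conjI impI)
  assume C: "positive_category C \<and> non_trivial C \<and> well_powered TYPE('u) C \<and>
    well_pointed TYPE('u) C \<and> strongly_filtral C \<and> complete_category TYPE('u) C"
  then have cat: "category C"
    unfolding positive_category_def coherent_category_def regular_category_def by blast
  obtain T where T: "is_terminal C T" using C unfolding well_pointed_def by blast
  have "small TYPE('u) (Hom C T X)" if "X \<in> Obj C" for X
  proof -
    have "is_functor C (set_cat TYPE('u)) (pt C T)"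
      using C T unfolding well_pointed_def faithful_functor_def by blast
    then show ?thesis using that unfolding is_functor_def by (simp add: pt_def set_cat_def)
  qed
  \<comment> \<open>An injection is needed for every object at once, since \<open>code\<close> is a
    parameter of the locale.\<close>
  then have "\<forall>X\<in>Obj C. \<exists>c :: 'a \<Rightarrow> 'u. inj_on c (Hom C T X)"
    using small_code by metis
  then obtain code :: "'o \<Rightarrow> 'a \<Rightarrow> 'u" where "\<forall>X\<in>Obj C. inj_on (code X) (Hom C T X)"
    using bchoice[of "Obj C" "\<lambda>X c. inj_on c (Hom C T X)"] by blast
  then interpret filtral_category C T code
    using cat assms C T by (intro filtral_category.intro filtral_category_axioms.intro) auto
  show "equivalent_categories C (Stone :: ('u topology, _) cat)"
    by (rule equivalent_to_Stone)
qed (rule assms positive_Stone non_trivial_Stone well_powered_Stone well_pointed_Stone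
    strongly_filtral_Stone complete_Stone)+

end
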